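(* Let $d$ be an integer, let $\mathcal{S}$ be a triangulated $2d$-sphere, and let $\mathcal{L}$ be an induced subcomplex of $\mathcal{S}$ which is homeomorphic to the $(d-1)$-sphere. Let $\mathcal{B}$ be a triangulated $d$-ball whose boundary $\partial\mathcal{B}$ is simplicially isomorphic to $\mathcal{L}$ via a simplicial isomorphism $g:\partial\mathcal{B}\to\mathcal{L}$. Then the glued complex $\mathcal{S}_{\leq d}\cup_g\mathcal{B}$ is not the $d$-skeleton of any triangulated $2d$-sphere.
   Context: A triangulated $k$-sphere (resp. $k$-ball) is a finite simplicial complex whose underlying space is homeomorphic to the $k$-sphere (resp. $k$-ball); no piecewise linearity is assumed. $\mathcal{S}_{\leq d}$ denotes the $d$-skeleton of $\mathcal{S}$ (all faces of dimension at most $d$). $\mathcal{S}_{\leq d}\cup_g\mathcal{B}$ is the simplicial complex obtained by gluing $\mathcal{B}$ to $\mathcal{S}_{\leq d}$ by identifying $\partial\mathcal{B}$ with $\mathcal{L}\subseteq\mathcal{S}_{\le d}$ via $g$. An induced subcomplex of $\mathcal{S}$ is one consisting of all faces of $\mathcal{S}$ contained in some subset of the vertex set. *)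

theory Defs
  imports "HOL-Analysis.Analysis"
begin

definition simplicial_complex :: "'a set set \<Rightarrow> bool" where
  "simplicial_complex K \<longleftrightarrow> finite K \<and> (\<forall>\<sigma>\<in>K. finite \<sigma> \<and> \<sigma> \<noteq> {}) \<and>
     (\<forall>\<sigma>\<in>K. \<forall>\<tau>. \<tau> \<subseteq> \<sigma> \<and> \<tau> \<noteq> {} \<longrightarrow> \<tau> \<in> K)"

definition vertices :: "'a set set \<Rightarrow> 'a set" where
  "vertices K = \<Union>K"

text \<open>Standard geometric realization inside the space of functions
vertices -> reals (barycentric coordinates), with the product topology.\<close>
definition geometric_realization :: "'a set set \<Rightarrow> ('a \<Rightarrow> real) set" where
  "geometric_realization K =
     (\<Union>\<sigma>\<in>K. {f. (\<forall>v. 0 \<le> f v) \<and> (\<forall>v. v \<notin> \<sigma> \<longrightarrow> f v = 0) \<and> sum f \<sigma> = 1})"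

definition realization_top :: "'a set set \<Rightarrow> ('a \<Rightarrow> real) topology" where
  "realization_top K = subtopology (powertop_real UNIV) (geometric_realization K)"

definition nball :: "nat \<Rightarrow> (nat \<Rightarrow> real) topology" where
  "nball k = subtopology (Euclidean_space k) {x. (\<Sum>i<k. x i ^ 2) \<le> 1}"

definition triangulated_sphere :: "nat \<Rightarrow> 'a set set \<Rightarrow> bool" where
  "triangulated_sphere k K \<longleftrightarrow>
     simplicial_complex K \<and> realization_top K homeomorphic_space nsphere k"

definition triangulated_ball :: "nat \<Rightarrow> 'a set set \<Rightarrow> bool" where
  "triangulated_ball k K \<longleftrightarrow>
     simplicial_complex K \<and> realization_top K homeomorphic_space nball k"

definition skeleton :: "nat \<Rightarrow> 'a set set \<Rightarrow> 'a set set" where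
  "skeleton d K = {\<sigma>\<in>K. card \<sigma> \<le> d + 1}"

definition induced_subcomplex :: "'a set set \<Rightarrow> 'a set set \<Rightarrow> bool" where
  "induced_subcomplex L K \<longleftrightarrow> (\<exists>W. L = {\<sigma>\<in>K. \<sigma> \<subseteq> W})"

definition ball_boundary :: "nat \<Rightarrow> 'a set set \<Rightarrow> 'a set set" where
  "ball_boundary d B = {\<tau>. \<tau> \<noteq> {} \<and> (\<exists>\<rho>\<in>B. card \<rho> = d \<and> \<tau> \<subseteq> \<rho> \<and>
       card {\<sigma>\<in>B. card \<sigma> = d + 1 \<and> \<rho> \<subseteq> \<sigma>} = 1)}"

definition simplicial_isomorphism :: "('b \<Rightarrow> 'a) \<Rightarrow> 'b set set \<Rightarrow> 'a set set \<Rightarrow> bool" where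
  "simplicial_isomorphism g K1 K2 \<longleftrightarrow>
     bij_betw g (vertices K1) (vertices K2) \<and>
     (\<forall>\<sigma>. \<sigma> \<subseteq> vertices K1 \<longrightarrow> (\<sigma> \<in> K1 \<longleftrightarrow> g ` \<sigma> \<in> K2))"

text \<open>S_{<= d} glued with B along g : dB -> L (dB the boundary of B).
Vertices of S become Inl-vertices; vertices of B not on its boundary become
Inr-vertices; boundary vertices v of B are identified with Inl (g v).\<close>
definition glue_vertex :: "'b set set \<Rightarrow> ('b \<Rightarrow> 'a) \<Rightarrow> 'b \<Rightarrow> 'a + 'b" where
  "glue_vertex dB g v = (if v \<in> vertices dB then Inl (g v) else Inr v)"

definition glued_complex ::
  "nat \<Rightarrow> 'a set set \<Rightarrow> 'b set set \<Rightarrow> 'b set set \<Rightarrow> ('b \<Rightarrow> 'a) \<Rightarrow> ('a + 'b) set set" where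
  "glued_complex d S B dB g =
     (\<lambda>\<sigma>. Inl ` \<sigma>) ` skeleton d S \<union> (\<lambda>\<sigma>. glue_vertex dB g ` \<sigma>) ` B"

end

theory Submission
  imports Defs "HOL-Library.Z2" "HOL-Homology.Homology"
begin

text \<open>Chains are taken over the field with two elements. Suppose a sphere \<open>T\<close> has the \<open>d\<close>-skeleton
\<open>S\<^sub>\<le>\<^sub>d \<union> B\<close>. A minimal face \<open>\<sigma>\<close> of \<open>S\<close> that is not in \<open>T\<close> would be a minimal nonface of \<open>T\<close>, so by
Alexander duality the faces of \<open>T\<close> disjoint from \<open>\<sigma>\<close> form a complex with homology in dimension
\<open>2d + 1 - card \<sigma> < d\<close>. In this dimension the complex agrees with the union of the deletions of \<open>\<sigma>\<close> from
\<open>S\<close> and from \<open>B\<close>, which meet in the deletion from \<open>L\<close>; as \<open>L\<close> is induced, all three are acyclic, and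
Mayer-Vietoris gives a contradiction. Hence \<open>S \<subseteq> T\<close>, the fundamental cycle of \<open>S\<close> is the one of \<open>T\<close>,
and \<open>T = S\<close> has no room for the facets of \<open>B\<close>.

No piecewise linear structure is available, so the homology of links and the fact that a ridge lies in
two facets come from singular homology relative to the complement of a barycenter. Singular chains are
turned into simplicial ones by a Sperner labelling of a fine subdivision.\<close>

section \<open>Mod 2 chains on families of sets\<close>

text \<open>The number 2d fits because a face of \<open>S\<close> outside the d-skeleton has between
  d + 2 and 2d + 1 vertices: the dual degree, counted by cardinality, lies between 1 and d, so
  cycles and their fillings use at most d + 1 vertices, where \<open>T\<close> is known. Since
  \<open>L\<close> is induced, a face of \<open>S\<close> meets its vertices in a face of
  \<open>L\<close>; deleting it from \<open>B\<close> is deleting a boundary face. Such a face lies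
  in a ridge with a single facet, which kills the top cycles of its star. A combinatorial homology
  sphere is given by acyclic stars below top degree, a bound on face sizes and two facets per ridge;
  purity and strong connectedness follow. Coefficients mod 2 avoid orientations, but the singular
  groups are integral. A cycle mod 2 is lifted to an integral chain with even boundary where it
  matters, and the halved boundary is filled one degree lower. At most two facets meet at a ridge
  because the local group is cyclic or trivial; a single facet is excluded because the identity of a
  sphere cannot be deformed off a point.\<close>

definition bd :: "'v set \<Rightarrow> ('v set \<Rightarrow> bit) \<Rightarrow> 'v set \<Rightarrow> bit" where
  "bd V c \<rho> = (\<Sum>v\<in>V - \<rho>. c (insert v \<rho>))"

text \<open>Chains are total functions, and \<open>bd\<close> is evaluated at all sets, inside or
  outside \<open>A\<close>. A relative boundary is obtained by testing \<open>bd\<close> on members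
  of \<open>A\<close> only, so no quotient is formed.\<close>

definition chn :: "'v set set \<Rightarrow> nat \<Rightarrow> ('v set \<Rightarrow> bit) \<Rightarrow> bool" where
  "chn A k c \<longleftrightarrow> (\<forall>\<sigma>. c \<sigma> \<noteq> 0 \<longrightarrow> \<sigma> \<in> A \<and> card \<sigma> = k)"

text \<open>The degree is the cardinality, not the dimension. If the empty set is in \<open>A\<close> this is vanishing of
reduced homology; on the faces containing \<open>\<alpha>\<close> it is vanishing of the reduced homology of the link of
\<open>\<alpha>\<close>, with the degree shifted by \<open>card \<alpha>\<close>.\<close>
definition acyc :: "'v set \<Rightarrow> 'v set set \<Rightarrow> nat \<Rightarrow> bool" where
  "acyc V A k \<longleftrightarrow> (\<forall>c. chn A k c \<longrightarrow> (\<forall>\<rho>\<in>A. bd V c \<rho> = 0) \<longrightarrow>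
     (\<exists>y. chn A (Suc k) y \<and> (\<forall>\<rho>\<in>A. bd V y \<rho> = c \<rho>)))"

declare add_bit_eq_xor [simp del] mult_bit_eq_and [simp del]

lemma bit_add_self [simp]: "(x::bit) + x = 0"
  by (cases x) auto

lemma bd_add: "bd V (\<lambda>\<sigma>. c \<sigma> + e \<sigma>) \<rho> = bd V c \<rho> + bd V e \<rho>"
  by (simp add: bd_def sum.distrib)

lemma bd_zero [simp]: "bd V (\<lambda>\<sigma>. 0) \<rho> = 0"
  by (simp add: bd_def)

text \<open>Ordered pairs of distinct elements cancel with their swaps mod 2. Besides
  \<open>bd_bd\<close>, this gives the edge count in \<open>top_cycle\<close>.\<close>

lemma bit_sum_symmetric:
  fixes f :: "'v \<Rightarrow> 'v \<Rightarrow> bit"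
  assumes "finite W" and sym: "\<And>v w. f v w = f w v"
  shows "(\<Sum>v\<in>W. \<Sum>w\<in>W - {v}. f v w) = 0"
  using assms(1)
proof (induction W rule: finite_induct)
  case (insert x F)
  have 1: "(\<Sum>v\<in>F. \<Sum>w\<in>insert x F - {v}. f v w) = (\<Sum>v\<in>F. f v x + (\<Sum>w\<in>F - {v}. f v w))"
  proof (rule sum.cong)
    fix v assume v: "v \<in> F"
    then have "insert x F - {v} = insert x (F - {v})" using insert by auto
    then show "(\<Sum>w\<in>insert x F - {v}. f v w) = f v x + (\<Sum>w\<in>F - {v}. f v w)"
      using insert by simp
  qed simp
  have "(\<Sum>v\<in>insert x F. \<Sum>w\<in>insert x F - {v}. f v w) =
    (\<Sum>w\<in>F. f x w) + ((\<Sum>v\<in>F. f v x) + (\<Sum>v\<in>F. \<Sum>w\<in>F - {v}. f v w))"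
    using insert 1 by (simp add: sum.distrib)
  also have "(\<Sum>v\<in>F. f v x) = (\<Sum>w\<in>F. f x w)" using sym by simp
  finally show ?case using insert by (simp add: add.assoc [symmetric])
qed (simp only: sum.empty)

lemma bd_bd:
  assumes "finite V"
  shows "bd V (bd V c) \<rho> = 0"
proof -
  have "bd V (bd V c) \<rho> = (\<Sum>v\<in>V - \<rho>. \<Sum>w\<in>(V - \<rho>) - {v}. c (insert w (insert v \<rho>)))"
    unfolding bd_def by (intro sum.cong) auto
  also have "\<dots> = 0"
    by (rule bit_sum_symmetric) (use assms in \<open>auto simp: insert_commute\<close>)
  finally show ?thesis .
qed

lemma card_of_insert: "card (insert v \<sigma>) = Suc k \<Longrightarrow> v \<notin> \<sigma> \<Longrightarrow> card \<sigma> = k"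
  by (cases "finite \<sigma>") auto

lemma bd_nonzeroE:
  assumes "bd V c \<rho> \<noteq> 0"
  obtains v where "v \<in> V" "v \<notin> \<rho>" "c (insert v \<rho>) \<noteq> 0"
proof -
  have "\<exists>v\<in>V - \<rho>. c (insert v \<rho>) \<noteq> 0"
    using assms unfolding bd_def by (rule contrapos_np) (auto intro: sum.neutral)
  then show thesis using that by blast
qed

lemma card_of_bd: "chn A (Suc k) c \<Longrightarrow> bd V c \<sigma> \<noteq> 0 \<Longrightarrow> card \<sigma> = k"
  unfolding chn_def by (erule bd_nonzeroE) (blast intro: card_of_insert)

lemma bd_cong:
  assumes "\<And>v. v \<in> V \<Longrightarrow> v \<notin> \<rho> \<Longrightarrow> c (insert v \<rho>) = e (insert v \<rho>)"
  shows "bd V c \<rho> = bd V e \<rho>"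
  unfolding bd_def by (rule sum.cong[OF refl], rule assms) simp_all

lemma acycI:
  assumes "\<And>c. chn A k c \<Longrightarrow> (\<And>\<rho>. \<rho> \<in> A \<Longrightarrow> bd V c \<rho> = 0) \<Longrightarrow>
     \<exists>y. chn A (Suc k) y \<and> (\<forall>\<rho>\<in>A. bd V y \<rho> = c \<rho>)"
  shows "acyc V A k"
  unfolding acyc_def by (intro allI impI) (rule assms, assumption, erule bspec)

lemma acycD:
  assumes "acyc V A k" "chn A k c" "\<And>\<rho>. \<rho> \<in> A \<Longrightarrow> bd V c \<rho> = 0"
  shows "\<exists>y. chn A (Suc k) y \<and> (\<forall>\<rho>\<in>A. bd V y \<rho> = c \<rho>)"
  using assms by (simp add: acyc_def)

lemma chn_add: "chn A k c \<Longrightarrow> chn A k e \<Longrightarrow> chn A k (\<lambda>\<sigma>. c \<sigma> + e \<sigma>)"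
  unfolding chn_def
proof (intro allI impI)
  fix \<sigma>
  assume c: "\<forall>\<sigma>. c \<sigma> \<noteq> 0 \<longrightarrow> \<sigma> \<in> A \<and> card \<sigma> = k" "\<forall>\<sigma>. e \<sigma> \<noteq> 0 \<longrightarrow> \<sigma> \<in> A \<and> card \<sigma> = k"
    and "c \<sigma> + e \<sigma> \<noteq> 0"
  then have "c \<sigma> \<noteq> 0 \<or> e \<sigma> \<noteq> 0" by (auto simp del: bit_not_zero_iff)
  then show "\<sigma> \<in> A \<and> card \<sigma> = k"
    using c(1)[rule_format, of \<sigma>] c(2)[rule_format, of \<sigma>] by argo
qed

lemma chn_mono: "chn A k c \<Longrightarrow> A \<subseteq> A' \<Longrightarrow> chn A' k c"
  by (auto simp: chn_def)

definition rstr :: "'v set set \<Rightarrow> ('v set \<Rightarrow> bit) \<Rightarrow> 'v set \<Rightarrow> bit" where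
  "rstr A c \<sigma> = (if \<sigma> \<in> A then c \<sigma> else 0)"

text \<open>Stars and deletions are of this kind. Convexity makes the relative boundary square to
  zero: no intermediate set is lost by restriction.\<close>

definition convex_family :: "'v set set \<Rightarrow> bool" where
  "convex_family A \<longleftrightarrow> (\<forall>\<rho>\<in>A. \<forall>\<tau>\<in>A. \<forall>\<sigma>. \<rho> \<subseteq> \<sigma> \<longrightarrow> \<sigma> \<subseteq> \<tau> \<longrightarrow> \<sigma> \<in> A)"

lemma chn_rstr_bd:
  assumes "chn A (Suc k) c"
  shows "chn B k (rstr B (bd V c))"
  unfolding chn_def rstr_def using card_of_bd[OF assms] by simp

lemma convex_familyD:
  assumes "convex_family A" "\<rho> \<in> A" "insert w (insert v \<rho>) \<in> A"
  shows "insert v \<rho> \<in> A"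
  using assms(1)[unfolded convex_family_def, rule_format, OF assms(2,3), of "insert v \<rho>"]
  by (simp add: subset_insertI)

lemma bd_rstr_bd:
  assumes "finite V" "convex_family A" "chn A k c" "\<rho> \<in> A"
  shows "bd V (rstr A (bd V c)) \<rho> = 0"
proof -
  have "bd V (rstr A (bd V c)) \<rho> = bd V (bd V c) \<rho>"
  proof (rule bd_cong)
    fix v
    show "rstr A (bd V c) (insert v \<rho>) = bd V c (insert v \<rho>)"
    proof (cases "bd V c (insert v \<rho>) = 0")
      case False
      then obtain w where "c (insert w (insert v \<rho>)) \<noteq> 0" by (rule bd_nonzeroE)
      then have "insert w (insert v \<rho>) \<in> A" using assms(3) unfolding chn_def by blast
      then have "insert v \<rho> \<in> A" using convex_familyD[OF assms(2,4)] by blast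
      then show ?thesis by (simp add: rstr_def)
    qed (simp add: rstr_def)
  qed
  then show ?thesis by (simp add: bd_bd assms(1))
qed

text \<open>The lemmas \<open>acyc_upper\<close> and \<open>acyc_lower\<close> are pieces of the long exact homology sequence of
the pair \<open>(M, N)\<close>, in which \<open>U\<close> carries the relative chains.\<close>
locale upper_split =
  fixes V :: "'v set" and M U N :: "'v set set"
  assumes fin: "finite V"
    and M_eq: "M = N \<union> U" and disj: "N \<inter> U = {}"
    and upper: "\<And>\<sigma> \<tau>. \<sigma> \<in> U \<Longrightarrow> \<tau> \<in> M \<Longrightarrow> \<sigma> \<subseteq> \<tau> \<Longrightarrow> \<tau> \<in> U"
    and conv: "convex_family M"
begin

lemma bd_lower_on_upper:
  assumes "chn N k c" "\<rho> \<in> U" shows "bd V c \<rho> = 0"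
proof (rule ccontr)
  assume "bd V c \<rho> \<noteq> 0"
  then obtain v where "c (insert v \<rho>) \<noteq> 0" by (rule bd_nonzeroE)
  then have "insert v \<rho> \<in> N" using assms by (auto simp: chn_def)
  then show False using upper[of \<rho> "insert v \<rho>"] assms M_eq disj by blast
qed

text \<open>The connecting map: the boundary of a relative cycle on \<open>U\<close> is, within
  \<open>M\<close>, a cycle on \<open>N\<close>.\<close>

lemma chn_bd_lower:
  assumes "chn U (Suc k) c" "\<And>\<rho>. \<rho> \<in> U \<Longrightarrow> bd V c \<rho> = 0"
  shows "chn N k (rstr N (bd V c))" "\<And>\<rho>. \<rho> \<in> M \<Longrightarrow> rstr N (bd V c) \<rho> = bd V c \<rho>"
    "\<And>\<rho>. \<rho> \<in> N \<Longrightarrow> bd V (rstr N (bd V c)) \<rho> = 0"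
proof -
  show "rstr N (bd V c) \<rho> = bd V c \<rho>" if "\<rho> \<in> M" for \<rho>
    using that M_eq assms(2) by (auto simp: rstr_def)
  show "chn N k (rstr N (bd V c))"
    unfolding chn_def
  proof (intro allI impI conjI)
    fix \<sigma> assume nz: "rstr N (bd V c) \<sigma> \<noteq> 0"
    then show "\<sigma> \<in> N" by (auto simp: rstr_def split: if_splits)
    from nz have "bd V c \<sigma> \<noteq> 0" by (auto simp: rstr_def split: if_splits)
    with assms(1) show "card \<sigma> = k" by (rule card_of_bd)
  qed
  show "bd V (rstr N (bd V c)) \<rho> = 0" if "\<rho> \<in> N" for \<rho>
  proof -
    have "bd V (rstr N (bd V c)) \<rho> = bd V (bd V c) \<rho>"
    proof (rule bd_cong)
      fix v assume "v \<in> V" "v \<notin> \<rho>"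
      show "rstr N (bd V c) (insert v \<rho>) = bd V c (insert v \<rho>)"
      proof (cases "bd V c (insert v \<rho>) = 0")
        case False
        then obtain w where "c (insert w (insert v \<rho>)) \<noteq> 0" by (rule bd_nonzeroE)
        then have "insert w (insert v \<rho>) \<in> M" using assms M_eq by (auto simp: chn_def)
        then have "insert v \<rho> \<in> M"
          using convex_familyD[OF conv] that M_eq by blast
        then show ?thesis using M_eq assms(2)[of "insert v \<rho>"] False by (simp add: rstr_def) blast
      qed (simp add: rstr_def)
    qed
    then show ?thesis by (simp add: bd_bd fin)
  qed
qed

lemma bd_rstr_upper:
  assumes "chn M k c" "\<rho> \<in> U"
  shows "bd V (rstr U c) \<rho> = bd V c \<rho>"
proof (rule bd_cong)
  fix v
  show "rstr U c (insert v \<rho>) = c (insert v \<rho>)"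
  proof (cases "c (insert v \<rho>) = 0")
    case False
    then have "insert v \<rho> \<in> M" using assms(1) unfolding chn_def by blast
    then have "insert v \<rho> \<in> U" using upper[OF assms(2)] by blast
    then show ?thesis by (simp add: rstr_def)
  qed (simp add: rstr_def)
qed

lemma acyc_upper:
  assumes "acyc V M (Suc k)" "acyc V N k"
  shows "acyc V U (Suc k)"
proof (rule acycI)
  fix c assume c: "chn U (Suc k) c" "\<And>\<rho>. \<rho> \<in> U \<Longrightarrow> bd V c \<rho> = 0"
  note e = chn_bd_lower[OF c]
  obtain f where f: "chn N (Suc k) f" "\<forall>\<rho>\<in>N. bd V f \<rho> = rstr N (bd V c) \<rho>"
    using acycD[OF assms(2) e(1,3)] by blast
  \<comment> \<open>\<open>f\<close> closes up the boundary of \<open>c\<close>, so the sum is a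
    cycle on \<open>M\<close>; restricting its filling to \<open>U\<close> forgets
    \<open>f\<close>.\<close>
  have s: "chn M (Suc k) (\<lambda>\<sigma>. c \<sigma> + f \<sigma>)"
    using c f M_eq by (intro chn_add) (auto intro: chn_mono)
  have "bd V (\<lambda>\<sigma>. c \<sigma> + f \<sigma>) \<rho> = 0" if "\<rho> \<in> M" for \<rho>
    using that M_eq f c e(2)[of \<rho>] bd_lower_on_upper[OF f(1), of \<rho>] by (auto simp: bd_add)
  then obtain g where g: "chn M (Suc (Suc k)) g" "\<forall>\<rho>\<in>M. bd V g \<rho> = c \<rho> + f \<rho>"
    using acycD[OF assms(1) s] by blast
  show "\<exists>y. chn U (Suc (Suc k)) y \<and> (\<forall>\<rho>\<in>U. bd V y \<rho> = c \<rho>)"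
  proof (intro exI conjI ballI)
    show "chn U (Suc (Suc k)) (rstr U g)"
      using g(1) by (auto simp: chn_def rstr_def)
    fix \<rho> assume \<rho>: "\<rho> \<in> U"
    then have "f \<rho> = 0" using f(1) disj by (auto simp: chn_def)
    then show "bd V (rstr U g) \<rho> = c \<rho>"
      using bd_rstr_upper[OF g(1) \<rho>] g(2) \<rho> M_eq by simp
  qed
qed

text \<open>The first half of \<open>acyc_lower\<close>: the filling in \<open>M\<close> restricts
  to a relative cycle on \<open>U\<close>. It stands alone because \<open>U\<close> need not be
  acyclic in top degree, where \<open>acyc_deln_vertex\<close> treats that cycle by hand.\<close>

lemma acyc_lower_aux:
  assumes "acyc V M k" "chn N k c" "\<And>\<rho>. \<rho> \<in> N \<Longrightarrow> bd V c \<rho> = 0"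
  shows "\<exists>y. chn M (Suc k) y \<and> (\<forall>\<rho>\<in>M. bd V y \<rho> = c \<rho>) \<and> (\<forall>\<rho>\<in>U. bd V (rstr U y) \<rho> = 0)"
proof -
  have c: "chn M k c" using assms(2) M_eq by (auto intro: chn_mono)
  have z: "bd V c \<rho> = 0" if "\<rho> \<in> M" for \<rho>
    using that assms(3) M_eq bd_lower_on_upper[OF assms(2)] by blast
  obtain y where y: "chn M (Suc k) y" "\<forall>\<rho>\<in>M. bd V y \<rho> = c \<rho>"
    using acycD[OF assms(1) c z] by blast
  have "bd V (rstr U y) \<rho> = 0" if "\<rho> \<in> U" for \<rho>
  proof -
    have "\<rho> \<in> M" "\<rho> \<notin> N" using that M_eq disj by auto
    then have "c \<rho> = 0" using assms(2) unfolding chn_def by blast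
    then show ?thesis using bd_rstr_upper[OF y(1) that] y(2) \<open>\<rho> \<in> M\<close> by simp
  qed
  with y show ?thesis by blast
qed

lemma bd_zero_then_lower:
  assumes "chn M k y" "\<And>\<rho>. \<rho> \<in> M \<Longrightarrow> bd V y \<rho> = c \<rho>" "rstr U y = (\<lambda>_. 0)"
  shows "chn N k y \<and> (\<forall>\<rho>\<in>N. bd V y \<rho> = c \<rho>)"
proof -
  have "y \<sigma> = 0" if "\<sigma> \<in> U" for \<sigma>
    using fun_cong[OF assms(3), of \<sigma>] that by (simp add: rstr_def)
  then show ?thesis using assms M_eq unfolding chn_def by blast
qed

lemma acyc_lower:
  assumes "acyc V M k" "acyc V U (Suc k)"
  shows "acyc V N k"
proof (rule acycI)
  fix c assume c: "chn N k c" "\<And>\<rho>. \<rho> \<in> N \<Longrightarrow> bd V c \<rho> = 0"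
  obtain y where y: "chn M (Suc k) y" "\<forall>\<rho>\<in>M. bd V y \<rho> = c \<rho>"
    "\<forall>\<rho>\<in>U. bd V (rstr U y) \<rho> = 0"
    using acyc_lower_aux[OF assms(1) c] by blast
  have yU: "chn U (Suc k) (rstr U y)" using y(1) by (auto simp: chn_def rstr_def)
  obtain g where g: "chn U (Suc (Suc k)) g" "\<forall>\<rho>\<in>U. bd V g \<rho> = rstr U y \<rho>"
    using acycD[OF assms(2) yU y(3)[rule_format]] by blast
  \<comment> \<open>The part of \<open>y\<close> on \<open>U\<close> is bounded by \<open>g\<close>;
    adding the boundary of \<open>g\<close> cancels that part and leaves the boundary of
    \<open>y\<close> on \<open>M\<close> unchanged.\<close>
  let ?h = "\<lambda>\<sigma>. y \<sigma> + rstr M (bd V g) \<sigma>"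
  have gM: "chn M (Suc (Suc k)) g" using g(1) M_eq by (auto intro: chn_mono)
  have cg: "chn M (Suc k) (rstr M (bd V g))"
    using gM by (rule chn_rstr_bd)
  have bb: "bd V (rstr M (bd V g)) \<rho> = 0" if "\<rho> \<in> M" for \<rho>
    using fin conv gM that by (rule bd_rstr_bd)
  have 1: "chn M (Suc k) ?h" using y(1) cg by (rule chn_add)
  have 2: "bd V ?h \<rho> = c \<rho>" if "\<rho> \<in> M" for \<rho>
    using y(2)[rule_format, OF that] bb[OF that] by (simp add: bd_add)
  have "rstr U ?h \<sigma> = 0" for \<sigma>
  proof (cases "\<sigma> \<in> U")
    case True
    then have "bd V g \<sigma> = y \<sigma>" "\<sigma> \<in> M" using g(2) M_eq by (simp_all add: rstr_def)
    then show ?thesis by (simp add: rstr_def)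
  next
    case False
    then show ?thesis by (simp only: rstr_def if_False)
  qed
  then have 3: "rstr U ?h = (\<lambda>_. 0)" by (rule ext)
  note bd_zero_then_lower[of "Suc k" ?h c, OF 1 2 3]
  then show "\<exists>y. chn N (Suc k) y \<and> (\<forall>\<rho>\<in>N. bd V y \<rho> = c \<rho>)" by blast
qed

end

section \<open>Combinatorial homology spheres\<close>

text \<open>Up to a degree shift, the deletion of \<open>D\<close> from the link of \<alpha>. Two
  parameters allow induction by moving a vertex from \<open>D\<close> to \<alpha>: the members with
  \<open>w\<close> form a deletion again, and so do those without it
  (\<open>split_deln\<close>).\<close>

definition deln :: "'v set set \<Rightarrow> 'v set \<Rightarrow> 'v set \<Rightarrow> 'v set set" where
  "deln K \<alpha> D = {\<tau>\<in>K. \<alpha> \<subseteq> \<tau> \<and> \<tau> \<inter> D = {}}"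

abbreviation star :: "'v set set \<Rightarrow> 'v set \<Rightarrow> 'v set set" where
  "star K \<alpha> \<equiv> deln K \<alpha> {}"

lemma star_iff [simp]: "\<tau> \<in> star K \<alpha> \<longleftrightarrow> \<tau> \<in> K \<and> \<alpha> \<subseteq> \<tau>"
  by (simp add: deln_def)

locale augmented_complex =
  fixes V :: "'v set" and K :: "'v set set"
  assumes fin_V: "finite V" and K_sub: "K \<subseteq> Pow V" and empty_in: "{} \<in> K"
    and down: "\<And>\<sigma> \<tau>. \<sigma> \<in> K \<Longrightarrow> \<tau> \<subseteq> \<sigma> \<Longrightarrow> \<tau> \<in> K"
begin

lemma fin_K: "finite K"
  using fin_V K_sub by (meson finite_Pow_iff finite_subset)

lemma fin_face: "\<sigma> \<in> K \<Longrightarrow> finite \<sigma>"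
  using fin_V K_sub by (auto intro: finite_subset)

lemma convex_deln: "convex_family (deln K \<alpha> D)"
  unfolding convex_family_def deln_def using down by auto

lemma split_deln:
  assumes "w \<notin> \<alpha>"
  shows "upper_split V (deln K \<alpha> D) (deln K (insert w \<alpha>) D) (deln K \<alpha> (insert w D))"
proof
  show "finite V" by (rule fin_V)
  show "convex_family (deln K \<alpha> D)" by (rule convex_deln)
qed (auto simp: deln_def)

text \<open>Each vertex of \<open>D\<close> costs one application of \<open>acyc_lower\<close>,
  which shifts the degree, so the stars must be acyclic in all degrees. A ball has this at its
  boundary faces, which form \<open>J\<close> in the application.\<close>

lemma acyc_deln_of_stars:
  assumes J: "\<And>\<sigma> \<tau>. \<sigma> \<in> J \<Longrightarrow> \<tau> \<subseteq> \<sigma> \<Longrightarrow> \<tau> \<in> J"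
    and ac: "\<And>\<alpha> k. \<alpha> \<in> J \<Longrightarrow> acyc V (star K \<alpha>) k"
    and "finite D" "\<alpha> \<inter> D = {}" "\<alpha> \<union> D \<in> J"
  shows "acyc V (deln K \<alpha> D) k"
  using assms(3-5)
proof (induction D arbitrary: \<alpha> k rule: finite_induct)
  case empty
  then show ?case using ac by simp
next
  case (insert w D \<alpha> k)
  have "\<alpha> \<union> D \<in> J" using insert.prems by (auto intro: J[of "\<alpha> \<union> insert w D"])
  then have 1: "acyc V (deln K \<alpha> D) k" using insert by auto
  have 2: "acyc V (deln K (insert w \<alpha>) D) (Suc k)"
    using insert by (intro insert.IH) auto
  interpret upper_split V "deln K \<alpha> D" "deln K (insert w \<alpha>) D" "deln K \<alpha> (insert w D)"
    using insert by (intro split_deln) auto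
  show ?case using 1 2 by (rule acyc_lower)
qed

end

text \<open>What spheres and balls have in common. \<open>m\<close> is the number of vertices of a
  facet; degree \<open>m\<close> is left out of \<open>star_acyc\<close> because spheres have a
  cycle there. For \<open>\<alpha> = {}\<close> the condition concerns the whole complex.\<close>

locale pseudo_acyclic = augmented_complex +
  fixes m :: nat
  assumes star_acyc: "\<And>\<alpha> k. \<alpha> \<in> K \<Longrightarrow> k < m \<Longrightarrow> acyc V (star K \<alpha>) k"
    and card_le: "\<And>\<sigma>. \<sigma> \<in> K \<Longrightarrow> card \<sigma> \<le> m"
    and ridge_le: "\<And>\<rho>. \<rho> \<in> K \<Longrightarrow> Suc (card \<rho>) = m \<Longrightarrow> card {v\<in>V - \<rho>. insert v \<rho> \<in> K} \<le> 2"
begin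

text \<open>The star of a maximal face \<tau> is \<tau> alone, so its indicator is a relative cycle
  that nothing bounds; \<open>star_acyc\<close> rules this out below degree
  \<open>m\<close>.\<close>

lemma pure:
  assumes "\<alpha> \<in> K"
  obtains \<tau> where "\<tau> \<in> K" "\<alpha> \<subseteq> \<tau>" "card \<tau> = m"
proof -
  obtain \<tau> where \<tau>: "\<tau> \<in> K" "\<alpha> \<subseteq> \<tau>" and mx: "\<forall>\<sigma>\<in>K. \<tau> \<subseteq> \<sigma> \<longrightarrow> \<tau> = \<sigma>"
    using finite_has_maximal2[OF fin_K assms] by blast
  have "card \<tau> = m"
  proof (rule ccontr)
    assume "card \<tau> \<noteq> m"
    with card_le[OF \<tau>(1)] have lt: "card \<tau> < m" by simp
    let ?c = "\<lambda>\<sigma>. if \<sigma> = \<tau> then 1 else 0 :: bit"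
    have c: "chn (star K \<tau>) (card \<tau>) ?c" using \<tau> by (auto simp: chn_def)
    have z: "bd V ?c \<rho> = 0" if "\<rho> \<in> star K \<tau>" for \<rho>
      unfolding bd_def using that by (intro sum.neutral) auto
    obtain y where y: "chn (star K \<tau>) (Suc (card \<tau>)) y" "\<forall>\<rho>\<in>star K \<tau>. bd V y \<rho> = ?c \<rho>"
      using acycD[OF star_acyc[OF \<tau>(1) lt] c z] by blast
    have "y \<sigma> = 0" for \<sigma>
    proof (rule ccontr)
      assume "y \<sigma> \<noteq> 0"
      then have "\<sigma> \<in> K" "\<tau> \<subseteq> \<sigma>" "card \<sigma> = Suc (card \<tau>)" using y(1) by (auto simp: chn_def)
      then show False using mx by force
    qed
    then have "bd V y \<tau> = 0" by (simp add: bd_def)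
    then show False using y(2) \<tau> by simp
  qed
  with \<tau> that show thesis by blast
qed

text \<open>Strong connectedness, by induction on the dimension of the link. By induction the cycle
  is constant on the star of each \<open>insert v \<alpha>\<close>. Adjacent vertices of the link
  have the same constant, since an edge lies in a facet by \<open>pure\<close>, and the link is
  connected by acyclicity in degree \<open>Suc (card \<alpha>)\<close>.\<close>

lemma top_cycle:
  assumes "\<alpha> \<in> K" "chn (star K \<alpha>) m z" "\<And>\<rho>. \<rho> \<in> star K \<alpha> \<Longrightarrow> bd V z \<rho> = 0"
  shows "(\<forall>\<tau>. z \<tau> = 0) \<or> (\<forall>\<tau>\<in>star K \<alpha>. card \<tau> = m \<longrightarrow> z \<tau> = 1)"
  using assms
proof (induction "m - card \<alpha>" arbitrary: \<alpha> z rule: less_induct)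
  case less
  have zK: "\<tau> \<in> K \<and> \<alpha> \<subseteq> \<tau> \<and> card \<tau> = m" if "z \<tau> \<noteq> 0" for \<tau>
    using less.prems(2) that by (auto simp: chn_def)
  consider "card \<alpha> = m" | "Suc (card \<alpha>) = m" | "Suc (card \<alpha>) < m"
    using card_le[OF less.prems(1)] by linarith
  then show ?case
  proof cases
    case 1
    have eq: "\<tau> = \<alpha>" if "\<tau> \<in> K" "\<alpha> \<subseteq> \<tau>" "card \<tau> = m" for \<tau>
      using card_subset_eq[of \<tau> \<alpha>] that 1 fin_face by auto
    show ?thesis
    proof (cases "z \<alpha> = 0")
      case True
      then have "z \<tau> = 0" for \<tau> using zK[of \<tau>] eq[of \<tau>] by (cases "z \<tau> = 0") auto
      then show ?thesis by blast
    next
      case False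
      then have "z \<alpha> = 1" by simp
      then have "\<forall>\<tau>\<in>star K \<alpha>. card \<tau> = m \<longrightarrow> z \<tau> = 1" using eq by (metis star_iff)
      then show ?thesis by blast
    qed
  next
    case 2
    let ?W = "{v\<in>V - \<alpha>. insert v \<alpha> \<in> K}"
    have fW: "finite ?W" using fin_V by simp
    have form: "\<exists>v\<in>?W. \<tau> = insert v \<alpha>" if "\<tau> \<in> K" "\<alpha> \<subseteq> \<tau>" "card \<tau> = m" for \<tau>
    proof -
      have "card (\<tau> - \<alpha>) = 1"
        using that 2 fin_face[OF less.prems(1)] by (simp add: card_Diff_subset)
      then obtain v where "\<tau> - \<alpha> = {v}" by (auto simp: card_1_singleton_iff)
      then have "\<tau> = insert v \<alpha>" "v \<notin> \<alpha>" using that(2) by auto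
      then show ?thesis using that(1) K_sub by auto
    qed
    have sum: "(\<Sum>v\<in>?W. z (insert v \<alpha>)) = 0"
    proof -
      have "bd V z \<alpha> = (\<Sum>v\<in>?W. z (insert v \<alpha>))"
        unfolding bd_def
        by (rule sum.mono_neutral_right) (use fin_V zK in \<open>auto simp del: bit_not_zero_iff bit_not_one_iff\<close>)
      then show ?thesis using less.prems by simp
    qed
    show ?thesis
    proof (rule ccontr)
      assume "\<not> ?thesis"
      then obtain \<tau>\<^sub>0 \<tau>\<^sub>1 where t: "z \<tau>\<^sub>0 \<noteq> 0" "\<tau>\<^sub>1 \<in> K" "\<alpha> \<subseteq> \<tau>\<^sub>1" "card \<tau>\<^sub>1 = m" "z \<tau>\<^sub>1 \<noteq> 1"
        by auto
      obtain v where v: "v \<in> ?W" "\<tau>\<^sub>0 = insert v \<alpha>" using form zK[OF t(1)] by blast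
      obtain w where w: "w \<in> ?W" "\<tau>\<^sub>1 = insert w \<alpha>" using form t by blast
      have "v \<noteq> w" using v w t by auto
      moreover have "card ?W \<le> 2" using ridge_le[OF less.prems(1) 2] .
      ultimately have "?W = {v, w}"
        using card_seteq[of ?W "{v, w}"] v(1) w(1) fW by simp
      then have "(\<Sum>v\<in>?W. z (insert v \<alpha>)) = z \<tau>\<^sub>0 + z \<tau>\<^sub>1" using \<open>v \<noteq> w\<close> v w by simp
      then show False using sum t by simp
    qed
  next
    case 3
    have IH: "(\<forall>\<tau>\<in>star K (insert v \<alpha>). z \<tau> = 0) \<or> (\<forall>\<tau>\<in>star K (insert v \<alpha>). card \<tau> = m \<longrightarrow> z \<tau> = 1)"
      if "v \<notin> \<alpha>" "insert v \<alpha> \<in> K" for v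
    proof -
      interpret upper_split V "star K \<alpha>" "star K (insert v \<alpha>)" "deln K \<alpha> {v}"
        using that split_deln[of v \<alpha> "{}"] by simp
      let ?z = "rstr (star K (insert v \<alpha>)) z"
      have 1: "chn (star K (insert v \<alpha>)) m ?z" using less.prems(2) by (auto simp: chn_def rstr_def)
      have 2: "bd V ?z \<rho> = 0" if "\<rho> \<in> star K (insert v \<alpha>)" for \<rho>
        using bd_rstr_upper[OF less.prems(2) that] less.prems(3)[of \<rho>] that by simp
      have "m - card (insert v \<alpha>) < m - card \<alpha>"
        using that 3 fin_face[OF less.prems(1)] by simp
      have rz: "?z \<tau> = z \<tau>" if "\<tau> \<in> star K (insert v \<alpha>)" for \<tau>
        using that by (simp only: rstr_def if_True)
      from less.hyps[OF \<open>m - card (insert v \<alpha>) < m - card \<alpha>\<close> that(2) 1 2] show ?thesis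
        using rz by metis
    qed
    show ?thesis
    proof (rule ccontr)
      assume "\<not> ?thesis"
      then obtain \<tau>\<^sub>0 \<tau>\<^sub>1 where t: "z \<tau>\<^sub>0 \<noteq> 0" "\<tau>\<^sub>1 \<in> K" "\<alpha> \<subseteq> \<tau>\<^sub>1" "card \<tau>\<^sub>1 = m" "z \<tau>\<^sub>1 \<noteq> 1"
        by auto
      note t0 = zK[OF t(1)]
      have "\<alpha> \<noteq> \<tau>\<^sub>0" "\<alpha> \<noteq> \<tau>\<^sub>1" using t0 t 3 by auto
      then obtain a b where ab: "a \<in> \<tau>\<^sub>0" "a \<notin> \<alpha>" "b \<in> \<tau>\<^sub>1" "b \<notin> \<alpha>" using t0 t by blast
      have aK: "insert a \<alpha> \<in> K" and bK: "insert b \<alpha> \<in> K"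
        using ab t0 t down[of \<tau>\<^sub>0 "insert a \<alpha>"] down[of \<tau>\<^sub>1 "insert b \<alpha>"] by auto
      define P where "P = {v\<in>V - \<alpha>. insert v \<alpha> \<in> K \<and> (\<forall>\<tau>\<in>star K (insert v \<alpha>). card \<tau> = m \<longrightarrow> z \<tau> = 1)}"
      have abV: "a \<in> V" "b \<in> V" using aK bK K_sub by auto
      have aP: "a \<in> P" using IH[OF ab(2) aK] t(1) t0 ab abV aK unfolding P_def by auto
      have bP: "b \<notin> P" using t ab unfolding P_def by auto
      have fP: "finite P" using fin_V by (simp add: P_def)
      let ?c = "\<lambda>\<sigma>. (if \<sigma> = insert a \<alpha> then 1 else 0) + (if \<sigma> = insert b \<alpha> then 1 else 0) :: bit"
      have cc: "card (insert a \<alpha>) = Suc (card \<alpha>)" "card (insert b \<alpha>) = Suc (card \<alpha>)"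
        using ab fin_face[OF less.prems(1)] by auto
      have c: "chn (star K \<alpha>) (Suc (card \<alpha>)) ?c"
        using aK bK cc by (intro chn_add) (auto simp: chn_def)
      have ins: "insert v \<alpha> = insert u \<alpha> \<longleftrightarrow> v = u" if "v \<notin> \<alpha>" "u \<notin> \<alpha>" for u v
        using that by auto
      have z: "bd V ?c \<rho> = 0" if \<rho>: "\<rho> \<in> star K \<alpha>" for \<rho>
      proof (cases "\<rho> = \<alpha>")
        case True
        have "(\<Sum>v\<in>V - \<alpha>. (if insert v \<alpha> = insert u \<alpha> then 1 else 0)) = (1::bit)"
          if "u \<in> V" "u \<notin> \<alpha>" for u
        proof -
          have "(\<Sum>v\<in>V - \<alpha>. (if insert v \<alpha> = insert u \<alpha> then 1 else 0)) =
            (\<Sum>v\<in>V - \<alpha>. (if v = u then 1 else (0::bit)))"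
            using that by (intro sum.cong) (auto simp: ins)
          then show ?thesis using that fin_V by simp
        qed
        from this[OF abV(1) ab(2)] this[OF abV(2) ab(4)] True show ?thesis
          by (simp add: bd_def sum.distrib)
      next
        case False
        then obtain x where x: "x \<in> \<rho>" "x \<notin> \<alpha>" using \<rho> by auto
        have "insert v \<rho> \<noteq> insert u \<alpha>" if "v \<notin> \<rho>" for u v
        proof
          assume eq: "insert v \<rho> = insert u \<alpha>"
          then have "x \<in> insert u \<alpha>" "v \<in> insert u \<alpha>" using x by auto
          then show False using x that \<rho> by auto
        qed
        then show ?thesis unfolding bd_def by (intro sum.neutral) auto
      qed
      obtain e where e: "chn (star K \<alpha>) (Suc (Suc (card \<alpha>))) e" "\<forall>\<rho>\<in>star K \<alpha>. bd V e \<rho> = ?c \<rho>"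
        using acycD[OF star_acyc[OF less.prems(1) 3] c z] by blast
      \<comment> \<open>\<open>e\<close> is a path from \<open>a\<close> to \<open>b\<close> in the link of \<open>\<alpha>\<close>. Summing its boundary over \<open>P\<close> counts \<open>a\<close>
        but not \<open>b\<close>, while no edge of the link leaves \<open>P\<close>.\<close>
      let ?f = "\<lambda>v w. e (insert w (insert v \<alpha>))"
      have "(\<Sum>v\<in>P. bd V e (insert v \<alpha>)) = (\<Sum>v\<in>P. \<Sum>w\<in>P - {v}. ?f v w)"
      proof (rule sum.cong[OF refl])
        fix v assume v: "v \<in> P"
        show "bd V e (insert v \<alpha>) = (\<Sum>w\<in>P - {v}. ?f v w)"
          unfolding bd_def
        proof (rule sum.mono_neutral_right)
          show "finite (V - insert v \<alpha>)" using fin_V by simp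
          show "P - {v} \<subseteq> V - insert v \<alpha>" by (auto simp: P_def)
          show "\<forall>w\<in>V - insert v \<alpha> - (P - {v}). e (insert w (insert v \<alpha>)) = 0"
          proof (rule ballI, rule ccontr)
            fix w assume w: "w \<in> V - insert v \<alpha> - (P - {v})" and nz: "e (insert w (insert v \<alpha>)) \<noteq> 0"
            have vw: "insert w (insert v \<alpha>) \<in> K" using e(1) nz by (simp add: chn_def)
            then obtain \<tau> where \<tau>: "\<tau> \<in> K" "insert w (insert v \<alpha>) \<subseteq> \<tau>" "card \<tau> = m" by (rule pure)
            then have "z \<tau> = 1" using v by (simp add: P_def)
            moreover have "insert w \<alpha> \<in> K" using vw down[of "insert w (insert v \<alpha>)" "insert w \<alpha>"] by auto
            ultimately have "w \<in> P" using IH[of w] w \<tau> unfolding P_def by auto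
            then show False using w by auto
          qed
        qed
      qed
      also have "\<dots> = 0" using fP by (rule bit_sum_symmetric) (simp add: insert_commute)
      finally have "(\<Sum>v\<in>P. bd V e (insert v \<alpha>)) = 0" .
      moreover have "(\<Sum>v\<in>P. bd V e (insert v \<alpha>)) = (\<Sum>v\<in>P. if v = a then 1 else 0)"
      proof (rule sum.cong[OF refl])
        fix v assume v: "v \<in> P"
        then have "v \<noteq> b" "v \<notin> \<alpha>" "insert v \<alpha> \<in> star K \<alpha>" using bP by (auto simp: P_def)
        then show "bd V e (insert v \<alpha>) = (if v = a then 1 else 0)"
          using e(2) ins ab by simp
      qed
      ultimately show False using aP fP by simp
    qed
  qed
qed

end

section \<open>Deletions of faces and of nonfaces from a homology sphere\<close>

locale homology_sphere = pseudo_acyclic +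
  assumes ridge: "\<And>\<rho>. \<rho> \<in> K \<Longrightarrow> Suc (card \<rho>) = m \<Longrightarrow> card {v\<in>V - \<rho>. insert v \<rho> \<in> K} = 2"
begin

text \<open>The fundamental cycle mod 2 of the star of \<alpha>; for \<open>\<alpha> = {}\<close>,
  of the sphere.\<close>

definition facets :: "'a set \<Rightarrow> 'a set \<Rightarrow> bit" where
  "facets \<alpha> \<tau> = (if \<tau> \<in> star K \<alpha> \<and> card \<tau> = m then 1 else 0)"

lemma chn_facets: "chn (star K \<alpha>) m (facets \<alpha>)"
  by (simp add: chn_def facets_def)

lemma bd_facets:
  assumes "\<rho> \<in> star K \<alpha>"
  shows "bd V (facets \<alpha>) \<rho> = 0"
proof (cases "Suc (card \<rho>) = m")
  case True
  let ?W = "{v\<in>V - \<rho>. insert v \<rho> \<in> K}"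
  have "bd V (facets \<alpha>) \<rho> = (\<Sum>v\<in>?W. facets \<alpha> (insert v \<rho>))"
    unfolding bd_def by (rule sum.mono_neutral_right) (use fin_V in \<open>auto simp: facets_def\<close>)
  also have "\<dots> = (\<Sum>v\<in>?W. 1)"
    using assms True fin_face[of \<rho>] by (intro sum.cong) (auto simp: facets_def)
  also have "\<dots> = of_nat (card ?W)" by simp
  also have "\<dots> = 0" using ridge[of \<rho>] assms True by simp
  finally show ?thesis .
next
  case False
  then show ?thesis unfolding bd_def
    using assms fin_face[of \<rho>] by (intro sum.neutral) (auto simp: facets_def)
qed

text \<open>A sphere minus an open vertex star is a ball. The exact sequence settles degrees below
  \<open>m - 1\<close>. In degree \<open>m - 1\<close> the obstruction is the fundamental cycle of
  the star of \<open>insert w \<alpha>\<close>, which extends to the star of \<alpha>. In degree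
  \<open>m\<close> a cycle misses a facet through \<open>w\<close> and vanishes by
  \<open>top_cycle\<close>.\<close>

lemma acyc_deln_vertex:
  assumes "w \<notin> \<alpha>" "insert w \<alpha> \<in> K"
  shows "acyc V (deln K \<alpha> {w}) k"
proof -
  have \<alpha>: "\<alpha> \<in> K" using down[OF assms(2)] by auto
  interpret upper_split V "star K \<alpha>" "star K (insert w \<alpha>)" "deln K \<alpha> {w}"
    using assms split_deln[of w \<alpha> "{}"] by simp
  obtain \<tau>\<^sub>w where \<tau>w: "\<tau>\<^sub>w \<in> K" "insert w \<alpha> \<subseteq> \<tau>\<^sub>w" "card \<tau>\<^sub>w = m"
    using assms(2) by (rule pure)
  consider "Suc k < m" | "Suc k = m" | "k = m" | "m < k" by linarith
  then show ?thesis
  proof cases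
    case 1
    then show ?thesis using acyc_lower star_acyc[OF \<alpha>, of k] star_acyc[OF assms(2), of "Suc k"] by simp
  next
    case 2
    show ?thesis
    proof (rule acycI)
      fix c assume c: "chn (deln K \<alpha> {w}) k c" "\<And>\<rho>. \<rho> \<in> deln K \<alpha> {w} \<Longrightarrow> bd V c \<rho> = 0"
      have "acyc V (star K \<alpha>) k" using star_acyc[OF \<alpha>] 2 by simp
      from acyc_lower_aux[OF this c]
      obtain y where y: "chn (star K \<alpha>) (Suc k) y" "\<forall>\<rho>\<in>star K \<alpha>. bd V y \<rho> = c \<rho>"
        "\<forall>\<rho>\<in>star K (insert w \<alpha>). bd V (rstr (star K (insert w \<alpha>)) y) \<rho> = 0" by blast
      let ?r = "rstr (star K (insert w \<alpha>)) y"
      have "chn (star K (insert w \<alpha>)) m ?r" using y(1) 2 by (auto simp: chn_def rstr_def)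
      from top_cycle[OF assms(2) this] y(3)
      consider "\<forall>\<tau>. ?r \<tau> = 0" | "\<forall>\<tau>\<in>star K (insert w \<alpha>). card \<tau> = m \<longrightarrow> ?r \<tau> = 1" by blast
      then show "\<exists>y. chn (deln K \<alpha> {w}) (Suc k) y \<and> (\<forall>\<rho>\<in>deln K \<alpha> {w}. bd V y \<rho> = c \<rho>)"
      proof cases
        case 1
        then have 1: "?r = (\<lambda>_. 0)" by blast
        show ?thesis using bd_zero_then_lower[OF y(1) _ 1, of c] y(2) by blast
      next
        case all: 2
        \<comment> \<open>Here the part of \<open>y\<close> on faces containing \<open>w\<close> is
          the whole fundamental cycle. Adding \<open>facets \<alpha>\<close> cancels it without
          changing the boundary of \<open>y\<close>.\<close>
        let ?y = "\<lambda>\<sigma>. y \<sigma> + facets \<alpha> \<sigma>"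
        have 1: "chn (star K \<alpha>) (Suc k) ?y" using y(1) chn_facets[of \<alpha>] 2 by (intro chn_add) simp_all
        have 2: "bd V ?y \<rho> = c \<rho>" if "\<rho> \<in> star K \<alpha>" for \<rho>
          using y(2) bd_facets[OF that] that by (simp add: bd_add)
        have "rstr (star K (insert w \<alpha>)) ?y \<sigma> = 0" for \<sigma>
        proof (cases "\<sigma> \<in> star K (insert w \<alpha>)")
          case True
          show ?thesis
          proof (cases "card \<sigma> = m")
            case c: True
            have "?r \<sigma> = 1" using all True c by blast
            then have "y \<sigma> = 1" using True by (simp only: rstr_def if_True)
            moreover have "facets \<alpha> \<sigma> = 1" using True c by (simp add: facets_def)
            ultimately show ?thesis by (simp add: rstr_def)
          next
            case False
            have "y \<sigma> = 0" using y(1) False \<open>Suc k = m\<close> unfolding chn_def by blast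
            moreover have "facets \<alpha> \<sigma> = 0" using False by (simp add: facets_def)
            ultimately show ?thesis by (simp add: rstr_def)
          qed
        qed (simp only: rstr_def if_False)
        then have 3: "rstr (star K (insert w \<alpha>)) ?y = (\<lambda>_. 0)" by (rule ext)
        show ?thesis using bd_zero_then_lower[OF 1 2 3] by blast
      qed
    qed
  next
    case 3
    show ?thesis
    proof (rule acycI)
      fix c assume c: "chn (deln K \<alpha> {w}) k c" "\<And>\<rho>. \<rho> \<in> deln K \<alpha> {w} \<Longrightarrow> bd V c \<rho> = 0"
      have 1: "chn (star K \<alpha>) m c" using c(1) 3 M_eq by (auto intro: chn_mono)
      have 2: "bd V c \<rho> = 0" if "\<rho> \<in> star K \<alpha>" for \<rho>
        using that c(2) M_eq bd_lower_on_upper[OF c(1)] by blast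
      have "c \<tau>\<^sub>w = 0" using c(1) \<tau>w by (auto simp: chn_def deln_def)
      then have "\<forall>\<tau>. c \<tau> = 0" using top_cycle[OF \<alpha> 1 2] \<tau>w by auto
      then show "\<exists>y. chn (deln K \<alpha> {w}) (Suc k) y \<and> (\<forall>\<rho>\<in>deln K \<alpha> {w}. bd V y \<rho> = c \<rho>)"
        by (intro exI[of _ "\<lambda>_. 0"]) (simp add: chn_def)
    qed
  next
    case 4
    show ?thesis
    proof (rule acycI)
      fix c assume c: "chn (deln K \<alpha> {w}) k c"
      have "c \<tau> = 0" for \<tau>
        using c 4 card_le[of \<tau>] by (auto simp: chn_def deln_def)
      then show "\<exists>y. chn (deln K \<alpha> {w}) (Suc k) y \<and> (\<forall>\<rho>\<in>deln K \<alpha> {w}. bd V y \<rho> = c \<rho>)"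
        by (intro exI[of _ "\<lambda>_. 0"]) (simp add: chn_def)
    qed
  qed
qed

text \<open>The induction starts with one deleted vertex rather than none, because the undeleted
  star carries a fundamental cycle.\<close>

lemma acyc_deln:
  assumes "D \<noteq> {}" "\<alpha> \<inter> D = {}" "\<alpha> \<union> D \<in> K"
  shows "acyc V (deln K \<alpha> D) k"
proof -
  have "finite D" using fin_face[OF assms(3)] by simp
  then show ?thesis using assms
  proof (induction D arbitrary: \<alpha> k rule: finite_ne_induct)
    case (singleton w)
    then show ?case using acyc_deln_vertex[of w \<alpha>] by simp
  next
    case (insert w D \<alpha> k)
    have "\<alpha> \<union> D \<in> K" using insert.prems by (auto intro: down[of "\<alpha> \<union> insert w D"])
    then have 1: "acyc V (deln K \<alpha> D) k" using insert by auto
    have 2: "acyc V (deln K (insert w \<alpha>) D) (Suc k)"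
      using insert by (intro insert.IH) auto
    interpret upper_split V "deln K \<alpha> D" "deln K (insert w \<alpha>) D" "deln K \<alpha> (insert w D)"
      using insert by (intro split_deln) auto
    show ?case using 1 2 by (rule acyc_lower)
  qed
qed

text \<open>Alexander duality for the boundary of a simplex in the link of \<open>\<alpha>\<close>.\<close>
lemma not_acyc_deln:
  assumes "\<alpha> \<union> D \<notin> K" "\<alpha> \<inter> D = {}" "finite D" "D \<noteq> {}" "\<And>\<tau>. \<tau> \<subset> \<alpha> \<union> D \<Longrightarrow> \<tau> \<in> K"
  shows "\<exists>k. k + card D = Suc m \<and> \<not> acyc V (deln K \<alpha> D) k"
  using assms(3,4,1,2,5)
proof (induction D arbitrary: \<alpha> rule: finite_ne_induct)
  case (singleton w)
  have \<alpha>: "\<alpha> \<in> K" using singleton by (intro singleton.prems(3)) auto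
  \<comment> \<open>No face contains \<alpha> and \<open>w\<close> together, so nothing is deleted
    and the nonzero class is the fundamental cycle in degree \<open>m\<close>.\<close>
  have eq: "deln K \<alpha> {w} = star K \<alpha>"
    using singleton down[of _ "insert w \<alpha>"] by (auto simp: deln_def)
  have "\<not> acyc V (star K \<alpha>) m"
  proof
    assume "acyc V (star K \<alpha>) m"
    from acycD[OF this chn_facets bd_facets] obtain y where
      y: "chn (star K \<alpha>) (Suc m) y" "\<forall>\<rho>\<in>star K \<alpha>. bd V y \<rho> = facets \<alpha> \<rho>" by blast
    have "y \<sigma> = 0" for \<sigma> using y(1) card_le[of \<sigma>] by (auto simp: chn_def)
    then have "facets \<alpha> \<rho> = 0" if "\<rho> \<in> star K \<alpha>" for \<rho>
      using y(2) that by (simp add: bd_def)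
    moreover obtain \<tau> where "\<tau> \<in> K" "\<alpha> \<subseteq> \<tau>" "card \<tau> = m" using \<alpha> by (rule pure)
    moreover from this have "facets \<alpha> \<tau> = 1" "\<tau> \<in> star K \<alpha>" by (simp_all add: facets_def)
    ultimately show False by (metis zero_neq_one)
  qed
  then show ?case using eq by (intro exI[of _ m]) simp
next
  case (insert w D)
  have "\<exists>k. k + card D = Suc m \<and> \<not> acyc V (deln K (insert w \<alpha>) D) k"
    using insert.prems insert.hyps by (intro insert.IH) auto
  then obtain k where k: "k + card D = Suc m" "\<not> acyc V (deln K (insert w \<alpha>) D) k" by blast
  have 1: "acyc V (deln K \<alpha> D) j" for j
    using insert.prems insert.hyps by (intro acyc_deln insert.prems(3)) auto
  \<comment> \<open>Ensures that \<open>k\<close> is positive and can be lowered by one.\<close>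
  have "card (insert w D) \<le> Suc m"
  proof -
    obtain v where v: "v \<in> D" using insert.hyps by blast
    have "insert w D - {v} \<subset> \<alpha> \<union> insert w D" using v by blast
    then have "insert w D - {v} \<in> K" by (rule insert.prems(3))
    then have "card (insert w D - {v}) \<le> m" by (rule card_le)
    then show ?thesis using v insert.hyps by simp
  qed
  then obtain j where j: "k = Suc j" using k(1) insert.hyps by (cases k) auto
  interpret upper_split V "deln K \<alpha> D" "deln K (insert w \<alpha>) D" "deln K \<alpha> (insert w D)"
    using insert by (intro split_deln) auto
  \<comment> \<open>\<alpha> \<union> D is still a face, so \<open>deln K \<alpha> D\<close> is
    acyclic in all degrees and the nonzero class descends from degree \<open>Suc j\<close> to
    \<open>j\<close>.\<close>
  have "\<not> acyc V (deln K \<alpha> (insert w D)) j"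
    using acyc_upper[OF 1] k(2) j by blast
  then show ?case using k(1) j insert.hyps by (intro exI[of _ j]) simp
qed

end

context augmented_complex begin

text \<open>For \<open>\<alpha> = {}\<close> a deletion is closed under subsets, so the relative
  boundary is the absolute one. This allows chains of different complexes to be added in the gluing
  argument.\<close>

lemma bd_deletion_nonzero:
  assumes "chn (deln K {} D) k c" "bd V c \<rho> \<noteq> 0"
  shows "\<rho> \<in> deln K {} D"
proof -
  obtain v where "c (insert v \<rho>) \<noteq> 0" using assms(2) by (rule bd_nonzeroE)
  then have "insert v \<rho> \<in> deln K {} D" using assms(1) by (simp add: chn_def)
  then show ?thesis using down[of "insert v \<rho>" \<rho>] by (auto simp: deln_def)
qed

lemma acyc_deletionD:
  assumes "acyc V (deln K {} D) k" "chn (deln K {} D) k c" "\<And>\<rho>. bd V c \<rho> = 0"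
  obtains y where "chn (deln K {} D) (Suc k) y" "bd V y = c"
proof -
  obtain y where y: "chn (deln K {} D) (Suc k) y" "\<forall>\<rho>\<in>deln K {} D. bd V y \<rho> = c \<rho>"
    using acycD[OF assms] by blast
  have "bd V y \<rho> = c \<rho>" for \<rho>
  proof (cases "\<rho> \<in> deln K {} D")
    case False
    then have "bd V y \<rho> = 0" "c \<rho> = 0"
      using bd_deletion_nonzero[OF y(1)] assms(2) unfolding chn_def by blast+
    then show ?thesis by simp
  qed (use y in simp)
  with y that show thesis by blast
qed

end

section \<open>The gluing argument\<close>

text \<open>The boundary at \<rho> of a top cycle is its coefficient at the single facet there, so
  that coefficient is 0 and \<open>top_cycle\<close> makes the cycle zero. In a ball this covers
  every boundary face, as \<open>ball_boundary\<close> consists of the faces of such ridges.\<close>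

lemma (in pseudo_acyclic) star_acyc_free:
  assumes \<rho>: "\<alpha> \<subseteq> \<rho>" "\<rho> \<in> K" "Suc (card \<rho>) = m" "card {v\<in>V - \<rho>. insert v \<rho> \<in> K} = 1"
  shows "acyc V (star K \<alpha>) k"
proof -
  have \<alpha>: "\<alpha> \<in> K" using down[OF \<rho>(2,1)] .
  obtain v where v: "{v\<in>V - \<rho>. insert v \<rho> \<in> K} = {v}"
    using \<rho>(4) by (auto simp: card_1_singleton_iff)
  have vK: "insert v \<rho> \<in> K" "v \<in> V" "v \<notin> \<rho>" using v by auto
  have triv: "acyc V (star K \<alpha>) k" if "\<And>c. chn (star K \<alpha>) k c \<Longrightarrow> (\<And>\<rho>. \<rho> \<in> star K \<alpha> \<Longrightarrow> bd V c \<rho> = 0) \<Longrightarrow> c = (\<lambda>_. 0)"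
  proof (rule acycI)
    fix c assume "chn (star K \<alpha>) k c" "\<And>\<rho>. \<rho> \<in> star K \<alpha> \<Longrightarrow> bd V c \<rho> = 0"
    then have "c = (\<lambda>_. 0)" by (rule that)
    then show "\<exists>y. chn (star K \<alpha>) (Suc k) y \<and> (\<forall>\<rho>\<in>star K \<alpha>. bd V y \<rho> = c \<rho>)"
      by (intro exI[of _ "\<lambda>_. 0"]) (simp add: chn_def)
  qed
  consider "k < m" | "k = m" | "m < k" by linarith
  then show ?thesis
  proof cases
    case 1
    then show ?thesis using star_acyc[OF \<alpha>] by blast
  next
    case 2
    show ?thesis
    proof (rule triv)
      fix c assume c: "chn (star K \<alpha>) k c" and z: "\<And>\<rho>. \<rho> \<in> star K \<alpha> \<Longrightarrow> bd V c \<rho> = 0"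
      have "bd V c \<rho> = (\<Sum>v\<in>{v\<in>V - \<rho>. insert v \<rho> \<in> K}. c (insert v \<rho>))"
        unfolding bd_def
      proof (rule sum.mono_neutral_right)
        show "\<forall>v\<in>V - \<rho> - {v\<in>V - \<rho>. insert v \<rho> \<in> K}. c (insert v \<rho>) = 0"
          using c unfolding chn_def star_iff by blast
      qed (use fin_V in auto)
      then have "c (insert v \<rho>) = 0" using v z[of \<rho>] \<rho> by simp
      moreover have "insert v \<rho> \<in> star K \<alpha>" "card (insert v \<rho>) = m"
        using vK \<rho> fin_face[OF \<rho>(2)] by auto
      ultimately have "\<forall>\<tau>. c \<tau> = 0" using top_cycle[OF \<alpha> c[unfolded 2] z] by (metis zero_neq_one)
      then show "c = (\<lambda>_. 0)" by blast
    qed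
  next
    case 3
    show ?thesis
    proof (rule triv)
      fix c assume c: "chn (star K \<alpha>) k c"
      show "c = (\<lambda>_. 0)"
      proof
        fix \<tau> show "c \<tau> = 0" using c 3 card_le[of \<tau>] by (auto simp: chn_def)
      qed
    qed
  qed
qed

text \<open>All four complexes contain \<open>{}\<close> and share the vertex set \<open>V\<close>,
  with the gluing map already absorbed into the labels. The parameters \<open>Suc (2 * d)\<close>,
  \<open>d\<close> and \<open>Suc d\<close> are facet sizes, one more than the dimensions.\<close>

locale glued_skeleton =
  S: homology_sphere V S "Suc (2 * d)" + T: homology_sphere V T "Suc (2 * d)" +
  L: homology_sphere V L d + B: pseudo_acyclic V B "Suc d"
  for V :: "'v set" and d :: nat and S T L B W +
  assumes d_pos: "d > 0"
    and L_eq: "L = {\<sigma>\<in>S. \<sigma> \<subseteq> W}" and L_sub: "L \<subseteq> B" and W_eq: "W = \<Union>L"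
    and B_free: "\<And>\<alpha> k. \<alpha> \<in> L \<Longrightarrow> acyc V (star B \<alpha>) k"
    and S_Int_B: "\<And>\<sigma>. \<sigma> \<in> S \<Longrightarrow> \<sigma> \<in> B \<Longrightarrow> \<sigma> \<in> L"
    and vertices_Int: "\<Union>S \<inter> \<Union>B \<subseteq> W"
    and skel: "\<And>\<tau>. card \<tau> \<le> Suc d \<Longrightarrow> \<tau> \<in> T \<longleftrightarrow> \<tau> \<in> S \<or> \<tau> \<in> B"
begin

text \<open>Mayer-Vietoris on chains: a cycle splits into its part on \<open>S\<close> and the rest,
  which lies in \<open>B\<close>. Their common boundary lives on \<open>L\<close> and is filled
  there; both parts, closed up by this filling, are filled in their own complexes. The bound
  \<open>k \<le> d\<close> keeps everything where \<open>skel\<close> applies.\<close>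

lemma deletion_acyclic:
  assumes \<sigma>: "\<sigma> \<in> S" "\<sigma> \<noteq> {}" and k: "0 < k" "k \<le> d"
  shows "acyc V (deln T {} \<sigma>) k"
proof (rule acycI)
  fix c assume c: "chn (deln T {} \<sigma>) k c" and z': "\<And>\<rho>. \<rho> \<in> deln T {} \<sigma> \<Longrightarrow> bd V c \<rho> = 0"
  have z: "bd V c \<rho> = 0" for \<rho>
    using T.bd_deletion_nonzero[OF c, of \<rho>] z'[of \<rho>] by blast
  obtain k' where k': "k = Suc k'" using k by (cases k) auto
  define cS cB where "cS = rstr S c" and "cB = rstr (- S) c"
  have csum: "c \<sigma> = cS \<sigma> + cB \<sigma>" for \<sigma> by (simp add: cS_def cB_def rstr_def)
  have cS: "chn (deln S {} \<sigma>) k cS"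
    using c by (auto simp: cS_def chn_def rstr_def deln_def)
  have cB: "chn (deln B {} \<sigma>) k cB"
    unfolding chn_def
  proof (intro allI impI)
    fix \<tau> assume "cB \<tau> \<noteq> 0"
    then have "\<tau> \<notin> S" "c \<tau> \<noteq> 0" by (auto simp: cB_def rstr_def split: if_splits)
    with c have "\<tau> \<in> T" "\<tau> \<inter> \<sigma> = {}" "card \<tau> = k" unfolding chn_def deln_def by blast+
    with skel[of \<tau>] k \<open>\<tau> \<notin> S\<close> show "\<tau> \<in> deln B {} \<sigma> \<and> card \<tau> = k" by (auto simp: deln_def)
  qed
  have bdeq: "bd V cS \<rho> = bd V cB \<rho>" for \<rho>
  proof -
    have "bd V cS \<rho> + bd V cB \<rho> = bd V c \<rho>"
      unfolding bd_add[symmetric] csum[symmetric] ..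
    then have "(bd V cS \<rho> + bd V cB \<rho>) + bd V cB \<rho> = bd V cB \<rho>" using z by simp
    then show ?thesis by (simp add: add.assoc)
  qed
  define e where "e = bd V cB"
  \<comment> \<open>As \<open>L\<close> is induced, this is a face of \<open>L\<close>; it is all
    that \<open>L\<close> and \<open>B\<close> see of \<sigma>.\<close>
  define U where "U = W \<inter> \<sigma>"
  have UL: "U \<in> L" unfolding L_eq U_def using S.down[OF \<sigma>(1)] by auto
  have e: "chn (deln L {} \<sigma>) k' e"
    unfolding chn_def
  proof (intro allI impI)
    fix \<rho> assume nz: "e \<rho> \<noteq> 0"
    then have "\<rho> \<in> deln B {} \<sigma>" using B.bd_deletion_nonzero[OF cB] by (simp add: e_def)
    moreover have "\<rho> \<in> deln S {} \<sigma>" using nz S.bd_deletion_nonzero[OF cS] bdeq by (simp add: e_def)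
    moreover have "card \<rho> = k'" using nz card_of_bd[OF cB[unfolded k']] by (simp add: e_def)
    ultimately show "\<rho> \<in> deln L {} \<sigma> \<and> card \<rho> = k'" using S_Int_B by (auto simp: deln_def)
  qed
  have Ldel: "deln L {} \<sigma> = deln L {} U"
    unfolding U_def deln_def W_eq by blast
  have Lac: "acyc V (deln L {} \<sigma>) k'"
  proof (cases "U = {}")
    \<comment> \<open>Nothing is deleted from \<open>L\<close>, but \<open>k' < d\<close> is below
      the degree of its fundamental cycle.\<close>
    case True
    then show ?thesis using L.star_acyc[OF L.empty_in, of k'] Ldel k k' by simp
  next
    case False
    then show ?thesis using L.acyc_deln[of U "{}"] UL Ldel by simp
  qed
  have ez: "bd V e \<rho> = 0" for \<rho> unfolding e_def using L.fin_V by (rule bd_bd)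
  obtain y where y: "chn (deln L {} \<sigma>) (Suc k') y" "bd V y = e"
    using L.acyc_deletionD[OF Lac e ez] .
  have yk: "chn (deln L {} \<sigma>) k y" using y(1) k' by simp
  have LS: "deln L {} \<sigma> \<subseteq> deln S {} \<sigma>" using L_eq by (auto simp: deln_def)
  have LB: "deln L {} \<sigma> \<subseteq> deln B {} \<sigma>" using L_sub by (auto simp: deln_def)
  have Sac: "acyc V (deln S {} \<sigma>) k" using S.acyc_deln[of \<sigma> "{}"] \<sigma> by simp
  have Bdel: "deln B {} \<sigma> = deln B {} U"
    using vertices_Int \<sigma>(1) unfolding deln_def U_def by blast
  have Bac: "acyc V (deln B {} \<sigma>) k"
    unfolding Bdel
    by (rule B.acyc_deln_of_stars[of L]) (use L.down B_free UL L.fin_face in auto)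
  let ?s = "\<lambda>\<sigma>. cS \<sigma> + y \<sigma>" and ?b = "\<lambda>\<sigma>. cB \<sigma> + y \<sigma>"
  have s: "chn (deln S {} \<sigma>) k ?s" "bd V ?s \<rho> = 0" for \<rho>
    using chn_add[OF cS chn_mono[OF yk LS]] bdeq by (simp_all add: bd_add y(2) e_def)
  have b: "chn (deln B {} \<sigma>) k ?b" "bd V ?b \<rho> = 0" for \<rho>
    using chn_add[OF cB chn_mono[OF yk LB]] by (simp_all add: bd_add y(2) e_def)
  obtain fS where fS: "chn (deln S {} \<sigma>) (Suc k) fS" "bd V fS = ?s"
    using S.acyc_deletionD[OF Sac s] .
  obtain fB where fB: "chn (deln B {} \<sigma>) (Suc k) fB" "bd V fB = ?b"
    using B.acyc_deletionD[OF Bac b] .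
  have inT: "chn (deln T {} \<sigma>) (Suc k) f" if "chn (deln S {} \<sigma>) (Suc k) f \<or> chn (deln B {} \<sigma>) (Suc k) f" for f
    unfolding chn_def
  proof (intro allI impI)
    fix \<tau> assume "f \<tau> \<noteq> 0"
    with that have "\<tau> \<in> S \<or> \<tau> \<in> B" "\<tau> \<inter> \<sigma> = {}" "card \<tau> = Suc k"
      unfolding chn_def deln_def by auto
    with skel[of \<tau>] k show "\<tau> \<in> deln T {} \<sigma> \<and> card \<tau> = Suc k" by (auto simp: deln_def)
  qed
  show "\<exists>y. chn (deln T {} \<sigma>) (Suc k) y \<and> (\<forall>\<rho>\<in>deln T {} \<sigma>. bd V y \<rho> = c \<rho>)"
  proof (intro exI conjI ballI)
    show "chn (deln T {} \<sigma>) (Suc k) (\<lambda>\<sigma>. fS \<sigma> + fB \<sigma>)"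
      using inT fS(1) fB(1) by (intro chn_add) blast+
    fix \<rho>
    have "bd V (\<lambda>\<sigma>. fS \<sigma> + fB \<sigma>) \<rho> = (cS \<rho> + y \<rho>) + (cB \<rho> + y \<rho>)"
      by (simp add: bd_add fS(2) fB(2))
    also have "\<dots> = c \<rho> + (y \<rho> + y \<rho>)" by (simp only: csum ac_simps)
    finally show "bd V (\<lambda>\<sigma>. fS \<sigma> + fB \<sigma>) \<rho> = c \<rho>" by simp
  qed
qed

lemma S_subset_T: "\<sigma> \<in> S \<Longrightarrow> \<sigma> \<in> T"
proof (induction "card \<sigma>" arbitrary: \<sigma> rule: less_induct)
  case less
  have fin: "finite \<sigma>" using S.fin_face less.prems by simp
  show ?case
  proof (cases "card \<sigma> \<le> Suc d")
    case True
    then show ?thesis using skel less.prems by blast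
  next
    case False
    then have ne: "\<sigma> \<noteq> {}" by auto
    show ?thesis
    proof (rule ccontr)
      assume "\<sigma> \<notin> T"
      moreover have "\<tau> \<in> T" if "\<tau> \<subset> \<sigma>" for \<tau>
        using less.hyps[of \<tau>] psubset_card_mono[OF fin that] S.down[OF less.prems, of \<tau>] that by auto
      ultimately obtain k where k: "k + card \<sigma> = Suc (Suc (2 * d))" "\<not> acyc V (deln T {} \<sigma>) k"
        using T.not_acyc_deln[of "{}" \<sigma>] fin ne by auto
      have "0 < k" "k \<le> d" using k(1) False S.card_le[OF less.prems] by auto
      then show False using deletion_acyclic[OF less.prems ne] k(2) by blast
    qed
  qed
qed

lemma contradiction: False
proof -
  let ?z = "S.facets {}"
  have 1: "chn (star T {}) (Suc (2 * d)) ?z"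
    using S.chn_facets[of "{}"] by (rule chn_mono) (use S_subset_T in \<open>auto simp: deln_def\<close>)
  have 2: "bd V ?z \<rho> = 0" for \<rho>
    using S.bd_deletion_nonzero[OF S.chn_facets[of "{}"], of \<rho>] S.bd_facets[of \<rho> "{}"] by blast
  obtain \<tau> where \<tau>: "\<tau> \<in> S" "card \<tau> = Suc (2 * d)" using S.empty_in by (rule S.pure)
  then have "?z \<tau> = 1" by (simp add: S.facets_def)
  then have all: "?z \<tau> = 1" if "\<tau> \<in> T" "card \<tau> = Suc (2 * d)" for \<tau>
    using T.top_cycle[OF T.empty_in 1 2] that by (metis star_iff empty_subsetI zero_neq_one)
  have TS: "\<tau> \<in> S" if "\<tau> \<in> T" for \<tau>
  proof -
    obtain \<phi> where \<phi>: "\<phi> \<in> T" "\<tau> \<subseteq> \<phi>" "card \<phi> = Suc (2 * d)" using \<open>\<tau> \<in> T\<close> by (rule T.pure)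
    then have "\<phi> \<in> S" using all[of \<phi>] by (auto simp: S.facets_def split: if_splits)
    then show ?thesis using S.down \<phi> by blast
  qed
  obtain \<phi> where \<phi>: "\<phi> \<in> B" "card \<phi> = Suc d" using B.empty_in by (rule B.pure)
  \<comment> \<open>A facet of \<open>B\<close> has \<open>d + 1\<close> vertices, hence belongs to
    \<open>T\<close>, to \<open>S\<close> and finally to \<open>L\<close>, whose faces have at most
    \<open>d\<close>.\<close>
  then have "\<phi> \<in> L" using skel[of \<phi>] TS S_Int_B by simp
  then show False using L.card_le \<phi> by fastforce
qed

end

section \<open>From singular to simplicial chains\<close>

definition unit_pt :: "nat \<Rightarrow> nat \<Rightarrow> real" where
  "unit_pt i = (\<lambda>j. if j = i then 1 else 0)"

lemma unit_pt_in [simp]: "unit_pt i \<in> standard_simplex p \<longleftrightarrow> i \<le> p"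
  by (simp add: unit_pt_def)

definition vset :: "('b \<Rightarrow> 'a) \<Rightarrow> nat \<Rightarrow> ((nat \<Rightarrow> real) \<Rightarrow> 'b) \<Rightarrow> 'a set" where
  "vset v p f = (\<lambda>i. v (f (unit_pt i))) ` {..p}"

text \<open>The simplicial chain mod 2 induced by a vertex labelling \<open>v\<close>; singular simplices with repeated
labels are dropped.\<close>
definition simp_chain :: "('b \<Rightarrow> 'a) \<Rightarrow> nat \<Rightarrow> 'b chain \<Rightarrow> 'a set \<Rightarrow> bit" where
  "simp_chain v p c \<tau> = (if card \<tau> = Suc p
     then of_int (Poly_Mapping.lookup (frag_extend (\<lambda>f. frag_of (vset v p f)) c) \<tau>) else 0)"

lemma simp_chain_0 [simp]: "simp_chain v p 0 \<tau> = 0"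
  by (simp add: simp_chain_def)

lemma simp_chain_add: "simp_chain v p (a + b) \<tau> = simp_chain v p a \<tau> + simp_chain v p b \<tau>"
  by (simp add: simp_chain_def frag_extend_add lookup_add)

lemma simp_chain_cmul: "simp_chain v p (frag_cmul k a) \<tau> = of_int k * simp_chain v p a \<tau>"
  by (simp add: simp_chain_def frag_extend_cmul)

lemma of_int_bit_neg1: "(of_int ((- 1) ^ k) :: bit) = 1"
  by (induction k) auto

lemma simp_chain_sum: "simp_chain v p (sum h I) \<tau> = (\<Sum>i\<in>I. simp_chain v p (h i) \<tau>)"
  by (induction I rule: infinite_finite_induct) (simp_all add: simp_chain_add)

lemma simp_chain_diff: "simp_chain v p (a - b) \<tau> = simp_chain v p a \<tau> + simp_chain v p b \<tau>"
proof -
  have "simp_chain v p (a - b) \<tau> + simp_chain v p b \<tau> = simp_chain v p a \<tau>"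
    by (simp add: simp_chain_add[symmetric])
  then have "simp_chain v p a \<tau> + simp_chain v p b \<tau>
     = simp_chain v p (a - b) \<tau> + (simp_chain v p b \<tau> + simp_chain v p b \<tau>)"
    by (simp only: add.assoc[symmetric])
  then show ?thesis by simp
qed

lemma simp_chain_of:
  "simp_chain v p (frag_of f) \<tau> = (if card \<tau> = Suc p \<and> vset v p f = \<tau> then 1 else 0)"
  by (simp add: simp_chain_def)

lemma simp_chain_nonzeroE:
  assumes "simp_chain v p c \<tau> \<noteq> 0"
  obtains f where "f \<in> Poly_Mapping.keys c" "vset v p f = \<tau>" "card \<tau> = Suc p"
proof -
  have c: "card \<tau> = Suc p"
    and "Poly_Mapping.lookup (frag_extend (\<lambda>f. frag_of (vset v p f)) c) \<tau> \<noteq> 0"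
    using assms by (auto simp: simp_chain_def split: if_splits)
  then have "\<tau> \<in> Poly_Mapping.keys (frag_extend (\<lambda>f. frag_of (vset v p f)) c)"
    by (simp add: in_keys_iff)
  then obtain f where "f \<in> Poly_Mapping.keys c" "\<tau> \<in> Poly_Mapping.keys (frag_of (vset v p f))"
    using keys_frag_extend[of "\<lambda>f. frag_of (vset v p f)" c] by blast
  with c that show thesis by simp
qed

text \<open>The chain map property for one simplex with labels \<open>s\<close>. For injective
  \<open>s\<close> only the omission of the vertex with the extra label yields \<rho>. If two
  vertices share a label, every other omission keeps the repetition and has too few labels, while
  the omissions of these two yield the same set and cancel mod 2.\<close>

lemma count_faces:
  fixes s :: "nat \<Rightarrow> 'a"
  assumes V: "finite V" "s ` {..q} \<subseteq> V" and q: "card \<rho> = q" "q > 0"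
  shows "(\<Sum>k\<le>q. if s ` ({..q} - {k}) = \<rho> then 1 else (0::bit)) =
    (\<Sum>u\<in>V - \<rho>. if card (insert u \<rho>) = Suc q \<and> s ` {..q} = insert u \<rho> then 1 else 0)"
    (is "?L = ?R")
proof -
  have fin\<rho>: "finite \<rho>" using q card_ge_0_finite by auto
  show ?thesis
  proof (cases "inj_on s {..q}")
    case inj: True
    have im: "s ` ({..q} - {k}) = s ` {..q} - {s k}" if "k \<le> q" for k
      using inj_on_image_set_diff[OF inj, of "{..q}" "{k}"] that by simp
    have cs: "card (s ` {..q}) = Suc q" using card_image[OF inj] by simp
    show ?thesis
    proof (cases "\<rho> \<subseteq> s ` {..q}")
      case True
      then have "card (s ` {..q} - \<rho>) = 1" using cs q fin\<rho> by (simp add: card_Diff_subset)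
      then obtain u where u: "s ` {..q} - \<rho> = {u}" by (auto simp: card_1_singleton_iff)
      then have su: "s ` {..q} = insert u \<rho>" "u \<notin> \<rho>" using True by auto
      then obtain i where i: "i \<le> q" "s i = u" by (metis atMost_iff image_iff insertI1)
      have "?L = (\<Sum>k\<le>q. if k = i then 1 else 0)"
      proof (rule sum.cong[OF refl])
        fix k assume k: "k \<in> {..q}"
        have "s ` ({..q} - {k}) = \<rho> \<longleftrightarrow> k = i"
        proof
          assume "s ` ({..q} - {k}) = \<rho>"
          then have "s k = u" using im[of k] k su by (auto simp: image_iff)
          then show "k = i" using inj i k by (auto simp: inj_on_def)
        next
          assume "k = i"
          then show "s ` ({..q} - {k}) = \<rho>" using im[of k] i su by auto
        qed
        then show "(if s ` ({..q} - {k}) = \<rho> then 1 else 0) = (if k = i then 1 else (0::bit))" by simp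
      qed
      also have "\<dots> = 1" using i by simp
      finally have L: "?L = 1" .
      have "?R = (\<Sum>w\<in>V - \<rho>. if w = u then 1 else 0)"
        using su fin\<rho> q by (intro sum.cong[OF refl]) (auto simp: insert_eq_iff)
      also have "\<dots> = 1" using su V by auto
      finally show ?thesis using L by simp
    next
      case False
      have "?L = 0" using False by (intro sum.neutral) auto
      moreover have "?R = 0" using False by (intro sum.neutral) auto
      ultimately show ?thesis by simp
    qed
  next
    case False
    then obtain i j where ij: "i \<le> q" "j \<le> q" "i \<noteq> j" "s i = s j" by (auto simp: inj_on_def)
    have "card (s ` {..q}) \<noteq> Suc q"
      using False by (metis card_atMost eq_card_imp_inj_on finite_atMost)
    then have "?R = 0" by (intro sum.neutral) auto
    moreover have "?L = 0"
    proof -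
      have no: "s ` ({..q} - {k}) \<noteq> \<rho>" if "k \<le> q" "k \<noteq> i" "k \<noteq> j" for k
      proof
        assume "s ` ({..q} - {k}) = \<rho>"
        then have "card (s ` ({..q} - {k})) = card ({..q} - {k})" using q that by simp
        then have "inj_on s ({..q} - {k})" by (intro eq_card_imp_inj_on) auto
        then show False using ij that by (auto simp: inj_on_def)
      qed
      have "s ` ({..q} - {i}) = s ` {..q}" "s ` ({..q} - {j}) = s ` {..q}"
        using ij by (auto simp: image_iff) (metis Diff_iff atMost_iff empty_iff insert_iff)+
      then have same: "s ` ({..q} - {i}) = s ` ({..q} - {j})" by simp
      have "?L = (\<Sum>k\<in>{i, j}. if s ` ({..q} - {k}) = \<rho> then 1 else (0::bit))"
        by (rule sum.mono_neutral_right) (use ij no in auto)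
      then show ?thesis using ij(3) same by simp
    qed
    ultimately show ?thesis by simp
  qed
qed

lemma vset_face:
  assumes "k \<le> Suc p"
  shows "vset v p (singular_face (Suc p) k f) = (\<lambda>i. v (f (unit_pt i))) ` ({..Suc p} - {k})"
proof -
  have face: "singular_face (Suc p) k f (unit_pt i) = f (unit_pt (if i < k then i else Suc i))"
    if "i \<le> p" for i
  proof -
    have "simplical_face k (unit_pt i) = unit_pt (if i < k then i else Suc i)"
      by (auto simp: simplical_face_def unit_pt_def fun_eq_iff)
    then show ?thesis using that by (simp add: singular_face_def)
  qed
  have "(\<lambda>i. if i < k then i else Suc i) ` {..p} = {..Suc p} - {k}" (is "?g ` _ = _")
  proof (intro equalityI subsetI)
    fix x assume x: "x \<in> {..Suc p} - {k}"
    then show "x \<in> ?g ` {..p}"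
      using assms by (cases "x < k") (force intro: image_eqI[of _ _ x] image_eqI[of _ _ "x - 1"])+
  qed auto
  then have "(\<lambda>i. v (f (unit_pt i))) ` ({..Suc p} - {k}) = (\<lambda>i. v (f (unit_pt i))) ` (?g ` {..p})"
    by (simp only:)
  also have "\<dots> = (\<lambda>i. v (f (unit_pt (?g i)))) ` {..p}" by (simp only: image_image)
  also have "\<dots> = vset v p (singular_face (Suc p) k f)"
    unfolding vset_def by (intro image_cong refl) (simp add: face)
  finally show ?thesis by (rule sym)
qed

lemma simp_chain_boundary:
  assumes V: "finite V" and keys: "\<And>f. f \<in> Poly_Mapping.keys c \<Longrightarrow> vset v (Suc p) f \<subseteq> V"
  shows "simp_chain v p (chain_boundary (Suc p) c) \<rho> = bd V (simp_chain v (Suc p) c) \<rho>"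
proof -
  have "Poly_Mapping.keys c \<subseteq> {f. vset v (Suc p) f \<subseteq> V}" using keys by auto
  then show ?thesis
  proof (induction c rule: frag_induction)
    case zero
    then show ?case by (simp add: bd_def)
  next
    case (one f)
    let ?s = "\<lambda>i. v (f (unit_pt i))"
    have "simp_chain v p (chain_boundary (Suc p) (frag_of f)) \<rho>
      = (\<Sum>k\<le>Suc p. if card \<rho> = Suc p \<and> ?s ` ({..Suc p} - {k}) = \<rho> then 1 else 0)"
      unfolding chain_boundary_of
      by (simp only: simp_chain_sum nat.distinct if_False, rule sum.cong[OF refl])
        (simp add: simp_chain_cmul simp_chain_of of_int_bit_neg1[simplified] vset_face)
    also have "\<dots> = (\<Sum>u\<in>V - \<rho>. if card (insert u \<rho>) = Suc (Suc p) \<and> ?s ` {..Suc p} = insert u \<rho> then 1 else 0)"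
    proof (cases "card \<rho> = Suc p")
      case True
      have "?s ` {..Suc p} \<subseteq> V" using one by (simp only: vset_def mem_Collect_eq)
      from count_faces[OF V this True zero_less_Suc] show ?thesis by (simp only: True simp_thms)
    next
      case False
      have "card (insert u \<rho>) \<noteq> Suc (Suc p)" if "u \<notin> \<rho>" for u
        using that card_of_insert[of u \<rho> "Suc p"] False by argo
      then have "(\<Sum>u\<in>V - \<rho>. if card (insert u \<rho>) = Suc (Suc p) \<and> ?s ` {..Suc p} = insert u \<rho> then 1 else (0::bit)) = 0"
        by (intro sum.neutral) auto
      moreover have "(\<Sum>k\<le>Suc p. if card \<rho> = Suc p \<and> ?s ` ({..Suc p} - {k}) = \<rho> then 1 else (0::bit)) = 0"
        using False by (intro sum.neutral) auto
      ultimately show ?thesis by (simp only:)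
    qed
    also have "\<dots> = bd V (simp_chain v (Suc p) (frag_of f)) \<rho>"
      unfolding bd_def simp_chain_of vset_def ..
    finally show ?case .
  next
    case (diff a b)
    have "simp_chain v (Suc p) (a - b) = (\<lambda>\<tau>. simp_chain v (Suc p) a \<tau> + simp_chain v (Suc p) b \<tau>)"
      by (rule ext) (rule simp_chain_diff)
    then show ?case unfolding chain_boundary_diff simp_chain_diff diff by (simp only: bd_add)
  qed
qed

section \<open>Iterated barycentric subdivision\<close>

abbreviation sdiv :: "nat \<Rightarrow> nat \<Rightarrow> 'a chain \<Rightarrow> 'a chain" where
  "sdiv p N \<equiv> (singular_subdivision p ^^ N)"

lemma singular_subdivision_cmul: "singular_subdivision p (frag_cmul k c) = frag_cmul k (singular_subdivision p c)"
  by (simp add: singular_subdivision_def frag_extend_cmul)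

lemma sdiv_add: "sdiv p N (a + b) = sdiv p N a + sdiv p N b"
  by (induction N) (simp_all add: singular_subdivision_add)

lemma sdiv_cmul: "sdiv p N (frag_cmul k c) = frag_cmul k (sdiv p N c)"
  by (induction N) (simp_all add: singular_subdivision_cmul)

lemma sdiv_sum: "sdiv p N (sum h I) = (\<Sum>i\<in>I. sdiv p N (h i))"
  by (induction I rule: infinite_finite_induct) (simp_all add: sdiv_add)

lemma singular_chain_sdiv: "singular_chain p X c \<Longrightarrow> singular_chain p X (sdiv p N c)"
  by (induction N) (simp_all add: singular_chain_singular_subdivision)

lemma chain_boundary_sdiv:
  assumes "singular_chain (Suc p) X c"
  shows "chain_boundary (Suc p) (sdiv (Suc p) N c) = sdiv p N (chain_boundary (Suc p) c)"
proof (induction N)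
  case (Suc N)
  then show ?case
    using chain_boundary_singular_subdivision[OF singular_chain_sdiv[OF assms]] by simp
qed simp

lemma frag_cmul_sum_left: "(\<Sum>i\<in>I. frag_cmul (h i) c) = frag_cmul (sum h I) c"
  by (induction I rule: infinite_finite_induct) (simp_all add: frag_cmul_distrib)

lemma sdiv_zero: "singular_chain 0 X c \<Longrightarrow> sdiv 0 N c = c"
  by (induction N) (simp_all add: singular_subdivision_zero)

section \<open>Affine simplices and simplicial chains inside the realization\<close>

definition rk :: "('a \<Rightarrow> nat) \<Rightarrow> 'a set \<Rightarrow> 'a \<Rightarrow> nat" where
  "rk ix \<tau> v = card {u\<in>\<tau>. ix u < ix v}"

lemma rk_bij:
  assumes "finite \<tau>" "inj_on ix \<tau>"
  shows "bij_betw (rk ix \<tau>) \<tau> {..<card \<tau>}"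
proof -
  have less: "rk ix \<tau> u < rk ix \<tau> v" if "u \<in> \<tau>" "v \<in> \<tau>" "ix u < ix v" for u v
    unfolding rk_def using that assms(1) by (intro psubset_card_mono) auto
  have inj: "inj_on (rk ix \<tau>) \<tau>"
  proof (rule inj_onI, rule ccontr)
    fix u v assume uv: "u \<in> \<tau>" "v \<in> \<tau>" "rk ix \<tau> u = rk ix \<tau> v" "u \<noteq> v"
    then have "ix u \<noteq> ix v" using assms(2) by (auto simp: inj_on_def)
    then show False using less[of u v] less[of v u] uv by (cases "ix u < ix v") auto
  qed
  have "rk ix \<tau> v < card \<tau>" if "v \<in> \<tau>" for v
    unfolding rk_def using that assms(1) by (intro psubset_card_mono) auto
  then have "rk ix \<tau> ` \<tau> \<subseteq> {..<card \<tau>}" by auto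
  then have "rk ix \<tau> ` \<tau> = {..<card \<tau>}"
    using card_image[OF inj] by (intro card_subset_eq) auto
  with inj show ?thesis by (simp add: bij_betw_def)
qed

text \<open>Positions after \<open>u\<close> drop by one and earlier ones stay, which is the
  reindexing done by \<open>simplical_face\<close> at position
  \<open>rk ix \<tau> u\<close>.\<close>

lemma rk_remove:
  assumes "finite \<tau>" "u \<in> \<tau>" "v \<in> \<tau>"
  shows "ix u < ix v \<Longrightarrow> rk ix \<tau> u < rk ix \<tau> v \<and> rk ix \<tau> v = Suc (rk ix (\<tau> - {u}) v)"
    and "ix v < ix u \<Longrightarrow> rk ix \<tau> v < rk ix \<tau> u \<and> rk ix (\<tau> - {u}) v = rk ix \<tau> v"
proof -
  have less: "rk ix \<tau> u < rk ix \<tau> v" if "u \<in> \<tau>" "ix u < ix v" for u v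
    unfolding rk_def using that assms(1) by (intro psubset_card_mono) auto
  show "rk ix \<tau> u < rk ix \<tau> v \<and> rk ix \<tau> v = Suc (rk ix (\<tau> - {u}) v)" if "ix u < ix v"
  proof -
    have "{w\<in>\<tau>. ix w < ix v} = insert u {w\<in>\<tau> - {u}. ix w < ix v}" using that assms by auto
    then show ?thesis using assms(1) less[OF assms(2) that] by (simp add: rk_def)
  qed
  show "rk ix \<tau> v < rk ix \<tau> u \<and> rk ix (\<tau> - {u}) v = rk ix \<tau> v" if "ix v < ix u"
  proof -
    have "{w\<in>\<tau>. ix w < ix v} = {w\<in>\<tau> - {u}. ix w < ix v}" using that assms by auto
    then show ?thesis using less[OF assms(3) that] by (simp add: rk_def)
  qed
qed

definition cell :: "'a set \<Rightarrow> ('a \<Rightarrow> real) set" where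
  "cell \<sigma> = {f. (\<forall>v. 0 \<le> f v) \<and> (\<forall>v. v \<notin> \<sigma> \<longrightarrow> f v = 0) \<and> sum f \<sigma> = 1}"

lemma geometric_realization_cells: "geometric_realization K = (\<Union>\<sigma>\<in>K. cell \<sigma>)"
  by (simp add: geometric_realization_def cell_def)

text \<open>The vertices of \<tau> are taken in the order of \<open>ix\<close>. The restriction is
  there because singular simplices are extensional; it makes \<open>face_aff\<close> an equality of
  functions.\<close>

definition aff :: "('a \<Rightarrow> nat) \<Rightarrow> 'a set \<Rightarrow> (nat \<Rightarrow> real) \<Rightarrow> 'a \<Rightarrow> real" where
  "aff ix \<tau> = restrict (\<lambda>x v. if v \<in> \<tau> then x (rk ix \<tau> v) else 0) (standard_simplex (card \<tau> - 1))"

text \<open>\<open>simplicial_complex\<close> excludes the empty face while the combinatorial part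
  uses it, hence \<open>insert {} K\<close>. The injection \<open>ix\<close> orders the vertices and
  so orients the faces.\<close>

locale realized = augmented_complex "\<Union>K" "insert {} K" for K :: "'a set set" +
  fixes ix :: "'a \<Rightarrow> nat"
  assumes simplicial: "simplicial_complex K" and ix: "inj_on ix (\<Union>K)"
begin

abbreviation "V \<equiv> \<Union>K"
abbreviation "X \<equiv> realization_top K"

lemma faceD: "\<tau> \<in> K \<Longrightarrow> finite \<tau> \<and> \<tau> \<noteq> {} \<and> \<tau> \<subseteq> V \<and> card \<tau> > 0 \<and> inj_on ix \<tau>"
  using simplicial ix by (auto simp: simplicial_complex_def card_gt_0_iff intro: inj_on_subset)

lemma subface: "\<sigma> \<in> K \<Longrightarrow> \<tau> \<subseteq> \<sigma> \<Longrightarrow> \<tau> \<noteq> {} \<Longrightarrow> \<tau> \<in> K"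
  using down[of \<sigma> \<tau>] by auto

lemma finite_K: "finite K"
  using simplicial by (simp add: simplicial_complex_def)

lemma topspace_X [simp]: "topspace X = geometric_realization K"
  by (simp add: realization_top_def)

lemma cell_sub: "\<tau> \<in> K \<Longrightarrow> cell \<tau> \<subseteq> geometric_realization K"
  by (auto simp: geometric_realization_cells)

lemma sum_V:
  assumes "x \<in> cell \<tau>" "\<tau> \<in> K" shows "sum x V = 1"
proof -
  have "sum x V = sum x \<tau>"
    using assms faceD[OF assms(2)] fin_V by (intro sum.mono_neutral_right) (auto simp: cell_def)
  then show ?thesis using assms by (simp add: cell_def)
qed

lemma realizationD:
  assumes "x \<in> geometric_realization K"
  shows "\<And>v. 0 \<le> x v" "\<And>v. v \<notin> V \<Longrightarrow> x v = 0" "sum x V = 1" "{v. x v > 0} \<in> K" "x \<in> cell {v. x v > 0}"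
    "\<And>v. x v \<le> 1"
proof -
  obtain \<tau> where \<tau>: "\<tau> \<in> K" "x \<in> cell \<tau>" using assms by (auto simp: geometric_realization_cells)
  show nn: "0 \<le> x v" for v using \<tau> by (simp add: cell_def)
  show z: "x v = 0" if "v \<notin> V" for v using \<tau> that by (auto simp: cell_def)
  show s: "sum x V = 1" using sum_V \<tau> by blast
  show "x v \<le> 1" for v
  proof (cases "v \<in> V")
    case True
    then show ?thesis using member_le_sum[of v V x] nn s fin_V by auto
  qed (simp add: z)
  have sub: "{v. x v > 0} \<subseteq> \<tau>" using \<tau> by (force simp: cell_def)
  have "{v. x v > 0} \<noteq> {}"
  proof
    assume "{v. x v > 0} = {}"
    then have "x v = 0" for v using nn[of v] by (metis antisym_conv1 empty_Collect_eq)
    then show False using s by simp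
  qed
  then show "{v. x v > 0} \<in> K" using subface[OF \<tau>(1) sub] by simp
  have "sum x \<tau> = sum x {v. x v > 0}"
  proof (rule sum.mono_neutral_right)
    show "\<forall>i\<in>\<tau> - {v. 0 < x v}. x i = 0" using nn by (auto simp: order.antisym not_less)
  qed (use sub \<tau> faceD in auto)
  then show "x \<in> cell {v. x v > 0}" using \<tau> nn by (auto simp: cell_def order.antisym not_less)
qed

lemma aff_image:
  assumes "\<tau> \<in> K" "x \<in> standard_simplex (card \<tau> - 1)"
  shows "aff ix \<tau> x \<in> cell \<tau>"
proof -
  have f: "finite \<tau>" "inj_on ix \<tau>" "card \<tau> > 0" using faceD[OF assms(1)] by auto
  have "(\<Sum>v\<in>\<tau>. x (rk ix \<tau> v)) = (\<Sum>i<card \<tau>. x i)"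
    using sum.reindex_bij_betw[OF rk_bij[OF f(1,2)], of x] .
  also have "{..<card \<tau>} = {..card \<tau> - 1}" using f(3) by auto
  also have "(\<Sum>i\<in>{..card \<tau> - 1}. x i) = 1" using assms(2) by (simp add: standard_simplex_def)
  finally show ?thesis using assms(2) by (auto simp: aff_def cell_def standard_simplex_def)
qed

lemma singular_simplex_aff:
  assumes "\<tau> \<in> K"
  shows "singular_simplex (card \<tau> - 1) (subtopology X (cell \<tau>)) (aff ix \<tau>)"
proof -
  let ?D = "subtopology (powertop_real UNIV) (standard_simplex (card \<tau> - 1))"
  have "continuous_map ?D (powertop_real UNIV) (\<lambda>x v. if v \<in> \<tau> then x (rk ix \<tau> v) else 0)"
    unfolding continuous_map_componentwise
  proof (intro conjI ballI)
    fix v show "continuous_map ?D euclideanreal (\<lambda>x. if v \<in> \<tau> then x (rk ix \<tau> v) else 0)"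
      by (cases "v \<in> \<tau>")
        (auto intro: continuous_map_from_subtopology continuous_map_product_projection)
  qed auto
  then have "continuous_map ?D (powertop_real UNIV) (aff ix \<tau>)"
    by (rule continuous_map_eq) (simp add: aff_def)
  then show ?thesis
    using aff_image[OF assms] cell_sub[OF assms]
    unfolding singular_simplex_def realization_top_def
    by (auto simp: continuous_map_in_subtopology aff_def[of ix \<tau>] subtopology_subtopology)
qed

lemma face_aff:
  assumes "\<tau> \<in> K" "card \<tau> = Suc (Suc p)" "u \<in> \<tau>"
  shows "singular_face (Suc p) (rk ix \<tau> u) (aff ix \<tau>) = aff ix (\<tau> - {u})"
proof
  have f: "finite \<tau>" "inj_on ix \<tau>" using faceD[OF assms(1)] by auto
  have k: "rk ix \<tau> u \<le> Suc p" using bij_betwE[OF rk_bij[OF f]] assms by fastforce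
  fix x
  show "singular_face (Suc p) (rk ix \<tau> u) (aff ix \<tau>) x = aff ix (\<tau> - {u}) x"
  proof (cases "x \<in> standard_simplex p")
    case True
    then have sf: "simplical_face (rk ix \<tau> u) x \<in> standard_simplex (Suc p)"
      using simplical_face_in_standard_simplex[of "Suc p" "rk ix \<tau> u" x] k by simp
    have "singular_face (Suc p) (rk ix \<tau> u) (aff ix \<tau>) x =
      (\<lambda>v. if v \<in> \<tau> then simplical_face (rk ix \<tau> u) x (rk ix \<tau> v) else 0)"
      using True sf assms by (simp add: singular_face_def aff_def)
    also have "\<dots> = (\<lambda>v. if v \<in> \<tau> - {u} then x (rk ix (\<tau> - {u}) v) else 0)"
    proof
      fix v
      show "(if v \<in> \<tau> then simplical_face (rk ix \<tau> u) x (rk ix \<tau> v) else 0) =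
        (if v \<in> \<tau> - {u} then x (rk ix (\<tau> - {u}) v) else 0)"
      proof (cases "v \<in> \<tau> \<and> v \<noteq> u")
        case v: True
        note r = rk_remove[OF f(1) assms(3), of v ix]
        have "ix u \<noteq> ix v" using v assms(3) f(2) by (auto simp: inj_on_def)
        then consider "ix v < ix u" | "ix u < ix v" by linarith
        then show ?thesis
        proof cases
          case 1
          with r(2) v show ?thesis by (simp add: simplical_face_def)
        next
          case 2
          with r(1) v show ?thesis by (simp add: simplical_face_def)
        qed
      next
        case False
        then show ?thesis by (auto simp: simplical_face_def)
      qed
    qed
    also have "\<dots> = aff ix (\<tau> - {u}) x" using True assms f by (simp add: aff_def)
    finally show ?thesis .
  next
    case False
    then show ?thesis using assms f by (simp add: singular_face_def aff_def)
  qed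
qed

lemma boundary_aff:
  assumes "\<tau> \<in> K" "card \<tau> = Suc (Suc p)"
  shows "chain_boundary (Suc p) (frag_of (aff ix \<tau>)) =
    (\<Sum>u\<in>\<tau>. frag_cmul ((-1) ^ rk ix \<tau> u) (frag_of (aff ix (\<tau> - {u}))))"
proof -
  have f: "finite \<tau>" "inj_on ix \<tau>" using faceD[OF assms(1)] by auto
  have b: "bij_betw (rk ix \<tau>) \<tau> {..Suc p}"
    using rk_bij[OF f] assms(2) by (simp add: lessThan_Suc_atMost)
  have "chain_boundary (Suc p) (frag_of (aff ix \<tau>)) =
    (\<Sum>k\<in>{..Suc p}. frag_cmul ((-1) ^ k) (frag_of (singular_face (Suc p) k (aff ix \<tau>))))"
    by (simp only: chain_boundary_of nat.distinct if_False)
  also have "\<dots> = (\<Sum>u\<in>\<tau>. frag_cmul ((-1) ^ rk ix \<tau> u) (frag_of (singular_face (Suc p) (rk ix \<tau> u) (aff ix \<tau>))))"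
    by (rule sum.reindex_bij_betw[OF b, symmetric])
  also have "\<dots> = (\<Sum>u\<in>\<tau>. frag_cmul ((-1) ^ rk ix \<tau> u) (frag_of (aff ix (\<tau> - {u}))))"
    by (intro sum.cong[OF refl]) (simp only: face_aff[OF assms])
  finally show ?thesis .
qed

text \<open>Sperner's lemma: \<open>v\<close> labels every point by a vertex of its carrier.\<close>
lemma simp_chain_sdiv_aff:
  assumes v: "\<And>x. x \<in> geometric_realization K \<Longrightarrow> 0 < x (v x)"
  shows "\<tau> \<in> K \<Longrightarrow> card \<tau> = Suc p \<Longrightarrow>
    simp_chain v p (sdiv p N (frag_of (aff ix \<tau>))) \<sigma> = (if \<sigma> = \<tau> then 1 else 0)"
proof (induction p arbitrary: \<tau> \<sigma>)
  case 0
  then obtain a where a: "\<tau> = {a}" by (auto simp: card_1_singleton_iff)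
  have "singular_chain 0 X (frag_of (aff ix \<tau>))"
    using singular_simplex_aff[OF 0(1)] 0 by (simp add: singular_chain_of singular_simplex_subtopology)
  then have s: "sdiv 0 N (frag_of (aff ix \<tau>)) = frag_of (aff ix \<tau>)" by (rule sdiv_zero)
  have c: "aff ix \<tau> (unit_pt 0) \<in> cell \<tau>" using aff_image[OF 0(1)] 0 by simp
  then have "0 < aff ix \<tau> (unit_pt 0) (v (aff ix \<tau> (unit_pt 0)))" using v cell_sub[OF 0(1)] by blast
  then have "v (aff ix \<tau> (unit_pt 0)) = a" using c a by (force simp: cell_def)
  then have "vset v 0 (aff ix \<tau>) = \<tau>" using a by (simp add: vset_def)
  then show ?case using 0 by (auto simp: s simp_chain_of)
next
  case (Suc p)
  let ?c = "sdiv (Suc p) N (frag_of (aff ix \<tau>))"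
  have fin: "finite \<tau>" using faceD[OF Suc.prems(1)] by simp
  have sc: "singular_chain (Suc p) (subtopology X (cell \<tau>)) (frag_of (aff ix \<tau>))"
    using singular_simplex_aff[OF Suc.prems(1)] Suc.prems by (simp add: singular_chain_of)
  have ch: "singular_chain (Suc p) (subtopology X (cell \<tau>)) ?c" by (rule singular_chain_sdiv[OF sc])
  \<comment> \<open>Subdivision stays in the cell of \<tau>, whose points have their carriers inside
    \<tau>, so only \<tau> itself can receive a nonzero coefficient.\<close>
  have vs: "vset v (Suc p) f \<subseteq> \<tau>" if "f \<in> Poly_Mapping.keys ?c" for f
  proof -
    have "f ` standard_simplex (Suc p) \<subseteq> cell \<tau>"
      using ch that by (simp add: singular_chain_subtopology)
    then have im: "f (unit_pt i) \<in> cell \<tau>" if "i \<le> Suc p" for i using that by (auto simp: image_subset_iff)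
    have "v (f (unit_pt i)) \<in> \<tau>" if "i \<le> Suc p" for i
    proof -
      have "0 < f (unit_pt i) (v (f (unit_pt i)))"
        using v im[OF that] cell_sub[OF Suc.prems(1)] by blast
      then show ?thesis using im[OF that] by (force simp: cell_def)
    qed
    then show ?thesis by (auto simp: vset_def)
  qed
  have off: "simp_chain v (Suc p) ?c \<rho> = 0" if "\<rho> \<noteq> \<tau>" for \<rho>
  proof (rule ccontr)
    assume "simp_chain v (Suc p) ?c \<rho> \<noteq> 0"
    then obtain f where "f \<in> Poly_Mapping.keys ?c" "vset v (Suc p) f = \<rho>" "card \<rho> = Suc (Suc p)"
      by (rule simp_chain_nonzeroE)
    then have "\<rho> \<subseteq> \<tau>" "card \<rho> = card \<tau>" using vs Suc.prems by auto
    then show False using that card_subset_eq[OF fin] by blast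
  qed
  obtain u where u: "u \<in> \<tau>" using Suc.prems(2) by fastforce
  let ?\<rho> = "\<tau> - {u}"
  have uV: "u \<in> V" using u Suc.prems by auto
  have ins: "insert u ?\<rho> = \<tau>" using u by auto
  \<comment> \<open>The coefficient at \<tau> is read off the boundary at one ridge, which only
    \<open>u\<close> completes to \<tau>. That boundary comes from the affine faces of \<tau>, and
    by induction just the face opposite \<open>u\<close> contributes to the ridge.\<close>
  have "bd V (simp_chain v (Suc p) ?c) ?\<rho> = (\<Sum>w\<in>V - ?\<rho>. if w = u then simp_chain v (Suc p) ?c \<tau> else 0)"
    unfolding bd_def
  proof (rule sum.cong[OF refl])
    fix w assume w: "w \<in> V - ?\<rho>"
    show "simp_chain v (Suc p) ?c (insert w ?\<rho>) = (if w = u then simp_chain v (Suc p) ?c \<tau> else 0)"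
    proof (cases "w = u")
      case False
      then have "insert w ?\<rho> \<noteq> \<tau>" using u w by auto
      then show ?thesis using off False by simp
    next
      case True
      show ?thesis unfolding True ins by simp
    qed
  qed
  also have "\<dots> = simp_chain v (Suc p) ?c \<tau>" using uV fin_V by simp
  finally have "simp_chain v (Suc p) ?c \<tau> = bd V (simp_chain v (Suc p) ?c) ?\<rho>" by simp
  also have "\<dots> = simp_chain v p (chain_boundary (Suc p) ?c) ?\<rho>"
    by (rule simp_chain_boundary[symmetric, OF fin_V]) (use vs Suc.prems in blast)
  also have "chain_boundary (Suc p) ?c = sdiv p N (chain_boundary (Suc p) (frag_of (aff ix \<tau>)))"
    by (rule chain_boundary_sdiv[OF sc])
  also have "simp_chain v p \<dots> ?\<rho> = (\<Sum>w\<in>\<tau>. simp_chain v p (sdiv p N (frag_of (aff ix (\<tau> - {w})))) ?\<rho>)"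
    unfolding boundary_aff[OF Suc.prems] sdiv_sum sdiv_cmul simp_chain_sum simp_chain_cmul of_int_power
    by (intro sum.cong[OF refl]) (simp add: of_int_bit_neg1[simplified])
  also have "\<dots> = (\<Sum>w\<in>\<tau>. if w = u then 1 else 0)"
  proof (rule sum.cong[OF refl])
    fix w assume w: "w \<in> \<tau>"
    have c: "card (\<tau> - {w}) = Suc p" using w Suc.prems(2) fin by simp
    then have "\<tau> - {w} \<noteq> {}" by (metis card.empty nat.distinct(1))
    then have "\<tau> - {w} \<in> K" using subface[OF Suc.prems(1), of "\<tau> - {w}"] by blast
    from Suc.IH[OF this c, of ?\<rho>] show "simp_chain v p (sdiv p N (frag_of (aff ix (\<tau> - {w})))) ?\<rho> = (if w = u then 1 else 0)"
      using w u by (auto split: if_splits)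
  qed
  also have "\<dots> = 1" using u fin by simp
  finally show ?case using off by simp
qed

definition real_chain :: "nat \<Rightarrow> ('a set \<Rightarrow> int) \<Rightarrow> ('a \<Rightarrow> real) chain" where
  "real_chain p a = (\<Sum>\<tau> | \<tau> \<in> K \<and> card \<tau> = Suc p. frag_cmul (a \<tau>) (frag_of (aff ix \<tau>)))"

text \<open>The signed simplicial boundary for the order \<open>ix\<close>; it makes
  \<open>real_chain\<close> a chain map (\<open>boundary_real_chain\<close>).\<close>

definition int_bd :: "('a set \<Rightarrow> int) \<Rightarrow> 'a set \<Rightarrow> int" where
  "int_bd a \<rho> = (\<Sum>u\<in>V - \<rho>. if insert u \<rho> \<in> K then (-1) ^ rk ix (insert u \<rho>) u * a (insert u \<rho>) else 0)"

lemma singular_chain_real_chain: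
  assumes "\<And>\<tau>. \<tau> \<in> K \<Longrightarrow> card \<tau> = Suc p \<Longrightarrow> a \<tau> \<noteq> 0 \<Longrightarrow> cell \<tau> \<subseteq> Y"
  shows "singular_chain p (subtopology X Y) (real_chain p a)"
  unfolding real_chain_def
proof (rule singular_chain_sum)
  fix \<tau> assume \<tau>: "\<tau> \<in> {\<tau>. \<tau> \<in> K \<and> card \<tau> = Suc p}"
  then have "singular_simplex p (subtopology X (cell \<tau>)) (aff ix \<tau>)"
    using singular_simplex_aff[of \<tau>] by simp
  then have "singular_simplex p (subtopology X Y) (aff ix \<tau>)" if "a \<tau> \<noteq> 0"
    using assms[of \<tau>] \<tau> that singular_simplex_mono[of p X "cell \<tau>" "aff ix \<tau>" Y] by auto
  then show "singular_chain p (subtopology X Y) (frag_cmul (a \<tau>) (frag_of (aff ix \<tau>)))"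
    by (cases "a \<tau> = 0") (auto intro: singular_chain_cmul simp: singular_chain_of)
qed

lemma singular_chain_real_chain_UNIV: "singular_chain p X (real_chain p a)"
  using singular_chain_real_chain[of p a UNIV] by simp

text \<open>Labelling is a left inverse mod 2 of \<open>real_chain\<close>, however fine the
  subdivision. Simplicial chains therefore survive the passage through singular ones.\<close>

lemma simp_chain_real_chain:
  assumes v: "\<And>x. x \<in> geometric_realization K \<Longrightarrow> 0 < x (v x)"
  shows "simp_chain v p (sdiv p N (real_chain p a)) \<sigma> = (if \<sigma> \<in> K \<and> card \<sigma> = Suc p then of_int (a \<sigma>) else 0)"
proof -
  have fin: "finite {\<tau>. \<tau> \<in> K \<and> card \<tau> = Suc p}" using finite_K by simp
  have "simp_chain v p (sdiv p N (real_chain p a)) \<sigma> =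
    (\<Sum>\<tau> | \<tau> \<in> K \<and> card \<tau> = Suc p. of_int (a \<tau>) * simp_chain v p (sdiv p N (frag_of (aff ix \<tau>))) \<sigma>)"
    unfolding real_chain_def sdiv_sum sdiv_cmul simp_chain_sum simp_chain_cmul ..
  also have "\<dots> = (\<Sum>\<tau> | \<tau> \<in> K \<and> card \<tau> = Suc p. if \<sigma> = \<tau> then of_int (a \<tau>) else 0)"
  proof (rule sum.cong[OF refl])
    fix \<tau> assume "\<tau> \<in> {\<tau>. \<tau> \<in> K \<and> card \<tau> = Suc p}"
    then have "simp_chain v p (sdiv p N (frag_of (aff ix \<tau>))) \<sigma> = (if \<sigma> = \<tau> then 1 else 0)"
      using simp_chain_sdiv_aff[of v \<tau> p N \<sigma>] v by blast
    then show "of_int (a \<tau>) * simp_chain v p (sdiv p N (frag_of (aff ix \<tau>))) \<sigma> = (if \<sigma> = \<tau> then of_int (a \<tau>) else 0)"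
      by simp
  qed
  also have "\<dots> = (if \<sigma> \<in> K \<and> card \<sigma> = Suc p then of_int (a \<sigma>) else 0)"
    using fin by (simp add: sum.delta')
  finally show ?thesis .
qed

lemma boundary_real_chain: "chain_boundary (Suc p) (real_chain (Suc p) a) = real_chain p (int_bd a)"
proof -
  let ?T = "{\<tau>. \<tau> \<in> K \<and> card \<tau> = Suc (Suc p)}" and ?R = "{\<rho>. \<rho> \<in> K \<and> card \<rho> = Suc p}"
  let ?A = "SIGMA \<tau>:?T. \<tau>" and ?B = "SIGMA \<rho>:?R. {u\<in>V - \<rho>. insert u \<rho> \<in> K}"
  let ?g = "\<lambda>\<tau> u. frag_cmul (a \<tau> * (-1) ^ rk ix \<tau> u) (frag_of (aff ix (\<tau> - {u})))"
  have finB: "\<forall>\<rho>\<in>?R. finite {u\<in>V - \<rho>. insert u \<rho> \<in> K}"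
    by (intro ballI finite_subset[OF _ fin_V]) blast
  have finT: "finite ?T" and finR: "finite ?R" using finite_K by auto
  have "chain_boundary (Suc p) (real_chain (Suc p) a) = (\<Sum>\<tau>\<in>?T. \<Sum>u\<in>\<tau>. ?g \<tau> u)"
    unfolding real_chain_def chain_boundary_sum
    by (intro sum.cong[OF refl]) (simp add: chain_boundary_cmul boundary_aff frag_cmul_sum)
  also have "\<dots> = (\<Sum>(\<tau>, u)\<in>?A. ?g \<tau> u)"
    by (rule sum.Sigma[OF finT]) (use faceD in auto)
  also have "\<dots> = (\<Sum>(\<rho>, u)\<in>?B. ?g (insert u \<rho>) u)"
  proof (rule sum.reindex_bij_witness[of _ "\<lambda>(\<rho>, u). (insert u \<rho>, u)" "\<lambda>(\<tau>, u). (\<tau> - {u}, u)"])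
    fix x assume x: "x \<in> ?A"
    obtain \<tau> u where eq: "x = (\<tau>, u)" by (cases x)
    then have \<tau>: "\<tau> \<in> K" "card \<tau> = Suc (Suc p)" "u \<in> \<tau>" using x by auto
    then have "card (\<tau> - {u}) = Suc p" using faceD by simp
    then have "\<tau> - {u} \<in> K" using subface[OF \<tau>(1), of "\<tau> - {u}"] by fastforce
    then show "(case x of (\<tau>, u) \<Rightarrow> (\<tau> - {u}, u)) \<in> ?B"
      using \<tau> \<open>card (\<tau> - {u}) = Suc p\<close> by (auto simp: eq insert_absorb)
  next
    fix x assume x: "x \<in> ?B"
    then show "(case x of (\<rho>, u) \<Rightarrow> (insert u \<rho>, u)) \<in> ?A" using faceD by auto
  qed (auto simp: insert_absorb)
  also have "\<dots> = (\<Sum>\<rho>\<in>?R. \<Sum>u\<in>{u\<in>V - \<rho>. insert u \<rho> \<in> K}. ?g (insert u \<rho>) u)"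
    by (rule sum.Sigma[symmetric, OF finR]) (rule finB)
  also have "\<dots> = real_chain p (int_bd a)"
    unfolding real_chain_def
  proof (rule sum.cong[OF refl])
    fix \<rho> assume "\<rho> \<in> ?R"
    have "(\<Sum>u\<in>{u\<in>V - \<rho>. insert u \<rho> \<in> K}. ?g (insert u \<rho>) u) =
      (\<Sum>u\<in>{u\<in>V - \<rho>. insert u \<rho> \<in> K}. frag_cmul ((-1) ^ rk ix (insert u \<rho>) u * a (insert u \<rho>)) (frag_of (aff ix \<rho>)))"
      by (intro sum.cong[OF refl]) (auto simp: mult.commute)
    also have "\<dots> = frag_cmul (\<Sum>u\<in>{u\<in>V - \<rho>. insert u \<rho> \<in> K}. (-1) ^ rk ix (insert u \<rho>) u * a (insert u \<rho>)) (frag_of (aff ix \<rho>))"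
      by (rule frag_cmul_sum_left)
    also have "(\<Sum>u\<in>{u\<in>V - \<rho>. insert u \<rho> \<in> K}. (-1) ^ rk ix (insert u \<rho>) u * a (insert u \<rho>)) = int_bd a \<rho>"
      unfolding int_bd_def
      by (rule sum.inter_filter[OF finite_Diff[OF fin_V]])
    finally show "(\<Sum>u\<in>{u\<in>V - \<rho>. insert u \<rho> \<in> K}. ?g (insert u \<rho>) u) = frag_cmul (int_bd a \<rho>) (frag_of (aff ix \<rho>))" .
  qed
  finally show ?thesis .
qed

lemma int_bd_mod_2:
  assumes "\<And>\<tau>. a \<tau> \<noteq> 0 \<Longrightarrow> \<tau> \<in> K"
  shows "of_int (int_bd a \<rho>) = bd V (\<lambda>\<tau>. of_int (a \<tau>)) \<rho>"
  unfolding int_bd_def bd_def of_int_sum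
proof (rule sum.cong[OF refl])
  fix u
  show "of_int (if insert u \<rho> \<in> K then (-1) ^ rk ix (insert u \<rho>) u * a (insert u \<rho>) else 0) = (of_int (a (insert u \<rho>)) :: bit)"
  proof (cases "a (insert u \<rho>) = 0")
    case False
    then show ?thesis using assms[of "insert u \<rho>"] of_int_bit_neg1[of "rk ix (insert u \<rho>) u"] by auto
  qed simp
qed

end

text \<open>For \<open>\<alpha>\<close> a face, the reduced coordinates of a point all vanish only at the barycenter of \<open>\<alpha>\<close>, and
some reduced coordinate in \<open>\<alpha>\<close> always vanishes. Labelling points by a vertex with a large reduced
coordinate therefore never uses all of \<open>\<alpha>\<close> on a small simplex that stays away from the barycenter.\<close>
definition reduced_coord :: "'a set \<Rightarrow> ('a \<Rightarrow> real) \<Rightarrow> 'a \<Rightarrow> real" where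
  "reduced_coord \<alpha> x u = x u - (if u \<in> \<alpha> then Min (x ` \<alpha>) else 0)"

definition barycenter :: "'a set \<Rightarrow> 'a \<Rightarrow> real" where
  "barycenter \<alpha> v = (if v \<in> \<alpha> then 1 / real (card \<alpha>) else 0)"

lemma continuous_map_Min:
  assumes "finite \<alpha>" "\<alpha> \<noteq> {}" "\<And>u. u \<in> \<alpha> \<Longrightarrow> continuous_map Y euclideanreal (\<lambda>x. x u)"
  shows "continuous_map Y euclideanreal (\<lambda>x. Min (x ` \<alpha>))"
  using assms
proof (induction \<alpha> rule: finite_ne_induct)
  case (insert a F)
  have "Min (x ` insert a F) = min (x a) (Min (x ` F))" for x :: "'a \<Rightarrow> real" using insert.hyps by simp
  then show ?case using insert by (simp only:) (intro continuous_map_real_min, auto)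
qed simp

section \<open>Labels near a barycenter and the transfer of fillings\<close>

context realized begin

lemma continuous_map_coord: "continuous_map X euclideanreal (\<lambda>x. x u)"
  unfolding realization_top_def
  by (rule continuous_map_from_subtopology[OF continuous_map_product_projection]) simp

definition nbhd :: "real \<Rightarrow> ('a \<Rightarrow> real) \<Rightarrow> ('a \<Rightarrow> real) set" where
  "nbhd \<delta> y = {x\<in>geometric_realization K. \<forall>u\<in>V. \<bar>x u - y u\<bar> < \<delta>}"

lemma nbhdD: "x \<in> nbhd \<delta> y \<Longrightarrow> u \<in> V \<Longrightarrow> \<bar>x u - y u\<bar> < \<delta>"
  unfolding nbhd_def by blast

lemma openin_nbhd: "openin X (nbhd \<delta> y)"
proof -
  let ?U = "\<lambda>u. {x \<in> topspace X. x u \<in> {y u - \<delta><..<y u + \<delta>}}"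
  have "openin X (?U u)" for u
    by (rule openin_continuous_map_preimage[OF continuous_map_coord]) simp
  then have "openin X ((\<Inter>u\<in>V. ?U u) \<inter> topspace X)" by (intro openin_INT[OF fin_V])
  also have "(\<Inter>u\<in>V. ?U u) \<inter> topspace X = nbhd \<delta> y"
    by (fastforce simp: nbhd_def abs_less_iff)
  finally show ?thesis .
qed

lemma cover_nbhd: "\<delta> > 0 \<Longrightarrow> topspace X \<subseteq> \<Union>(nbhd \<delta> ` geometric_realization K)"
  by (auto simp: nbhd_def)

definition good :: "real \<Rightarrow> 'a set \<Rightarrow> ('a \<Rightarrow> real) \<Rightarrow> bool" where
  "good \<eta> \<alpha> x \<longleftrightarrow> (\<exists>u\<in>V. \<eta> \<le> reduced_coord \<alpha> x u)"

text \<open>When no reduced coordinate is large, the mass lies almost evenly on \<alpha>, and any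
  vertex of \<alpha> belongs to the carrier. So for small \<open>\<eta>\<close> the label is
  admissible for Sperner's lemma at bad points too.\<close>

definition near_vertex :: "real \<Rightarrow> 'a set \<Rightarrow> ('a \<Rightarrow> real) \<Rightarrow> 'a" where
  "near_vertex \<eta> \<alpha> x =
     (if good \<eta> \<alpha> x then SOME u. u \<in> V \<and> \<eta> \<le> reduced_coord \<alpha> x u else SOME u. u \<in> \<alpha>)"

text \<open>The factor 2 comes from averaging: if no reduced coordinate reaches
  \<open>\<eta>\<close> and \<open>t\<close> is the minimum over \<alpha> (0 if \<alpha> is empty),
  then \<open>1 \<le> card V * (\<eta> + t)\<close>, hence \<open>\<eta> \<le> t\<close>.\<close>

definition small_enough :: "real \<Rightarrow> bool" where
  "small_enough \<eta> \<longleftrightarrow> 0 < \<eta> \<and> \<eta> * (2 * real (card V)) \<le> 1"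

lemma V_nonempty: "x \<in> geometric_realization K \<Longrightarrow> V \<noteq> {}"
  using realizationD(3)[of x] by (metis sum.empty zero_neq_one)

lemma aug_face: "\<alpha> \<in> insert {} K \<Longrightarrow> finite \<alpha> \<and> \<alpha> \<subseteq> V"
  using faceD by auto

lemma reduced_coord_le:
  assumes "x \<in> geometric_realization K" "finite \<alpha>"
  shows "0 \<le> reduced_coord \<alpha> x u" "reduced_coord \<alpha> x u \<le> x u"
proof -
  have "Min (x ` \<alpha>) \<le> x u" if "u \<in> \<alpha>" using that assms(2) by simp
  then show "0 \<le> reduced_coord \<alpha> x u" using realizationD(1)[OF assms(1)] by (simp add: reduced_coord_def)
  have "0 \<le> Min (x ` \<alpha>)" if "u \<in> \<alpha>"
    using that assms(2) realizationD(1)[OF assms(1)] by (subst Min_ge_iff) auto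
  then show "reduced_coord \<alpha> x u \<le> x u" by (simp add: reduced_coord_def)
qed

lemma near_vertex_good:
  assumes "good \<eta> \<alpha> x"
  shows "near_vertex \<eta> \<alpha> x \<in> V \<and> \<eta> \<le> reduced_coord \<alpha> x (near_vertex \<eta> \<alpha> x)"
proof -
  have "\<exists>u. u \<in> V \<and> \<eta> \<le> reduced_coord \<alpha> x u" using assms by (auto simp: good_def)
  from someI_ex[OF this] show ?thesis using assms by (simp add: near_vertex_def)
qed

lemma near_vertex_coord:
  assumes x: "x \<in> geometric_realization K" and \<alpha>: "\<alpha> \<in> insert {} K" and \<eta>: "small_enough \<eta>"
  shows "near_vertex \<eta> \<alpha> x \<in> V" "\<eta> \<le> x (near_vertex \<eta> \<alpha> x)"
proof -
  have f: "finite \<alpha>" "\<alpha> \<subseteq> V" using aug_face[OF \<alpha>] by auto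
  have pos: "0 < \<eta>" and le: "\<eta> * (2 * real (card V)) \<le> 1" using \<eta> by (auto simp: small_enough_def)
  have cV: "0 < real (card V)" using V_nonempty[OF x] fin_V by (simp only: of_nat_0_less_iff card_gt_0_iff) simp
  have "near_vertex \<eta> \<alpha> x \<in> V \<and> \<eta> \<le> x (near_vertex \<eta> \<alpha> x)"
  proof (cases "good \<eta> \<alpha> x")
    case True
    then show ?thesis using near_vertex_good[OF True] reduced_coord_le(2)[OF x f(1)]
      by (meson order_trans)
  next
    case False
    define t where "t = (if \<alpha> = {} then 0 else Min (x ` \<alpha>))"
    have lt: "x u \<le> \<eta> + t" if "u \<in> V" for u
    proof -
      have "reduced_coord \<alpha> x u < \<eta>" using False that by (auto simp: good_def not_le)
      moreover have "0 \<le> t" unfolding t_def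
        using f(1) realizationD(1)[OF x] by (auto simp: Min_ge_iff)
      ultimately show ?thesis by (auto simp: reduced_coord_def t_def split: if_splits)
    qed
    have "1 = sum x V" using realizationD(3)[OF x] by simp
    also have "\<dots> \<le> (\<Sum>u\<in>V. \<eta> + t)" by (rule sum_mono) (rule lt)
    also have "\<dots> = real (card V) * (\<eta> + t)" by simp
    finally have "1 \<le> real (card V) * (\<eta> + t)" .
    then have "\<eta> * (2 * real (card V)) \<le> real (card V) * (\<eta> + t)" using le by linarith
    then have "real (card V) * (2 * \<eta>) \<le> real (card V) * (\<eta> + t)" by (simp add: mult_ac)
    then have "2 * \<eta> \<le> \<eta> + t" using cV by (rule mult_left_le_imp_le)
    then have t: "\<eta> \<le> t" by simp
    then have ne: "\<alpha> \<noteq> {}" using pos by (auto simp: t_def)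
    then have s: "(SOME u. u \<in> \<alpha>) \<in> \<alpha>" by (auto intro: someI)
    have "t \<le> x (SOME u. u \<in> \<alpha>)" using ne s f(1) by (simp add: t_def)
    then show ?thesis using False s f(2) t by (auto simp: near_vertex_def)
  qed
  then show "near_vertex \<eta> \<alpha> x \<in> V" "\<eta> \<le> x (near_vertex \<eta> \<alpha> x)" by auto
qed

lemma Min_close:
  assumes "finite \<alpha>" "\<alpha> \<noteq> {}" "\<And>u. u \<in> \<alpha> \<Longrightarrow> \<bar>x u - y u\<bar> < (\<delta>::real)"
  shows "\<bar>Min (x ` \<alpha>) - Min (y ` \<alpha>)\<bar> < \<delta>"
proof -
  have "Min (x ` \<alpha>) < Min (y ` \<alpha>) + \<delta>" if "\<And>u. u \<in> \<alpha> \<Longrightarrow> \<bar>x u - y u\<bar> < \<delta>" for x y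
  proof -
    have "Min (y ` \<alpha>) \<in> y ` \<alpha>" using assms by (intro Min_in) auto
    then obtain a where a: "a \<in> \<alpha>" "Min (y ` \<alpha>) = y a" by auto
    have "Min (x ` \<alpha>) \<le> x a" using a assms(1) by simp
    then show ?thesis using that[OF a(1)] a(2) by linarith
  qed
  from this[of x y] this[of y x] show ?thesis using assms(3) by (force simp: abs_minus_commute abs_less_iff)
qed

lemma reduced_coord_close:
  assumes "\<alpha> \<in> insert {} K" "x \<in> nbhd \<delta> y" "u \<in> V"
  shows "\<bar>reduced_coord \<alpha> x u - reduced_coord \<alpha> y u\<bar> < 2 * \<delta>"
proof -
  have f: "finite \<alpha>" "\<alpha> \<subseteq> V" using aug_face[OF assms(1)] by auto
  have c: "\<bar>x v - y v\<bar> < \<delta>" if "v \<in> V" for v using nbhdD[OF assms(2) that] .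
  show ?thesis
  proof (cases "u \<in> \<alpha>")
    case True
    have "\<bar>Min (x ` \<alpha>) - Min (y ` \<alpha>)\<bar> < \<delta>" by (rule Min_close) (use f True c in auto)
    then show ?thesis using c[OF assms(3)] True by (simp add: reduced_coord_def abs_less_iff)
  next
    case False
    then show ?thesis using c[OF assms(3)] by (simp add: reduced_coord_def)
  qed
qed

text \<open>Within radius \<open>\<eta> / 4\<close> a coordinate changes by less than
  \<open>\<eta> / 4\<close> and a reduced coordinate by less than \<open>\<eta> / 2\<close>, so at
  the centre \<open>y\<close> the labels still have positive coordinates, and in the good case
  positive reduced ones. Hence they lie in the carrier of \<open>y\<close>, and in the good case
  they miss the vertex of \<alpha> at which \<open>y\<close> is minimal.\<close>

lemma vset_small:
  assumes \<alpha>: "\<alpha> \<in> insert {} K" and \<eta>: "small_enough \<eta>"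
    and f: "f \<in> standard_simplex p \<rightarrow> nbhd (\<eta> / 4) y" and y: "y \<in> geometric_realization K"
  shows "vset (near_vertex \<eta> \<alpha>) p f \<in> K"
    and "\<alpha> \<noteq> {} \<Longrightarrow> f \<in> standard_simplex p \<rightarrow> {x. good \<eta> \<alpha> x} \<Longrightarrow> \<not> \<alpha> \<subseteq> vset (near_vertex \<eta> \<alpha>) p f"
proof -
  have pos: "0 < \<eta>" using \<eta> by (simp add: small_enough_def)
  have im: "f (unit_pt i) \<in> nbhd (\<eta> / 4) y" if "i \<le> p" for i
    using f that by (auto simp: Pi_iff)
  have "y (near_vertex \<eta> \<alpha> (f (unit_pt i))) > 0" if "i \<le> p" for i
  proof -
    have fx: "f (unit_pt i) \<in> geometric_realization K" using im[OF that] by (simp add: nbhd_def)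
    note nv = near_vertex_coord[OF fx \<alpha> \<eta>]
    have "\<bar>f (unit_pt i) (near_vertex \<eta> \<alpha> (f (unit_pt i))) - y (near_vertex \<eta> \<alpha> (f (unit_pt i)))\<bar> < \<eta> / 4"
      by (rule nbhdD[OF im[OF that] nv(1)])
    then show ?thesis using nv(2) pos by linarith
  qed
  then have "vset (near_vertex \<eta> \<alpha>) p f \<subseteq> {v. y v > 0}" unfolding vset_def by blast
  moreover have "vset (near_vertex \<eta> \<alpha>) p f \<noteq> {}" by (simp add: vset_def)
  ultimately show "vset (near_vertex \<eta> \<alpha>) p f \<in> K" using subface[OF realizationD(4)[OF y]] by blast
  assume ne: "\<alpha> \<noteq> {}" and g: "f \<in> standard_simplex p \<rightarrow> {x. good \<eta> \<alpha> x}"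
  have rc: "reduced_coord \<alpha> y (near_vertex \<eta> \<alpha> (f (unit_pt i))) > 0" if "i \<le> p" for i
  proof -
    have "good \<eta> \<alpha> (f (unit_pt i))" using g that by (auto simp: Pi_iff)
    then have nv: "near_vertex \<eta> \<alpha> (f (unit_pt i)) \<in> V"
      "\<eta> \<le> reduced_coord \<alpha> (f (unit_pt i)) (near_vertex \<eta> \<alpha> (f (unit_pt i)))"
      using near_vertex_good by blast+
    show ?thesis using nv(2) reduced_coord_close[OF \<alpha> im[OF that] nv(1)] pos by linarith
  qed
  have "Min (y ` \<alpha>) \<in> y ` \<alpha>" using aug_face[OF \<alpha>] ne by (intro Min_in) auto
  then obtain a where a: "a \<in> \<alpha>" "Min (y ` \<alpha>) = y a" by auto
  then have "reduced_coord \<alpha> y a = 0" by (simp add: reduced_coord_def)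
  then have "a \<notin> vset (near_vertex \<eta> \<alpha>) p f" using rc by (force simp: vset_def)
  with a show "\<not> \<alpha> \<subseteq> vset (near_vertex \<eta> \<alpha>) p f" by blast
qed

text \<open>Subdivision and labelling turn an identity of integral singular chains into one of
  simplicial chains mod 2: \<open>u\<close> disappears with its factor 2, and \<open>y\<close>
  becomes the filling \<open>Y\<close>. The contribution of \<open>w\<close> is left open, because
  it vanishes for different reasons in \<open>local_bridge\<close> and
  \<open>global_bridge\<close>.\<close>

lemma bridge:
  assumes \<alpha>: "\<alpha> \<in> insert {} K" and \<eta>: "small_enough \<eta>"
    and y: "singular_chain (Suc p) X y" and w: "singular_chain p X w"
    and eq: "real_chain p a = chain_boundary (Suc p) y + w + frag_cmul 2 u"
    and a: "\<And>\<tau>. a \<tau> \<noteq> 0 \<Longrightarrow> \<tau> \<in> K \<and> card \<tau> = Suc p"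
  shows "\<exists>Y N. chn K (Suc (Suc p)) Y \<and>
    (\<forall>\<rho>. of_int (a \<rho>) = bd V Y \<rho> + simp_chain (near_vertex \<eta> \<alpha>) p (sdiv p N w) \<rho>) \<and>
    (\<forall>f\<in>Poly_Mapping.keys (sdiv p N w).
      \<exists>z\<in>geometric_realization K. f \<in> standard_simplex p \<rightarrow> nbhd (\<eta> / 4) z)"
proof -
  have pos: "0 < \<eta>" using \<eta> by (simp add: small_enough_def)
  let ?C = "nbhd (\<eta> / 4) ` geometric_realization K" and ?v = "near_vertex \<eta> \<alpha>"
  have C: "openin X U" if "U \<in> ?C" for U using that openin_nbhd by auto
  have cov: "topspace X \<subseteq> \<Union>?C" using cover_nbhd[of "\<eta> / 4"] pos by simp
  obtain N1 where N1: "\<And>m f. N1 \<le> m \<Longrightarrow> f \<in> Poly_Mapping.keys (sdiv (Suc p) m y) \<Longrightarrow>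
      \<exists>U\<in>?C. f \<in> standard_simplex (Suc p) \<rightarrow> U"
    using sufficient_iterated_singular_subdivision_exists[OF C cov y] by metis
  obtain N2 where N2: "\<And>m f. N2 \<le> m \<Longrightarrow> f \<in> Poly_Mapping.keys (sdiv p m w) \<Longrightarrow>
      \<exists>U\<in>?C. f \<in> standard_simplex p \<rightarrow> U"
    using sufficient_iterated_singular_subdivision_exists[OF C cov w] by metis
  define N where "N = max N1 N2"
  have vs: "vset ?v (Suc p) f \<in> K" if "f \<in> Poly_Mapping.keys (sdiv (Suc p) N y)" for f
    using N1[of N f] that vset_small(1)[OF \<alpha> \<eta>] by (auto simp: N_def)
  let ?Y = "simp_chain ?v (Suc p) (sdiv (Suc p) N y)"
  have v: "0 < x (?v x)" if "x \<in> geometric_realization K" for x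
    using near_vertex_coord(2)[OF that \<alpha> \<eta>] pos by linarith
  show ?thesis
  proof (intro exI conjI allI ballI)
    show "chn K (Suc (Suc p)) ?Y"
      unfolding chn_def
    proof (intro allI impI)
      fix \<sigma> assume "?Y \<sigma> \<noteq> 0"
      then obtain f where "f \<in> Poly_Mapping.keys (sdiv (Suc p) N y)" "vset ?v (Suc p) f = \<sigma>" "card \<sigma> = Suc (Suc p)"
        by (rule simp_chain_nonzeroE)
      then show "\<sigma> \<in> K \<and> card \<sigma> = Suc (Suc p)" using vs by auto
    qed
    fix \<rho>
    have "of_int (a \<rho>) = simp_chain ?v p (sdiv p N (real_chain p a)) \<rho>"
    proof -
      have "simp_chain ?v p (sdiv p N (real_chain p a)) \<rho> = (if \<rho> \<in> K \<and> card \<rho> = Suc p then of_int (a \<rho>) else 0)"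
        by (rule simp_chain_real_chain) (rule v)
      then show ?thesis using a[of \<rho>] by (cases "a \<rho> = 0") simp_all
    qed
    also have "\<dots> = simp_chain ?v p (sdiv p N (chain_boundary (Suc p) y)) \<rho> + simp_chain ?v p (sdiv p N w) \<rho>"
      unfolding eq sdiv_add sdiv_cmul simp_chain_add simp_chain_cmul by simp
    also have "simp_chain ?v p (sdiv p N (chain_boundary (Suc p) y)) \<rho> = bd V ?Y \<rho>"
      unfolding chain_boundary_sdiv[OF y, symmetric]
      by (rule simp_chain_boundary[OF fin_V]) (use vs in blast)
    finally show "of_int (a \<rho>) = bd V ?Y \<rho> + simp_chain ?v p (sdiv p N w) \<rho>" .
  next
    fix f assume "f \<in> Poly_Mapping.keys (sdiv p N w)"
    then show "\<exists>z\<in>geometric_realization K. f \<in> standard_simplex p \<rightarrow> nbhd (\<eta> / 4) z"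
      using N2[of N f] by (auto simp: N_def)
  qed
qed

lemma small_enough_exists:
  assumes "0 < \<epsilon>"
  obtains \<eta> where "small_enough \<eta>" "\<eta> * real (card V) \<le> \<epsilon>" "\<eta> * real (card V) < 1"
proof
  define \<eta> where "\<eta> = min 1 \<epsilon> / (2 * real (card V) + 2)"
  have p: "0 < \<eta>" using assms by (simp add: \<eta>_def)
  have e: "\<eta> * (2 * real (card V) + 2) = min 1 \<epsilon>" by (simp add: \<eta>_def)
  have r: "0 \<le> \<eta> * real (card V)" using p by simp
  show "small_enough \<eta>" "\<eta> * real (card V) \<le> \<epsilon>" "\<eta> * real (card V) < 1"
    using p e r unfolding small_enough_def by (auto simp: algebra_simps min_def split: if_splits)
qed

lemma reduced_coord_sum_pos:
  assumes "\<alpha> \<in> K" "x \<in> geometric_realization K" "x \<noteq> barycenter \<alpha>"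
  shows "0 < (\<Sum>u\<in>V. reduced_coord \<alpha> x u)"
proof (rule ccontr)
  have f: "finite \<alpha>" "\<alpha> \<subseteq> V" "\<alpha> \<noteq> {}" using faceD[OF assms(1)] by auto
  have nn: "0 \<le> reduced_coord \<alpha> x u" for u using reduced_coord_le(1)[OF assms(2) f(1)] .
  assume "\<not> ?thesis"
  moreover have "0 \<le> (\<Sum>u\<in>V. reduced_coord \<alpha> x u)" by (rule sum_nonneg) (rule nn)
  ultimately have "(\<Sum>u\<in>V. reduced_coord \<alpha> x u) = 0" by linarith
  then have z: "reduced_coord \<alpha> x u = 0" if "u \<in> V" for u
    using sum_nonneg_eq_0_iff[OF fin_V, of "reduced_coord \<alpha> x"] nn that by blast
  have out: "x u = 0" if "u \<notin> \<alpha>" for u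
    using z[of u] realizationD(2)[OF assms(2), of u] that by (cases "u \<in> V") (auto simp: reduced_coord_def)
  have ins: "x u = Min (x ` \<alpha>)" if "u \<in> \<alpha>" for u
    using z[of u] f that by (auto simp: reduced_coord_def)
  have "1 = sum x V" using realizationD(3)[OF assms(2)] by simp
  also have "\<dots> = sum x \<alpha>" by (rule sum.mono_neutral_right[OF fin_V f(2)]) (use out in auto)
  also have "\<dots> = (\<Sum>u\<in>\<alpha>. Min (x ` \<alpha>))" using ins by (rule sum.cong[OF refl])
  also have "\<dots> = real (card \<alpha>) * Min (x ` \<alpha>)" by simp
  finally have "Min (x ` \<alpha>) = 1 / real (card \<alpha>)" using f by (simp add: field_simps)
  then have "x = barycenter \<alpha>" using out ins by (auto simp: barycenter_def fun_eq_iff)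
  then show False using assms(3) by simp
qed

text \<open>Compactness: on the images of the simplices of \<open>w\<close> the sum of the reduced
  coordinates is positive, hence at least some \<open>\<epsilon> > 0\<close>, and
  \<open>\<eta> * card V \<le> \<epsilon>\<close> forces one summand up to
  \<open>\<eta>\<close>.\<close>

lemma good_away_from_barycenter:
  assumes \<alpha>: "\<alpha> \<in> K" and w: "singular_chain p (subtopology X (geometric_realization K - {barycenter \<alpha>})) w"
  obtains \<eta> where "small_enough \<eta>" "singular_chain p (subtopology X {x. good \<eta> \<alpha> x}) w"
proof -
  have f: "finite \<alpha>" "\<alpha> \<subseteq> V" "\<alpha> \<noteq> {}" using faceD[OF \<alpha>] by auto
  let ?g = "\<lambda>x. \<Sum>u\<in>V. reduced_coord \<alpha> x u"
  have "continuous_map X euclideanreal (\<lambda>x. reduced_coord \<alpha> x u)" for u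
    unfolding reduced_coord_def
    by (cases "u \<in> \<alpha>") (auto intro!: continuous_map_diff continuous_map_coord continuous_map_Min f)
  then have cg: "continuous_map X euclideanreal ?g" by (intro continuous_map_sum fin_V)
  let ?C = "\<Union>f\<in>Poly_Mapping.keys w. f ` standard_simplex p"
  have wk: "singular_simplex p X h" "h ` standard_simplex p \<subseteq> geometric_realization K - {barycenter \<alpha>}"
    if "h \<in> Poly_Mapping.keys w" for h
  proof -
    have "singular_simplex p (subtopology X (geometric_realization K - {barycenter \<alpha>})) h"
      using w that by (auto simp: singular_chain_def)
    then show "singular_simplex p X h" "h ` standard_simplex p \<subseteq> geometric_realization K - {barycenter \<alpha>}"
      by (simp_all only: singular_simplex_subtopology)
  qed
  have cD: "compactin (subtopology (powertop_real UNIV) (standard_simplex p)) (standard_simplex p)"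
    by (simp add: compactin_subtopology compactin_standard_simplex)
  have hc: "compactin X (h ` standard_simplex p)" if "h \<in> Poly_Mapping.keys w" for h
    by (rule image_compactin[OF cD]) (use wk(1)[OF that] in \<open>simp add: singular_simplex_def\<close>)
  have "compactin X ?C"
    by (rule compactin_Union) (auto intro: hc)
  then have "compactin euclideanreal (?g ` ?C)" using cg by (rule image_compactin)
  then have cpt: "compact (?g ` ?C)" by simp
  have pos: "0 < ?g x" if "x \<in> ?C" for x
  proof -
    obtain h where h: "h \<in> Poly_Mapping.keys w" "x \<in> h ` standard_simplex p" using \<open>x \<in> ?C\<close> by auto
    have "x \<in> geometric_realization K - {barycenter \<alpha>}" by (rule subsetD[OF wk(2)[OF h(1)] h(2)])
    then show ?thesis using reduced_coord_sum_pos[OF \<alpha>, of x] by simp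
  qed
  obtain \<epsilon> where \<epsilon>: "0 < \<epsilon>" "\<And>x. x \<in> ?C \<Longrightarrow> \<epsilon> \<le> ?g x"
  proof (cases "?C = {}")
    case True
    then show thesis using that[of 1] by (metis empty_iff zero_less_one)
  next
    case False
    then obtain s where "s \<in> ?g ` ?C" "\<And>t. t \<in> ?g ` ?C \<Longrightarrow> s \<le> t"
      using compact_attains_inf[OF cpt] by blast
    then show thesis using that[of s] pos by (metis (no_types, lifting) imageE imageI)
  qed
  obtain \<eta> where \<eta>: "small_enough \<eta>" "\<eta> * real (card V) \<le> \<epsilon>" "\<eta> * real (card V) < 1"
    using small_enough_exists[OF \<epsilon>(1)] .
  have "good \<eta> \<alpha> x" if x: "x \<in> ?C" for x
  proof (rule ccontr)
    assume "\<not> good \<eta> \<alpha> x"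
    then have lt: "reduced_coord \<alpha> x u < \<eta>" if "u \<in> V" for u using that by (auto simp: good_def not_le)
    have "V \<noteq> {}" using f by (metis subset_empty)
    then have "?g x < (\<Sum>u\<in>V. \<eta>)" using lt by (rule sum_strict_mono[OF fin_V])
    also have "\<dots> = \<eta> * real (card V)" by (simp only: sum_constant mult.commute)
    finally show False using \<epsilon>(2)[OF x] \<eta>(2) by linarith
  qed
  then have "singular_chain p (subtopology X {x. good \<eta> \<alpha> x}) w"
    using w unfolding singular_chain_subtopology by blast
  with \<eta>(1) show thesis by (rule that)
qed

text \<open>The small simplices of \<open>w\<close> consist of good points and never use all of
  \<alpha> as labels, so \<open>w\<close> contributes nothing to sets containing \<alpha>.\<close>

lemma local_bridge:
  assumes \<alpha>: "\<alpha> \<in> K"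
    and y: "singular_chain (Suc p) X y"
    and w: "singular_chain p (subtopology X (geometric_realization K - {barycenter \<alpha>})) w"
    and eq: "real_chain p a = chain_boundary (Suc p) y + w + frag_cmul 2 u"
    and a: "\<And>\<tau>. a \<tau> \<noteq> 0 \<Longrightarrow> \<tau> \<in> K \<and> card \<tau> = Suc p"
  shows "\<exists>Y. chn (star (insert {} K) \<alpha>) (Suc (Suc p)) Y \<and>
    (\<forall>\<rho>\<in>star (insert {} K) \<alpha>. bd V Y \<rho> = of_int (a \<rho>))"
proof -
  obtain \<eta> where \<eta>: "small_enough \<eta>" "singular_chain p (subtopology X {x. good \<eta> \<alpha> x}) w"
    using good_away_from_barycenter[OF \<alpha> w] .
  have \<alpha>': "\<alpha> \<in> insert {} K" and ne: "\<alpha> \<noteq> {}" using \<alpha> faceD by auto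
  have wX: "singular_chain p X w" using \<eta>(2) by (simp add: singular_chain_subtopology)
  obtain Y N where Y: "chn K (Suc (Suc p)) Y"
    "\<forall>\<rho>. of_int (a \<rho>) = bd V Y \<rho> + simp_chain (near_vertex \<eta> \<alpha>) p (sdiv p N w) \<rho>"
    "\<forall>f\<in>Poly_Mapping.keys (sdiv p N w).
      \<exists>z\<in>geometric_realization K. f \<in> standard_simplex p \<rightarrow> nbhd (\<eta> / 4) z"
    using bridge[OF \<alpha>' \<eta>(1) y wX eq a] by blast
  let ?s = "star (insert {} K) \<alpha>"
  have z: "simp_chain (near_vertex \<eta> \<alpha>) p (sdiv p N w) \<rho> = 0" if "\<alpha> \<subseteq> \<rho>" for \<rho>
  proof (rule ccontr)
    assume "simp_chain (near_vertex \<eta> \<alpha>) p (sdiv p N w) \<rho> \<noteq> 0"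
    then obtain f where f: "f \<in> Poly_Mapping.keys (sdiv p N w)" "vset (near_vertex \<eta> \<alpha>) p f = \<rho>"
      by (rule simp_chain_nonzeroE)
    have "f \<in> standard_simplex p \<rightarrow> {x. good \<eta> \<alpha> x}"
      using singular_chain_sdiv[OF \<eta>(2), of N] f(1) by (auto simp: singular_chain_subtopology)
    moreover obtain z where "z \<in> geometric_realization K" "f \<in> standard_simplex p \<rightarrow> nbhd (\<eta> / 4) z"
      using Y(3) f(1) by blast
    ultimately show False using vset_small(2)[OF \<alpha>' \<eta>(1) _ _ ne, of f p z] f(2) that by blast
  qed
  show ?thesis
  proof (intro exI conjI ballI)
    show "chn ?s (Suc (Suc p)) (rstr ?s Y)" using Y(1) by (auto simp: chn_def rstr_def)
    fix \<rho> assume \<rho>: "\<rho> \<in> ?s"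
    have "bd V (rstr ?s Y) \<rho> = bd V Y \<rho>"
    proof (rule bd_cong)
      fix v
      show "rstr ?s Y (insert v \<rho>) = Y (insert v \<rho>)"
      proof (cases "Y (insert v \<rho>) = 0")
        case False
        then have "insert v \<rho> \<in> K" using Y(1) unfolding chn_def by blast
        then have "insert v \<rho> \<in> ?s" using \<rho> by auto
        then show ?thesis by (simp only: rstr_def if_True)
      qed (simp add: rstr_def)
    qed
    also have "\<dots> = of_int (a \<rho>)" using Y(2)[rule_format, of \<rho>] z[of \<rho>] \<rho> by simp
    finally show "bd V (rstr ?s Y) \<rho> = of_int (a \<rho>)" .
  qed
qed

text \<open>The simplices of \<open>w\<close> are constant at \<open>b\<close> and get a single
  label, so \<open>w\<close> contributes at most one vertex, and only for \<open>p = 0\<close>; the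
  parity condition \<open>cyc\<close> excludes that. Homology relative to a point thus plays the
  part of reduced homology.\<close>

lemma global_bridge:
  assumes y: "singular_chain (Suc p) X y"
    and w: "singular_chain p (subtopology X {b}) w" and b: "b \<in> geometric_realization K"
    and eq: "real_chain p a = chain_boundary (Suc p) y + w + frag_cmul 2 u"
    and a: "\<And>\<tau>. a \<tau> \<noteq> 0 \<Longrightarrow> \<tau> \<in> K \<and> card \<tau> = Suc p"
    and cyc: "p = 0 \<Longrightarrow> bd V (\<lambda>\<tau>. of_int (a \<tau>)) {} = 0"
  shows "\<exists>Y. chn K (Suc (Suc p)) Y \<and> (\<forall>\<rho>. bd V Y \<rho> = of_int (a \<rho>))"
proof -
  obtain \<eta> where \<eta>: "small_enough \<eta>" using small_enough_exists[of 1] by auto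
  have wX: "singular_chain p X w" using w by (simp add: singular_chain_subtopology)
  obtain Y N where Y: "chn K (Suc (Suc p)) Y"
    "\<forall>\<rho>. of_int (a \<rho>) = bd V Y \<rho> + simp_chain (near_vertex \<eta> {}) p (sdiv p N w) \<rho>"
    using bridge[OF _ \<eta> y wX eq a, of "{}"] by blast
  let ?v = "near_vertex \<eta> {}" and ?W = "simp_chain (near_vertex \<eta> {}) p (sdiv p N w)"
  have W: "\<rho> = {?v b} \<and> p = 0" if nz: "?W \<rho> \<noteq> 0" for \<rho>
  proof -
    obtain f where f: "f \<in> Poly_Mapping.keys (sdiv p N w)" "vset ?v p f = \<rho>" "card \<rho> = Suc p"
      using nz by (rule simp_chain_nonzeroE)
    have "f ` standard_simplex p \<subseteq> {b}"
      using singular_chain_sdiv[OF w, of N] f(1) by (auto simp: singular_chain_subtopology)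
    then have fb: "f (unit_pt i) = b" if "i \<le> p" for i using that by (auto simp: image_subset_iff)
    have "vset ?v p f = (\<lambda>i. ?v b) ` {..p}" unfolding vset_def by (rule image_cong) (simp_all add: fb)
    then have "vset ?v p f = {?v b}" by auto
    then show ?thesis using f(2,3) by auto
  qed
  have "?W \<rho> = 0" for \<rho>
  proof (rule ccontr)
    assume nz: "?W \<rho> \<noteq> 0"
    note p0 = W[OF nz]
    have vV: "?v b \<in> V" using near_vertex_coord(1)[OF b _ \<eta>, of "{}"] by blast
    have "0 = bd V (\<lambda>\<tau>. of_int (a \<tau>)) {}" using cyc p0 by simp
    also have "\<dots> = bd V (\<lambda>\<tau>. bd V Y \<tau> + ?W \<tau>) {}" by (rule bd_cong) (rule Y(2)[rule_format])
    also have "\<dots> = bd V ?W {}" unfolding bd_add bd_bd[OF fin_V] by simp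
    also have "\<dots> = (\<Sum>u\<in>V. if u = ?v b then ?W {?v b} else 0)"
      unfolding bd_def Diff_empty
    proof (rule sum.cong[OF refl])
      fix u
      show "?W {u} = (if u = ?v b then ?W {?v b} else 0)"
      proof (cases "?W {u} = 0")
        case False
        then have "u = ?v b" using W[of "{u}"] by blast
        then show ?thesis by simp
      next
        case True
        then show ?thesis by auto
      qed
    qed
    also have "\<dots> = ?W {?v b}" using vV fin_V by simp
    finally have "?W {?v b} = 0" by (rule sym)
    then show False using nz p0 by metis
  qed
  then have "bd V Y \<rho> = of_int (a \<rho>)" for \<rho> using Y(2)[rule_format, of \<rho>] by simp
  with Y(1) show ?thesis by blast
qed

end

section \<open>Filling relative cycles mod 2\<close>

lemma relboundary_of_trivial:
  assumes "trivial_group (relative_homology_group (int p) X A)" "singular_relcycle p X A c"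
  shows "singular_relboundary p X A c"
proof -
  have "homologous_rel_set p X A c \<in> carrier (relative_homology_group (int p) X A)"
    using assms(2) by (auto simp: carrier_relative_homology_group)
  then have "homologous_rel_set p X A c = singular_relboundary_set p X A"
    using assms(1) by (simp add: trivial_group_def)
  then show ?thesis by (simp add: homologous_rel_set_eq_relboundary)
qed

text \<open>The trivial alternative covers the boundary points of a ball, so that spheres and balls
  are treated together.\<close>

definition cyclic_or_trivial :: "nat \<Rightarrow> 'a topology \<Rightarrow> 'a set \<Rightarrow> bool" where
  "cyclic_or_trivial p X A \<longleftrightarrow> trivial_group (relative_homology_group (int p) X A) \<or>
     relative_homology_group (int p) X A \<cong> integer_group"

text \<open>In an infinite cyclic group one of two elements or their difference is divisible by 2.\<close>
lemma one_of_three_even: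
  assumes "cyclic_or_trivial p X A"
    and z1: "singular_relcycle p X A z1" and z2: "singular_relcycle p X A z2"
  obtains z s where "z \<in> {z1, z2, z1 - z2}" "singular_relcycle p X A s"
    "singular_relboundary p X A (z - (s + s))"
  using assms(1) unfolding cyclic_or_trivial_def
proof
  assume "trivial_group (relative_homology_group (int p) X A)"
  then have "singular_relboundary p X A z1" using z1 by (rule relboundary_of_trivial)
  then show thesis using that[of z1 0] by simp
next
  let ?H = "relative_homology_group (int p) X A" and ?c = "homologous_rel_set p X A"
  assume "?H \<cong> integer_group"
  then obtain h where h: "h \<in> iso ?H integer_group" by (auto simp: is_iso_def)
  have hom: "h (a \<otimes>\<^bsub>?H\<^esub> b) = h a + h b" if "a \<in> carrier ?H" "b \<in> carrier ?H" for a b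
    using h that by (auto simp: iso_def hom_def)
  have inj: "inj_on h (carrier ?H)" and surj: "h ` carrier ?H = UNIV"
    using h by (auto simp: iso_def bij_betw_def)
  have car: "?c z \<in> carrier ?H" if "singular_relcycle p X A z" for z
    using that by (auto simp: carrier_relative_homology_group)
  have mult: "?c z \<otimes>\<^bsub>?H\<^esub> ?c w = ?c (z + w)"
    if "singular_relcycle p X A z" "singular_relcycle p X A w" for z w
  proof -
    have "?c z \<otimes>\<^bsub>?H\<^esub> ?c w = (\<Union>r\<in>?c z. \<Union>s\<in>?c w. {r + s})"
      by (simp add: mult_relative_homology_group)
    also have "\<dots> = ?c (z + w)"
    proof (intro equalityI subsetI)
      fix x assume "x \<in> (\<Union>r\<in>?c z. \<Union>s\<in>?c w. {r + s})"
      then show "x \<in> ?c (z + w)" by (auto intro: homologous_rel_add)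
    next
      fix x assume x: "x \<in> ?c (z + w)"
      then have "homologous_rel p X A (z + w - w) (x - w)"
        using homologous_rel_diff[of p X A "z + w" x w w] by simp
      then have "x - w \<in> ?c z" by simp
      then show "x \<in> (\<Union>r\<in>?c z. \<Union>s\<in>?c w. {r + s})"
        by (intro UN_I[of "x - w"] UN_I[of w]) auto
    qed
    finally show ?thesis .
  qed
  have main: "\<exists>s. singular_relcycle p X A s \<and> singular_relboundary p X A (z - (s + s))"
    if z: "singular_relcycle p X A z" and ev: "even (h (?c z))" for z
  proof -
    obtain j' where "h (?c z) = 2 * j'" using ev by (rule evenE)
    then obtain j where j: "h (?c z) = j + j" by (simp only: mult_2)
    obtain s where s: "singular_relcycle p X A s" "h (?c s) = j"
    proof -
      have "j \<in> h ` carrier ?H" using surj by simp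
      then show thesis using that by (auto simp: carrier_relative_homology_group)
    qed
    have ss: "singular_relcycle p X A (s + s)" by (intro singular_relcycle_add s)
    have "h (?c (s + s)) = h (?c z)" using hom[OF car car, of s s] mult[of s s] s j by simp
    then have "?c z = ?c (s + s)" using inj car[OF z] car[OF ss] by (auto simp: inj_on_def)
    then have "homologous_rel p X A z (s + s)" by (metis homologous_rel_refl mem_Collect_eq)
    then show ?thesis using s by (auto simp: homologous_rel_def)
  qed
  have dcyc: "singular_relcycle p X A (z1 - z2)" by (intro singular_relcycle_diff z1 z2)
  have "h (?c z1) = h (?c (z1 - z2)) + h (?c z2)"
    using hom[OF car car, OF dcyc z2] mult[OF dcyc z2] by simp
  then have "even (h (?c z1)) \<or> even (h (?c z2)) \<or> even (h (?c (z1 - z2)))" by presburger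
  then show thesis using main[OF z1] main[OF z2] main[OF dcyc] that by blast
qed

section \<open>Local homology of spheres and balls\<close>

lemma iso_point_complement:
  assumes "homeomorphic_map X Y f" "b \<in> topspace X"
  shows "relative_homology_group p X (topspace X - {b}) \<cong> relative_homology_group p Y (topspace Y - {f b})"
    "relative_homology_group p X {b} \<cong> relative_homology_group p Y {f b}"
proof -
  have im: "f ` (topspace X - {b}) = topspace Y - {f b}"
    using assms unfolding homeomorphic_eq_everything_map inj_on_def by blast
  show "relative_homology_group p X (topspace X - {b}) \<cong> relative_homology_group p Y (topspace Y - {f b})"
    by (rule is_isoI[OF homeomorphic_map_relative_homology_iso[OF assms(1)]]) (use im in auto)
  show "relative_homology_group p X {b} \<cong> relative_homology_group p Y {f b}"
    by (rule is_isoI[OF homeomorphic_map_relative_homology_iso[OF assms(1)]]) (use assms in auto)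
qed

lemma continuous_map_prod_coord:
  "continuous_map (prod_topology (top_of_set {0..1::real}) (subtopology (powertop_real UNIV) S)) euclideanreal (\<lambda>r. snd r k)"
  "continuous_map (prod_topology (top_of_set {0..1::real}) (subtopology (powertop_real UNIV) S)) euclideanreal fst"
proof -
  show "continuous_map (prod_topology (top_of_set {0..1::real}) (subtopology (powertop_real UNIV) S)) euclideanreal (\<lambda>r. snd r k)"
    using continuous_map_compose[OF continuous_map_snd, of "subtopology (powertop_real UNIV) S" euclideanreal "\<lambda>x. x k" "top_of_set {0..1}"]
      continuous_map_from_subtopology[OF continuous_map_product_projection, of k UNIV "\<lambda>_. euclideanreal" S]
    by (simp add: o_def)
  show "continuous_map (prod_topology (top_of_set {0..1::real}) (subtopology (powertop_real UNIV) S)) euclideanreal fst"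
    by (rule continuous_map_into_fulltopology[OF continuous_map_fst])
qed

lemma contractible_punctured_nsphere:
  assumes b: "b \<in> topspace (nsphere n)"
  shows "contractible_space (subtopology (nsphere n) (topspace (nsphere n) - {b}))"
proof -
  let ?S = "{x::nat \<Rightarrow> real. (\<Sum>i\<le>n. x i ^ 2) = 1 \<and> (\<forall>i>n. x i = 0) \<and> x \<noteq> b}"
  let ?Y = "subtopology (powertop_real UNIV) ?S" and ?T = "top_of_set {0..1::real}"
  have Y: "subtopology (nsphere n) (topspace (nsphere n) - {b}) = ?Y"
    unfolding nsphere subtopology_subtopology by (rule arg_cong[of _ _ "subtopology (powertop_real UNIV)"]) auto
  have b1: "(\<Sum>i\<le>n. b i ^ 2) = 1" "\<And>i. i > n \<Longrightarrow> b i = 0" using b by (auto simp: nsphere)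
  let ?h = "\<lambda>r i. (1 - fst r) * snd r i - fst r * b i"
  let ?q = "\<lambda>r. \<Sum>j\<le>n. (?h r j)\<^sup>2"
  let ?F = "\<lambda>r i. ?h r i / sqrt (?q r)"
  \<comment> \<open>One computation for two claims: \<open>l = 0\<close> says that the segment from
    \<open>x\<close> to the antipode of \<open>b\<close> misses the origin, positive
    \<open>l\<close> that its radial projection misses \<open>b\<close>.\<close>
  have key: "x = b" if x: "(\<Sum>i\<le>n. x i ^ 2) = 1" "\<forall>i>n. x i = 0" and t: "0 \<le> t" "t \<le> 1" and l: "0 \<le> l"
    and eq: "\<And>i. i \<le> n \<Longrightarrow> (1 - t) * x i - t * b i = l * b i" for x t l
  proof -
    have "(1 - t)\<^sup>2 = (\<Sum>i\<le>n. ((1 - t) * x i)\<^sup>2)" using x by (simp add: power_mult_distrib flip: sum_distrib_left)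
    also have "\<dots> = (\<Sum>i\<le>n. ((l + t) * b i)\<^sup>2)"
    proof (rule sum.cong[OF refl])
      fix i assume "i \<in> {..n}"
      then have "(1 - t) * x i = (l + t) * b i" using eq[of i] by (simp add: algebra_simps)
      then show "((1 - t) * x i)\<^sup>2 = ((l + t) * b i)\<^sup>2" by simp
    qed
    also have "\<dots> = (l + t)\<^sup>2" using b1 by (simp add: power_mult_distrib flip: sum_distrib_left)
    finally have e: "1 - t = l + t" using t l by (simp add: power2_eq_iff_nonneg)
    then have "1 - t > 0" using t l by linarith
    have "x i = b i" for i
    proof (cases "i \<le> n")
      case True
      have "(1 - t) * x i = (l + t) * b i" using eq[OF True] by (simp add: algebra_simps)
      then have "(1 - t) * x i = (1 - t) * b i" by (simp only: e)
      then show ?thesis using \<open>1 - t > 0\<close> by simp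
    qed (use x b1 in auto)
    then show "x = b" by (rule ext)
  qed
  have q_pos: "?q r > 0" if r: "fst r \<in> {0..1}" "snd r \<in> ?S" for r
  proof (rule ccontr)
    assume "\<not> ?q r > 0"
    then have "?q r = 0" using sum_nonneg[of "{..n}" "\<lambda>j. (?h r j)\<^sup>2"] by force
    then have "?h r i = 0" if "i \<le> n" for i using that by (simp add: sum_nonneg_eq_0_iff)
    then have "snd r = b" using r by (intro key[where t = "fst r" and l = 0]) auto
    then show False using r by simp
  qed
  have FS: "?F r \<in> ?S" if r: "fst r \<in> {0..1}" "snd r \<in> ?S" for r
  proof -
    have rr: "0 \<le> fst r" "fst r \<le> 1" "(\<Sum>i\<le>n. (snd r i)\<^sup>2) = 1" "\<forall>i>n. snd r i = 0" "snd r \<noteq> b"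
      using r by auto
    have norm: "(\<Sum>i\<le>n. (h i / sqrt Q)\<^sup>2) = 1" if "Q = (\<Sum>i\<le>n. (h i)\<^sup>2)" "Q > 0" for h :: "nat \<Rightarrow> real" and Q
    proof -
      have "(\<Sum>i\<le>n. (h i / sqrt Q)\<^sup>2) = (\<Sum>i\<le>n. (h i)\<^sup>2 / Q)"
        using that(2) by (simp add: power_divide)
      also have "\<dots> = Q / Q" unfolding that(1) by (rule sum_divide_distrib[symmetric])
      finally show ?thesis using that(2) by simp
    qed
    have 1: "(\<Sum>i\<le>n. (?F r i)\<^sup>2) = 1" by (rule norm[OF refl q_pos[OF r]])
    have 2: "\<forall>i>n. ?F r i = 0" using r b1 by simp
    have "?F r \<noteq> b"
    proof
      assume Fb: "?F r = b"
      have l: "0 < sqrt (?q r)" using q_pos[OF r] by (rule real_sqrt_gt_zero)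
      have div: "u = s * c" if "u / s = c" "0 < s" for u s c :: real
        using that by (auto simp: field_simps)
      have "?h r i = sqrt (?q r) * b i" for i
        by (rule div[OF fun_cong[OF Fb, of i] l])
      then have "snd r = b"
        by (rule key[OF rr(3,4,1,2) less_imp_le[OF l]])
      then show False using rr(5) by simp
    qed
    with 1 2 show ?thesis by blast
  qed
  have hc: "continuous_map (prod_topology ?T ?Y) euclideanreal (\<lambda>r. ?h r k)" for k
    by (intro continuous_intros continuous_map_prod_coord)
  have "continuous_map (prod_topology ?T ?Y) euclideanreal (\<lambda>r. ?F r k)" for k
  proof (intro continuous_map_real_divide hc continuous_map_sqrt continuous_map_sum continuous_map_real_pow)
    fix r assume "r \<in> topspace (prod_topology ?T ?Y)"
    then have "?q r > 0" by (intro q_pos) auto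
    then show "sqrt (?q r) \<noteq> 0" by simp
  qed auto
  moreover have "?F \<in> topspace (prod_topology ?T ?Y) \<rightarrow> ?S"
  proof
    fix r assume "r \<in> topspace (prod_topology ?T ?Y)"
    then show "?F r \<in> ?S" by (intro FS) auto
  qed
  ultimately have cF: "continuous_map (prod_topology ?T ?Y) ?Y ?F"
    unfolding continuous_map_in_subtopology continuous_map_componentwise_UNIV by blast
  have 2: "?F (0, x) = id x" if "x \<in> topspace ?Y" for x using that by simp
  have 3: "?F (1, x) = (\<lambda>i. - b i)" for x using b1 by simp
  have "homotopic_with (\<lambda>x. True) ?Y ?Y id (\<lambda>x. (\<lambda>i. - b i))"
    by (subst homotopic_with, simp, intro exI[of _ ?F] conjI ballI allI) (use cF 2 3 in simp_all)
  then show ?thesis unfolding Y contractible_space_def by blast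
qed

text \<open>Homology relative to a contractible subspace is reduced homology, and the complement of
  a point in a sphere is as contractible as the point.\<close>

lemma homology_sphere_point:
  assumes X: "X homeomorphic_space nsphere n" and b: "b \<in> topspace X"
  shows "p \<noteq> int n \<Longrightarrow> trivial_group (relative_homology_group p X (topspace X - {b}))"
    "cyclic_or_trivial n X (topspace X - {b})"
    "p \<noteq> int n \<Longrightarrow> trivial_group (relative_homology_group p X {b})"
proof -
  obtain f where f: "homeomorphic_map X (nsphere n) f" using X by (auto simp: homeomorphic_space)
  let ?b = "f b" and ?S = "nsphere n"
  have b': "?b \<in> topspace ?S" using f b homeomorphic_imp_surjective_map by fastforce
  have ne: "topspace ?S \<inter> (topspace ?S - {?b}) \<noteq> {}"
  proof -
    have "(\<lambda>i. - ?b i) \<in> topspace ?S" using b' by (simp add: nsphere)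
    moreover have "(\<lambda>i. - ?b i) \<noteq> ?b"
    proof
      assume eq: "(\<lambda>i. - ?b i) = ?b"
      have "?b i = 0" for i using fun_cong[OF eq, of i] by simp
      then have "(\<Sum>i\<le>n. (?b i)\<^sup>2) = 0" by simp
      then show False using b' by (simp add: nsphere)
    qed
    ultimately show ?thesis by blast
  qed
  have 1: "relative_homology_group p ?S (topspace ?S - {?b}) \<cong> reduced_homology_group p ?S" for p
    using isomorphic_relative_homology_by_contractible[OF contractible_punctured_nsphere[OF b'] ne] .
  have 2: "relative_homology_group p ?S {?b} \<cong> reduced_homology_group p ?S" for p
    using isomorphic_relative_homology_by_singleton[OF b'] .
  have 3: "relative_homology_group p X (topspace X - {b}) \<cong> reduced_homology_group p ?S"
    "relative_homology_group p X {b} \<cong> reduced_homology_group p ?S" for p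
    using iso_trans[OF iso_point_complement(1)[OF f b] 1] iso_trans[OF iso_point_complement(2)[OF f b] 2] .
  show "trivial_group (relative_homology_group p X (topspace X - {b}))" if "p \<noteq> int n"
    using isomorphic_group_triviality[OF 3(1)] reduced_homology_group_nsphere(2)[OF that] by simp
  show "trivial_group (relative_homology_group p X {b})" if "p \<noteq> int n"
    using isomorphic_group_triviality[OF 3(2)] reduced_homology_group_nsphere(2)[OF that] by simp
  show "cyclic_or_trivial n X (topspace X - {b})"
    unfolding cyclic_or_trivial_def using iso_trans[OF 3(1) reduced_homology_group_nsphere(1)] by blast
qed

text \<open>A nonsurjective self-map of a sphere is nullhomotopic and the identity is not. This
  excludes single cofacets in \<open>ridge_not_one\<close>.\<close>

lemma homotopic_id_surjective:
  assumes X: "X homeomorphic_space nsphere n" and hom: "homotopic_with (\<lambda>x. True) X X id f"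
  shows "f ` topspace X = topspace X"
proof (rule ccontr)
  assume ns: "f ` topspace X \<noteq> topspace X"
  obtain g k where gk: "homeomorphic_maps X (nsphere n) g k" using X by (auto simp: homeomorphic_space_def)
  then have cg: "continuous_map X (nsphere n) g" and ck: "continuous_map (nsphere n) X k"
    and kg: "\<And>x. x \<in> topspace X \<Longrightarrow> k (g x) = x" and gk': "\<And>y. y \<in> topspace (nsphere n) \<Longrightarrow> g (k y) = y"
    by (auto simp: homeomorphic_maps_def)
  have cf: "continuous_map X X f" using hom homotopic_with_imp_continuous_maps by blast
  let ?f = "g \<circ> f \<circ> k"
  have cF: "continuous_map (nsphere n) (nsphere n) ?f"
    using cf cg ck by (intro continuous_map_compose)
  have gS: "g x \<in> topspace (nsphere n)" if "x \<in> topspace X" for x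
    using cg that by (auto simp: continuous_map_def)
  have kX: "k y \<in> topspace X" if "y \<in> topspace (nsphere n)" for y
    using ck that by (auto simp: continuous_map_def)
  have fX: "f x \<in> topspace X" if "x \<in> topspace X" for x
    using cf that by (auto simp: continuous_map_def)
  have "?f ` topspace (nsphere n) \<noteq> topspace (nsphere n)"
  proof
    assume eq: "?f ` topspace (nsphere n) = topspace (nsphere n)"
    have "topspace X \<subseteq> f ` topspace X"
    proof
      fix x assume x: "x \<in> topspace X"
      have "g x \<in> ?f ` topspace (nsphere n)" using eq gS[OF x] by simp
      then obtain y where y: "y \<in> topspace (nsphere n)" "g x = g (f (k y))" by auto
      then have "x = f (k y)" using kg[OF x] kg[OF fX[OF kX[OF y(1)]]] by metis
      then show "x \<in> f ` topspace X" using kX[OF y(1)] by blast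
    qed
    then show False using ns fX by blast
  qed
  then obtain a where a: "homotopic_with (\<lambda>x. True) (nsphere n) (nsphere n) ?f (\<lambda>x. a)"
    using nullhomotopic_nonsurjective_sphere_map[OF cF] by blast
  have "homotopic_with (\<lambda>x. True) X (nsphere n) (g \<circ> id) (g \<circ> f)"
    by (rule homotopic_with_compose_continuous_map_left[OF hom cg]) simp
  then have "homotopic_with (\<lambda>x. True) (nsphere n) (nsphere n) (g \<circ> id \<circ> k) ?f"
    by (rule homotopic_with_compose_continuous_map_right[OF _ ck]) simp
  then have "homotopic_with (\<lambda>x. True) (nsphere n) (nsphere n) id ?f"
    by (rule homotopic_with_eq) (simp_all add: gk')
  then have "homotopic_with (\<lambda>x. True) (nsphere n) (nsphere n) id (\<lambda>x. a)"
    using a by (rule homotopic_with_trans)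
  then show False using non_contractible_space_nsphere[of n] by (auto simp: contractible_space_def)
qed

section \<open>Boundary points and interior points of a ball\<close>

lemma nball_eq: "nball n = subtopology (powertop_real UNIV) {x. (\<forall>i\<ge>n. x i = 0) \<and> (\<Sum>i<n. x i ^ 2) \<le> 1}"
  unfolding nball_def Euclidean_space_def subtopology_subtopology
  by (rule arg_cong[of _ _ "subtopology (powertop_real UNIV)"]) auto

lemma contractible_star_shaped:
  assumes "\<And>x t. x \<in> S \<Longrightarrow> 0 \<le> t \<Longrightarrow> t \<le> 1 \<Longrightarrow> (\<lambda>i. (1 - t) * x i) \<in> (S :: (nat \<Rightarrow> real) set)"
  shows "contractible_space (subtopology (powertop_real UNIV) S)"
proof -
  let ?Y = "subtopology (powertop_real UNIV) S" and ?T = "top_of_set {0..1::real}"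
  let ?F = "\<lambda>r i. (1 - fst r) * snd r i"
  have "continuous_map (prod_topology ?T ?Y) euclideanreal (\<lambda>r. ?F r k)" for k
    by (intro continuous_intros continuous_map_prod_coord)
  moreover have "?F \<in> topspace (prod_topology ?T ?Y) \<rightarrow> S" using assms by auto
  ultimately have cF: "continuous_map (prod_topology ?T ?Y) ?Y ?F"
    unfolding continuous_map_in_subtopology continuous_map_componentwise_UNIV by blast
  have "homotopic_with (\<lambda>x. True) ?Y ?Y id (\<lambda>x. (\<lambda>i. 0))"
    by (subst homotopic_with, simp, intro exI[of _ ?F] conjI ballI allI) (use cF in simp_all)
  then show ?thesis unfolding contractible_space_def by blast
qed

lemma contractible_nball: "contractible_space (nball n)"
  unfolding nball_eq
proof (rule contractible_star_shaped)
  fix x :: "nat \<Rightarrow> real" and t :: real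
  assume x: "x \<in> {x. (\<forall>i\<ge>n. x i = 0) \<and> (\<Sum>i<n. x i ^ 2) \<le> 1}" and t: "0 \<le> t" "t \<le> 1"
  have "(\<Sum>i<n. ((1 - t) * x i)\<^sup>2) = (1 - t)\<^sup>2 * (\<Sum>i<n. (x i)\<^sup>2)"
    by (simp add: power_mult_distrib sum_distrib_left)
  also have "\<dots> \<le> 1 * 1" using x t by (intro mult_mono power_le_one sum_nonneg) auto
  finally show "(\<lambda>i. (1 - t) * x i) \<in> {x. (\<forall>i\<ge>n. x i = 0) \<and> (\<Sum>i<n. x i ^ 2) \<le> 1}"
    using x by simp
qed

text \<open>Scaling towards the origin reaches a point of norm 1 only from itself, so the punctured
  ball is still star-shaped.\<close>

lemma contractible_nball_minus_boundary_point:
  assumes b: "b \<in> topspace (nball n)" "(\<Sum>i<n. b i ^ 2) = 1"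
  shows "contractible_space (subtopology (nball n) (topspace (nball n) - {b}))"
proof -
  let ?S = "{x. (\<forall>i\<ge>n. x i = 0) \<and> (\<Sum>i<n. x i ^ 2) \<le> 1 \<and> x \<noteq> b}"
  have "subtopology (nball n) (topspace (nball n) - {b}) = subtopology (powertop_real UNIV) ?S"
    unfolding nball_eq subtopology_subtopology
    by (rule arg_cong[of _ _ "subtopology (powertop_real UNIV)"]) auto
  moreover have "contractible_space (subtopology (powertop_real UNIV) ?S)"
  proof (rule contractible_star_shaped)
    fix x :: "nat \<Rightarrow> real" and t :: real
    assume x: "x \<in> ?S" and t: "0 \<le> t" "t \<le> 1"
    have s: "(\<Sum>i<n. ((1 - t) * x i)\<^sup>2) = (1 - t)\<^sup>2 * (\<Sum>i<n. (x i)\<^sup>2)"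
      by (simp add: power_mult_distrib sum_distrib_left)
    have le: "(1 - t)\<^sup>2 * (\<Sum>i<n. (x i)\<^sup>2) \<le> (1 - t)\<^sup>2 * 1" using x by (intro mult_left_mono) auto
    have t1: "(1 - t)\<^sup>2 \<le> 1" using t by (intro power_le_one) auto
    have "(\<lambda>i. (1 - t) * x i) \<noteq> b"
    proof
      assume eq: "(\<lambda>i. (1 - t) * x i) = b"
      then have "(\<Sum>i<n. ((1 - t) * x i)\<^sup>2) = 1" using b(2) by auto
      then have "(1 - t)\<^sup>2 = 1" using s le t1 by linarith
      then have "t = 0" using t by (auto simp: power2_eq_1_iff)
      then have "x = b" using eq by simp
      then show False using x by simp
    qed
    moreover have "(\<Sum>i<n. ((1 - t) * x i)\<^sup>2) \<le> 1" using s le t1 by linarith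
    ultimately show "(\<lambda>i. (1 - t) * x i) \<in> ?S" using x by simp
  qed
  ultimately show ?thesis by simp
qed

text \<open>Complements of homeomorphic closed sets have isomorphic relative homology, which moves
  \<open>b\<close> to the origin; \<open>n\<close> dimension steps then lead to
  \<open>Euclidean_space 0\<close>.\<close>

lemma Euclidean_point_homology:
  assumes b: "b \<in> topspace (Euclidean_space n)"
  shows "relative_homology_group p (Euclidean_space n) (topspace (Euclidean_space n) - {b})
    \<cong> homology_group (p - int n) (Euclidean_space 0)"
proof -
  let ?z = "\<lambda>i::nat. 0::real"
  have E0: "topspace (Euclidean_space 0) = {?z}" by (auto simp: topspace_Euclidean_space)
  have zn: "?z \<in> topspace (Euclidean_space n)" by (simp add: topspace_Euclidean_space)
  have cl: "closedin (Euclidean_space n) {a}" if "a \<in> topspace (Euclidean_space n)" for a n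
    using that by (simp add: closedin_Euclidean_space_iff)
  have hom: "subtopology (Euclidean_space n) {b} homeomorphic_space subtopology (Euclidean_space n) {?z}"
    unfolding homeomorphic_space_def homeomorphic_maps_def
    by (rule exI[of _ "\<lambda>_. ?z"], rule exI[of _ "\<lambda>_. b"]) (use b zn in \<open>auto simp: continuous_map_in_subtopology\<close>)
  have 1: "relative_homology_group p (Euclidean_space n) (topspace (Euclidean_space n) - {b})
    \<cong> relative_homology_group p (Euclidean_space n) (topspace (Euclidean_space n) - {?z})"
    by (rule isomorphic_relative_homology_groups_Euclidean_complements[OF cl[OF b] cl[OF zn] hom])
  have "relative_homology_group (p - int n) (Euclidean_space 0) (topspace (Euclidean_space 0) - {?z})
    \<cong> relative_homology_group (p - int n + int n) (Euclidean_space (0 + n)) (topspace (Euclidean_space (0 + n)) - {?z})"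
    by (rule relative_homology_group_Euclidean_complement_step) (rule cl, simp add: E0)
  then have "homology_group (p - int n) (Euclidean_space 0)
    \<cong> relative_homology_group p (Euclidean_space n) (topspace (Euclidean_space n) - {?z})"
    by (simp add: E0)
  then show ?thesis
    using 1 group.iso_sym[OF group_relative_homology_group] iso_trans by blast
qed

text \<open>Radial projection onto the ball is a homotopy inverse of the inclusion of pairs: points
  outside the ball keep norm at least 1 along the linear homotopy, and \<open>b\<close> has norm
  less than 1.\<close>

lemma ball_interior_point_homology:
  assumes b: "b \<in> topspace (nball n)" "(\<Sum>i<n. b i ^ 2) < 1"
  shows "relative_homology_group p (nball n) (topspace (nball n) - {b})
    \<cong> relative_homology_group p (Euclidean_space n) (topspace (Euclidean_space n) - {b})"
proof -
  let ?D = "nball n" and ?E = "Euclidean_space n" and ?T = "top_of_set {0..1::real}"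
  let ?q = "\<lambda>y. \<Sum>i<n. (y i)\<^sup>2" and ?N = "\<lambda>y. max 1 (sqrt (\<Sum>i<n. (y i)\<^sup>2))"
  let ?g = "\<lambda>y i. y i / ?N y"
  have E: "?E = subtopology (powertop_real UNIV) {x. \<forall>i\<ge>n. x i = 0}" by (simp add: Euclidean_space_def)
  have ST: "topspace ?D - {b} \<subseteq> topspace ?E - {b}" by (auto simp: nball_eq E)
  have cE: "continuous_map ?E euclideanreal (\<lambda>y. y k)" for k
    unfolding E by (rule continuous_map_from_subtopology[OF continuous_map_product_projection]) simp
  have q0: "0 \<le> ?q y" for y :: "nat \<Rightarrow> real" by (simp add: sum_nonneg)
  have scale: "?q (\<lambda>i. c * y i) = c\<^sup>2 * ?q y" for c and y :: "nat \<Rightarrow> real"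
    by (simp add: power_mult_distrib sum_distrib_left)
  have gN: "?q (?g y) \<le> 1" for y :: "nat \<Rightarrow> real"
  proof -
    have "?q (?g y) = (1 / ?N y)\<^sup>2 * ?q y" using scale[of "1 / ?N y" y] by simp
    also have "\<dots> \<le> (1 / ?N y)\<^sup>2 * (?N y)\<^sup>2"
    proof (rule mult_left_mono)
      have "sqrt (?q y) \<le> ?N y" by simp
      then have "(sqrt (?q y))\<^sup>2 \<le> (?N y)\<^sup>2" using q0[of y] by (intro power_mono) auto
      then show "?q y \<le> (?N y)\<^sup>2" using q0[of y] by simp
    qed simp
    also have "\<dots> = 1"
    proof -
      have h: "(1 / s)\<^sup>2 * s\<^sup>2 = 1" if "s > 0" for s :: real using that by (simp add: power_divide)
      show ?thesis by (rule h) simp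
    qed
    finally show ?thesis .
  qed
  have cg: "continuous_map ?E ?D ?g"
    unfolding nball_eq continuous_map_in_subtopology continuous_map_componentwise_UNIV
  proof (intro conjI allI)
    fix k show "continuous_map ?E euclideanreal (\<lambda>y. ?g y k)"
      by (intro continuous_map_real_divide cE continuous_map_real_max continuous_map_sqrt continuous_map_sum
          continuous_map_real_pow) auto
  next
    show "?g \<in> topspace ?E \<rightarrow> {x. (\<forall>i\<ge>n. x i = 0) \<and> (\<Sum>i<n. x i ^ 2) \<le> 1}"
      using gN by (auto simp: topspace_Euclidean_space)
  qed
  have ci: "continuous_map ?D ?E id"
    unfolding nball_def by (rule continuous_map_from_subtopology) simp
  have ge1: "1 \<le> ?q (\<lambda>i. c * y i)" if "?q y > 1" "1 / ?N y \<le> c" for c and y :: "nat \<Rightarrow> real"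
  proof -
    have s: "sqrt (?q y) > 1" using that(1) by simp
    then have "?N y = sqrt (?q y)" by (simp only: max_def) simp
    then have c: "1 / sqrt (?q y) \<le> c" using that(2) by simp
    have "1 = (1 / sqrt (?q y))\<^sup>2 * ?q y" using s q0[of y] that(1) by (simp add: power_divide)
    also have "\<dots> \<le> c\<^sup>2 * ?q y" using c s q0[of y] by (intro mult_right_mono power_mono) auto
    finally show ?thesis by (simp only: scale)
  qed
  have gb: "?g y \<noteq> b" if "y \<noteq> b" for y
  proof (cases "?q y \<le> 1")
    case True
    then show ?thesis using that by simp
  next
    case False
    then have "1 \<le> ?q (?g y)" using ge1[of y "1 / ?N y"] by simp
    then show ?thesis using b(2) by auto
  qed
  let ?c = "\<lambda>r. (1 - fst r) / ?N (snd r) + fst r"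
  let ?F = "\<lambda>r i. ?c r * snd r i"
  have Fb: "(\<lambda>i. ((1 - t) / ?N y + t) * y i) \<noteq> b" if "y \<noteq> b" "0 \<le> t" "t \<le> 1" for y t
  proof (cases "?q y \<le> 1")
    case True
    then show ?thesis using that by simp
  next
    case False
    have h: "1 / s \<le> (1 - t) / s + t" if "s \<ge> 1" for s :: real
    proof -
      have "t * (1 / s) \<le> t * 1" using that \<open>0 \<le> t\<close> by (intro mult_left_mono) auto
      then show ?thesis by (simp add: diff_divide_distrib)
    qed
    have "1 / ?N y \<le> (1 - t) / ?N y + t" by (rule h) simp
    then have "1 \<le> ?q (\<lambda>i. ((1 - t) / ?N y + t) * y i)" using ge1[of y "(1 - t) / ?N y + t"] False by simp
    then show ?thesis using b(2) by auto
  qed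
  have cF: "continuous_map (prod_topology ?T ?E) ?E ?F"
    unfolding E continuous_map_in_subtopology continuous_map_componentwise_UNIV
  proof (intro conjI allI)
    fix k
    show "continuous_map (prod_topology ?T (subtopology (powertop_real UNIV) {x. \<forall>i\<ge>n. x i = 0})) euclideanreal (\<lambda>r. ?F r k)"
      by (intro continuous_map_real_mult continuous_map_add continuous_map_diff continuous_map_real_divide
          continuous_map_real_max continuous_map_sqrt continuous_map_sum continuous_map_real_pow
          continuous_map_prod_coord continuous_map_canonical_const) auto
  qed auto
  have 1: "homotopic_with (\<lambda>k. k \<in> (topspace ?E - {b}) \<rightarrow> (topspace ?E - {b})) ?E ?E (id \<circ> ?g) id"
  proof (subst homotopic_with)
    show "\<And>h k. (\<And>x. x \<in> topspace ?E \<Longrightarrow> h x = k x) \<Longrightarrow>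
      (h \<in> (topspace ?E - {b}) \<rightarrow> (topspace ?E - {b})) = (k \<in> (topspace ?E - {b}) \<rightarrow> (topspace ?E - {b}))"
      by (auto simp: Pi_iff)
    show "\<exists>h. continuous_map (prod_topology ?T ?E) ?E h \<and> (\<forall>x\<in>topspace ?E. h (0, x) = (id \<circ> ?g) x) \<and>
      (\<forall>x\<in>topspace ?E. h (1, x) = id x) \<and>
      (\<forall>t\<in>{0..1}. (\<lambda>x. h (t, x)) \<in> (topspace ?E - {b}) \<rightarrow> (topspace ?E - {b}))"
    proof (intro exI[of _ ?F] conjI ballI)
      fix t :: real assume t: "t \<in> {0..1}"
      show "(\<lambda>x. ?F (t, x)) \<in> (topspace ?E - {b}) \<rightarrow> (topspace ?E - {b})"
      proof
        fix y assume y: "y \<in> topspace ?E - {b}"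
        then have "?F (t, y) \<noteq> b" using Fb[of y t] t by simp
        moreover have "?F (t, y) \<in> topspace ?E" using y by (simp add: topspace_Euclidean_space)
        ultimately show "?F (t, y) \<in> topspace ?E - {b}" by simp
      qed
    qed (use cF in simp_all)
  qed
  have 2: "homotopic_with (\<lambda>h. h \<in> (topspace ?D - {b}) \<rightarrow> (topspace ?D - {b})) ?D ?D (?g \<circ> id) id"
  proof (rule homotopic_with_equal)
    have gid: "(?g \<circ> id) x = x" if "x \<in> topspace ?D" for x using that by (simp add: nball_eq)
    then show "?g \<circ> id \<in> (topspace ?D - {b}) \<rightarrow> (topspace ?D - {b})" by auto
    show "continuous_map ?D ?D (?g \<circ> id)" using ci cg by (rule continuous_map_compose)
    show "(?g \<circ> id) x = id x" if "x \<in> topspace ?D" for x using gid[OF that] by simp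
  qed auto
  have gT: "?g \<in> (topspace ?E - {b}) \<rightarrow> (topspace ?D - {b})"
    using cg gb unfolding continuous_map_def by blast
  show ?thesis
    by (rule homotopy_equivalent_space_imp_isomorphic_relative_homology_groups[OF ci _ cg gT 2 1]) (use ST in auto)
qed

lemma homology_ball_point:
  assumes X: "X homeomorphic_space nball n" and n: "n > 0" and b: "b \<in> topspace X"
  shows "p \<noteq> int n \<Longrightarrow> trivial_group (relative_homology_group p X (topspace X - {b}))"
    "cyclic_or_trivial n X (topspace X - {b})"
    "trivial_group (relative_homology_group p X {b})"
proof -
  obtain f where f: "homeomorphic_map X (nball n) f" using X by (auto simp: homeomorphic_space)
  let ?b = "f b" and ?D = "nball n" and ?z = "\<lambda>i::nat. 0::real"
  have b': "?b \<in> topspace ?D" using f b homeomorphic_imp_surjective_map by fastforce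
  show "trivial_group (relative_homology_group p X {b})"
    using isomorphic_group_triviality[OF iso_point_complement(2)[OF f b]]
      isomorphic_group_triviality[OF isomorphic_relative_homology_by_singleton[OF b']]
      trivial_reduced_homology_group_contractible_space[OF contractible_nball] by simp
  note iso = iso_point_complement(1)[OF f b]
  have zero_in: "?z \<in> topspace ?D - {?b}" if "(\<Sum>i<n. ?b i ^ 2) = 1"
  proof -
    have "?z \<noteq> ?b"
    proof
      assume eq: "?z = ?b"
      have "(\<Sum>i<n. ?b i ^ 2) = (\<Sum>i<n. ?z i ^ 2)" by (simp only: eq[symmetric])
      then show False using that by simp
    qed
    then show ?thesis by (simp add: nball_eq)
  qed
  have E0: "topspace (Euclidean_space 0) = {?z}" by (auto simp: topspace_Euclidean_space)
  show "trivial_group (relative_homology_group p X (topspace X - {b}))" if "p \<noteq> int n" for p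
  proof (cases "(\<Sum>i<n. ?b i ^ 2) = 1")
    case True
    note zb = zero_in[OF True]
    have "trivial_group (relative_homology_group p ?D (topspace ?D - {?b}))"
      by (intro trivial_relative_homology_group_contractible_spaces contractible_nball
          contractible_nball_minus_boundary_point b' True) (use zb in blast)
    then show ?thesis using isomorphic_group_triviality[OF iso] by simp
  next
    case False
    then have lt: "(\<Sum>i<n. ?b i ^ 2) < 1" using b' by (simp add: nball_eq)
    have bE: "?b \<in> topspace (Euclidean_space n)" using b' by (simp add: nball_eq topspace_Euclidean_space)
    have "trivial_group (homology_group (p - int n) (Euclidean_space 0))"
      by (rule homology_dimension_axiom[OF E0]) (use that in simp)
    then show ?thesis
      using isomorphic_group_triviality[OF iso] isomorphic_group_triviality[OF ball_interior_point_homology[OF b' lt]]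
        isomorphic_group_triviality[OF Euclidean_point_homology[OF bE]] by simp
  qed
  show "cyclic_or_trivial n X (topspace X - {b})"
  proof (cases "(\<Sum>i<n. ?b i ^ 2) = 1")
    case True
    note zb = zero_in[OF True]
    have "trivial_group (relative_homology_group (int n) ?D (topspace ?D - {?b}))"
      by (intro trivial_relative_homology_group_contractible_spaces contractible_nball
          contractible_nball_minus_boundary_point b' True) (use zb in blast)
    then show ?thesis using isomorphic_group_triviality[OF iso] by (simp add: cyclic_or_trivial_def)
  next
    case False
    then have lt: "(\<Sum>i<n. ?b i ^ 2) < 1" using b' by (simp add: nball_eq)
    have bE: "?b \<in> topspace (Euclidean_space n)" using b' by (simp add: nball_eq topspace_Euclidean_space)
    have "relative_homology_group (int n) X (topspace X - {b}) \<cong> homology_group (int n - int n) (Euclidean_space 0)"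
      using iso ball_interior_point_homology[OF b' lt] Euclidean_point_homology[OF bE] iso_trans by blast
    then show ?thesis using homology_coefficients[OF E0] iso_trans unfolding cyclic_or_trivial_def by fastforce
  qed
qed

section \<open>Integral fillings of cycles mod 2\<close>

lemma chnD: "chn A k c \<Longrightarrow> c \<sigma> \<noteq> 0 \<Longrightarrow> \<sigma> \<in> A \<and> card \<sigma> = k"
  unfolding chn_def by (erule allE, erule mp)

lemma singular_chain_frag_cmul_cancel:
  assumes "singular_chain p X (frag_cmul k c)" "k \<noteq> 0"
  shows "singular_chain p X c"
proof -
  have "Poly_Mapping.keys c \<subseteq> Poly_Mapping.keys (frag_cmul k c)"
    using assms(2) by (auto simp: in_keys_iff)
  then show ?thesis using assms(1) by (auto simp: singular_chain_def)
qed

text \<open>Universal coefficients on chains. With boundary \<open>w + 2u\<close> of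
  \<open>c\<close>, the chain \<open>u\<close> is a relative cycle, since twice its boundary lies in
  \<open>A\<close>, so it bounds some \<open>s\<close> up to \<open>A\<close>; then
  \<open>c - 2s\<close> is an integral relative cycle. \<open>w\<close> and \<open>u\<close> take
  the lower degree as argument because there is none for \<open>p = 0\<close>.\<close>

lemma fill_mod_2:
  assumes t: "trivial_group (relative_homology_group (int p) X A)"
    and c: "singular_chain p X c"
    and q: "\<And>q. p = Suc q \<Longrightarrow> trivial_group (relative_homology_group (int q) X A) \<and>
      singular_chain q (subtopology X A) (w q) \<and> singular_chain q X (u q) \<and>
      chain_boundary (Suc q) c = w q + frag_cmul 2 (u q)"
  shows "\<exists>y w s. singular_chain (Suc p) X y \<and> singular_chain p (subtopology X A) w \<and>
    c = chain_boundary (Suc p) y + w + frag_cmul 2 s"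
proof -
  have fill: "\<exists>y w. singular_chain (Suc p) X y \<and> singular_chain p (subtopology X A) w \<and> c = chain_boundary (Suc p) y + w"
    if "trivial_group (relative_homology_group (int p) X A)" "singular_relcycle p X A c" for p c
    using relboundary_of_trivial[OF that] unfolding singular_relboundary by blast
  show ?thesis
  proof (cases p)
    case 0
    have "singular_relcycle p X A c" using c 0 by (simp add: singular_relcycle chain_boundary_def)
    from fill[OF t this] show ?thesis by (metis add.right_neutral frag_cmul_zero2)
  next
    case (Suc r)
    note Q = q[OF Suc]
    have "singular_chain (r - 1) (subtopology X A) (chain_boundary r (u r))"
    proof (cases "r = 0")
      case True
      then show ?thesis by (simp add: chain_boundary_def)
    next
      case False
      have "chain_boundary r (chain_boundary (Suc r) c) = 0"
        using chain_boundary_boundary[of "Suc r" X c] c Suc by simp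
      then have "0 = chain_boundary r (w r) + frag_cmul 2 (chain_boundary r (u r))"
        using Q by (simp add: chain_boundary_add chain_boundary_cmul)
      then have "frag_cmul 2 (chain_boundary r (u r)) = - chain_boundary r (w r)"
        by (metis add_eq_0_iff)
      moreover have "singular_chain (r - 1) (subtopology X A) (- chain_boundary r (w r))"
        using Q singular_chain_boundary[of r "subtopology X A" "w r"] by (simp add: singular_chain_minus)
      ultimately show ?thesis using singular_chain_frag_cmul_cancel[of "r - 1" "subtopology X A" 2] by simp
    qed
    then have "singular_relcycle r X A (u r)" using Q by (simp add: singular_relcycle)
    then obtain s w' where s: "singular_chain (Suc r) X s" "singular_chain r (subtopology X A) w'"
      "u r = chain_boundary (Suc r) s + w'" using fill[of r] Q by blast
    have "chain_boundary p (c - frag_cmul 2 s) = w r + frag_cmul 2 w'"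
      using Q s Suc by (simp add: chain_boundary_diff chain_boundary_cmul frag_cmul_distrib2)
    moreover have "singular_chain r (subtopology X A) (w r + frag_cmul 2 w')"
      using Q s by (intro singular_chain_add singular_chain_cmul) auto
    moreover have "singular_chain p X (c - frag_cmul 2 s)"
      using c s Suc by (intro singular_chain_diff singular_chain_cmul) auto
    ultimately have "singular_relcycle p X A (c - frag_cmul 2 s)" using Suc by (simp add: singular_relcycle)
    then obtain y w'' where y: "singular_chain (Suc p) X y" "singular_chain p (subtopology X A) w''"
      "c - frag_cmul 2 s = chain_boundary (Suc p) y + w''" using fill[OF t] by blast
    have "c = chain_boundary (Suc p) y + w'' + frag_cmul 2 s" using y(3) by (simp add: algebra_simps)
    with y show ?thesis by blast
  qed
qed

section \<open>Triangulated spheres and balls\<close>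

text \<open>The singular input to the combinatorics: local homology at all points and homology
  relative to a point below degree \<open>n\<close>. It is shared by spheres and balls.\<close>

locale realized_manifold = realized +
  fixes n :: nat
  assumes local_trivial: "\<And>b p. b \<in> geometric_realization K \<Longrightarrow> p \<noteq> n \<Longrightarrow>
      trivial_group (relative_homology_group (int p) X (geometric_realization K - {b}))"
    and local_cyclic: "\<And>b. b \<in> geometric_realization K \<Longrightarrow> cyclic_or_trivial n X (geometric_realization K - {b})"
    and global_trivial: "\<And>b p. b \<in> geometric_realization K \<Longrightarrow> p < n \<Longrightarrow>
      trivial_group (relative_homology_group (int p) X {b})"
    and nonempty: "geometric_realization K \<noteq> {}"
begin

lemma barycenter_in: "\<alpha> \<in> K \<Longrightarrow> barycenter \<alpha> \<in> cell \<alpha>"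
  using faceD[of \<alpha>] by (auto simp: cell_def barycenter_def)

lemma barycenter_in_X: "\<alpha> \<in> K \<Longrightarrow> barycenter \<alpha> \<in> geometric_realization K"
  using barycenter_in cell_sub by blast

lemma cell_avoids_barycenter:
  assumes "\<alpha> \<in> K" "\<rho> \<in> K" "\<not> \<alpha> \<subseteq> \<rho>"
  shows "cell \<rho> \<subseteq> geometric_realization K - {barycenter \<alpha>}"
proof -
  obtain a where a: "a \<in> \<alpha>" "a \<notin> \<rho>" using assms(3) by blast
  have "barycenter \<alpha> a \<noteq> 0" using a faceD[OF assms(1)] by (auto simp: barycenter_def)
  then have "barycenter \<alpha> \<notin> cell \<rho>" using a by (auto simp: cell_def)
  then show ?thesis using cell_sub[OF assms(2)] by blast
qed

lemma real_chain_add: "real_chain p (\<lambda>\<tau>. a \<tau> + b \<tau>) = real_chain p a + real_chain p b"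
  by (simp add: real_chain_def frag_cmul_distrib sum.distrib)

lemma real_chain_diff: "real_chain p (\<lambda>\<tau>. a \<tau> - b \<tau>) = real_chain p a - real_chain p b"
  by (simp add: real_chain_def frag_cmul_diff_distrib sum_subtractf)

lemma real_chain_cmul: "real_chain p (\<lambda>\<tau>. k * a \<tau>) = frag_cmul k (real_chain p a)"
  by (simp add: real_chain_def frag_cmul_sum)

lemma real_chain_cong:
  "(\<And>\<tau>. \<tau> \<in> K \<Longrightarrow> card \<tau> = Suc p \<Longrightarrow> a \<tau> = b \<tau>) \<Longrightarrow> real_chain p a = real_chain p b"
  unfolding real_chain_def by (intro sum.cong) auto

definition lift_chain :: "('a set \<Rightarrow> bit) \<Rightarrow> 'a set \<Rightarrow> int" where
  "lift_chain c \<tau> = (if c \<tau> = 0 then 0 else 1)"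

lemma of_int_lift_chain [simp]: "of_int (lift_chain c \<tau>) = c \<tau>"
  by (cases "c \<tau>") (simp_all add: lift_chain_def)

lemma lift_chain_nonzero: "lift_chain c \<tau> \<noteq> 0 \<longleftrightarrow> c \<tau> \<noteq> 0"
  unfolding lift_chain_def by presburger

lemma even_int_bd_lift:
  assumes "chn K k c" "bd V c \<rho> = 0"
  shows "even (int_bd (lift_chain c) \<rho>)"
proof -
  have "of_int (int_bd (lift_chain c) \<rho>) = bd V (\<lambda>\<tau>. of_int (lift_chain c \<tau>)) \<rho>"
  proof (rule int_bd_mod_2)
    fix \<tau> assume "lift_chain c \<tau> \<noteq> 0"
    then have "c \<tau> \<noteq> 0" by (rule lift_chain_nonzero[THEN iffD1])
    with assms(1) have "\<tau> \<in> K \<and> card \<tau> = k" by (rule chnD)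
    then show "\<tau> \<in> K" ..
  qed
  then have "(of_int (int_bd (lift_chain c) \<rho>) :: bit) = 0" unfolding of_int_lift_chain assms(2) .
  moreover have "(of_int m :: bit) = of_bool (odd m)" for m :: int
  proof (cases "even m")
    case True
    then obtain j where "m = 2 * j" by (rule evenE)
    then show ?thesis by simp
  next
    case False
    then obtain j where "m = 2 * j + 1" by (rule oddE)
    then show ?thesis by simp
  qed
  ultimately show ?thesis by (metis of_bool_eq_0_iff)
qed

text \<open>Brings a boundary into the form required by \<open>fill_mod_2\<close>: faces outside
  \<open>P\<close> go to the subspace, and the even coefficients on \<open>P\<close> are
  halved.\<close>

lemma split_mod_2:
  assumes "\<And>\<rho>. \<rho> \<in> K \<Longrightarrow> P \<rho> \<Longrightarrow> even (h \<rho>)"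
  shows "real_chain q h = real_chain q (\<lambda>\<rho>. if P \<rho> then 0 else h \<rho>) +
    frag_cmul 2 (real_chain q (\<lambda>\<rho>. if P \<rho> then h \<rho> div 2 else 0))"
  unfolding real_chain_cmul[symmetric] real_chain_add[symmetric]
  by (rule real_chain_cong) (use assms in auto)

text \<open>Cells of faces not containing \<alpha> avoid its barycenter, so a cycle on the star is a
  relative cycle mod 2 for the complement of that point. Cardinality \<open>k\<close> is singular
  degree \<open>k - 1\<close>, which is less than \<open>n\<close>.\<close>

lemma star_acyclic_face:
  assumes \<alpha>: "\<alpha> \<in> K" and k: "k < Suc n"
  shows "acyc V (star (insert {} K) \<alpha>) k"
proof (rule acycI)
  let ?s = "star (insert {} K) \<alpha>"
  fix c assume c: "chn ?s k c" and z: "\<And>\<rho>. \<rho> \<in> ?s \<Longrightarrow> bd V c \<rho> = 0"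
  have ne: "\<alpha> \<noteq> {}" using faceD[OF \<alpha>] by simp
  have cK: "\<sigma> \<in> K \<and> \<alpha> \<subseteq> \<sigma> \<and> card \<sigma> = k" if "c \<sigma> \<noteq> 0" for \<sigma>
    using c that ne by (auto simp: chn_def)
  then have cK': "chn K k c" by (simp add: chn_def)
  show "\<exists>y. chn ?s (Suc k) y \<and> (\<forall>\<rho>\<in>?s. bd V y \<rho> = c \<rho>)"
  proof (cases k)
    case 0
    have "c \<sigma> = 0" for \<sigma> using cK[of \<sigma>] 0 faceD[of \<sigma>] by (cases "c \<sigma> = 0") auto
    then show ?thesis by (intro exI[of _ "\<lambda>_. 0"]) (simp add: chn_def)
  next
    case (Suc p)
    let ?A = "geometric_realization K - {barycenter \<alpha>}"
    let ?a = "lift_chain c"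
    let ?w = "\<lambda>q. real_chain q (\<lambda>\<rho>. if \<alpha> \<subseteq> \<rho> then 0 else int_bd ?a \<rho>)"
    let ?u = "\<lambda>q. real_chain q (\<lambda>\<rho>. if \<alpha> \<subseteq> \<rho> then int_bd ?a \<rho> div 2 else 0)"
    note bX = barycenter_in_X[OF \<alpha>]
    have t: "trivial_group (relative_homology_group (int p) X ?A)"
      by (rule local_trivial[OF bX]) (use k Suc in simp)
    have "\<exists>y w s. singular_chain (Suc p) X y \<and> singular_chain p (subtopology X ?A) w \<and>
      real_chain p ?a = chain_boundary (Suc p) y + w + frag_cmul 2 s"
    proof (rule fill_mod_2[OF t singular_chain_real_chain_UNIV, where w = ?w and u = ?u], intro conjI)
      fix q assume q: "p = Suc q"
      show "trivial_group (relative_homology_group (int q) X ?A)"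
        by (rule local_trivial[OF bX]) (use k Suc q in simp)
      show "singular_chain q (subtopology X ?A) (?w q)"
        by (rule singular_chain_real_chain) (use cell_avoids_barycenter[OF \<alpha>] in \<open>metis\<close>)
      show "singular_chain q X (?u q)" by (rule singular_chain_real_chain_UNIV)
      show "chain_boundary (Suc q) (real_chain p ?a) = ?w q + frag_cmul 2 (?u q)"
        unfolding q boundary_real_chain
      proof (rule split_mod_2)
        fix \<rho> assume "\<rho> \<in> K" "\<alpha> \<subseteq> \<rho>"
        then have "bd V c \<rho> = 0" using z by simp
        then show "even (int_bd ?a \<rho>)" by (rule even_int_bd_lift[OF cK'])
      qed
    qed
    then obtain y w s where yws: "singular_chain (Suc p) X y" "singular_chain p (subtopology X ?A) w"
      "real_chain p ?a = chain_boundary (Suc p) y + w + frag_cmul 2 s" by blast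
    have a: "\<tau> \<in> K \<and> card \<tau> = Suc p" if "?a \<tau> \<noteq> 0" for \<tau>
      using chnD[OF cK'] that[unfolded lift_chain_nonzero] unfolding Suc .
    show ?thesis using local_bridge[OF \<alpha> yws a] unfolding of_int_lift_chain Suc .
  qed
qed

text \<open>For \<open>k = 0\<close> the chain is a multiple of the empty face, which a vertex
  fills. Otherwise homology relative to a point is used, and the cycle condition at the empty face
  is the parity condition of \<open>global_bridge\<close>.\<close>

lemma acyclic_global:
  assumes k: "k < Suc n"
  shows "acyc V (star (insert {} K) {}) k"
proof (rule acycI)
  let ?s = "star (insert {} K) {}"
  fix c assume c: "chn ?s k c" and z: "\<And>\<rho>. \<rho> \<in> ?s \<Longrightarrow> bd V c \<rho> = 0"
  obtain b where b: "b \<in> geometric_realization K" using nonempty by blast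
  show "\<exists>y. chn ?s (Suc k) y \<and> (\<forall>\<rho>\<in>?s. bd V y \<rho> = c \<rho>)"
  proof (cases k)
    case 0
    have c0: "c \<sigma> = 0" if "\<sigma> \<noteq> {}" for \<sigma>
    proof (rule ccontr)
      assume "c \<sigma> \<noteq> 0"
      then have "\<sigma> \<in> K" "card \<sigma> = 0" using c 0 that by (auto simp: chn_def)
      then show False using faceD[of \<sigma>] by simp
    qed
    obtain \<tau> v where v: "\<tau> \<in> K" "v \<in> \<tau>" using realizationD(4)[OF b] faceD by blast
    have vK: "{v} \<in> K" using subface[OF v(1), of "{v}"] v(2) by simp
    let ?y = "\<lambda>\<sigma>. if \<sigma> = {v} then c {} else 0"
    have "bd V ?y \<rho> = c \<rho>" for \<rho>
    proof (cases "\<rho> = {}")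
      case True
      have "bd V ?y {} = (\<Sum>u\<in>V. if u = v then c {} else 0)" by (simp add: bd_def)
      also have "\<dots> = c {}" using v fin_V by auto
      finally show ?thesis using True by simp
    next
      case False
      then have "bd V ?y \<rho> = 0" unfolding bd_def by (intro sum.neutral) auto
      then show ?thesis using c0[OF False] by simp
    qed
    moreover have "chn ?s (Suc k) ?y" using vK 0 by (simp add: chn_def)
    ultimately show ?thesis by blast
  next
    case (Suc p)
    have cK: "\<sigma> \<in> K \<and> card \<sigma> = k" if "c \<sigma> \<noteq> 0" for \<sigma>
      using c that Suc by (auto simp: chn_def)
    then have cK': "chn K k c" by (simp add: chn_def)
    let ?a = "lift_chain c"
    let ?w = "\<lambda>q. 0 :: ('a \<Rightarrow> real) chain"
    let ?u = "\<lambda>q. real_chain q (\<lambda>\<rho>. int_bd ?a \<rho> div 2)"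
    have t: "trivial_group (relative_homology_group (int p) X {b})"
      by (rule global_trivial[OF b]) (use k Suc in simp)
    have "\<exists>y w s. singular_chain (Suc p) X y \<and> singular_chain p (subtopology X {b}) w \<and>
      real_chain p ?a = chain_boundary (Suc p) y + w + frag_cmul 2 s"
    proof (rule fill_mod_2[OF t singular_chain_real_chain_UNIV, where w = ?w and u = ?u], intro conjI)
      fix q assume q: "p = Suc q"
      show "trivial_group (relative_homology_group (int q) X {b})"
        by (rule global_trivial[OF b]) (use k Suc q in simp)
      show "singular_chain q (subtopology X {b}) 0" by simp
      show "singular_chain q X (?u q)" by (rule singular_chain_real_chain_UNIV)
      have "real_chain q (int_bd ?a) = real_chain q (\<lambda>\<rho>. 2 * (int_bd ?a \<rho> div 2))"
        by (rule real_chain_cong) (use even_int_bd_lift[OF cK'] z in simp)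
      then show "chain_boundary (Suc q) (real_chain p ?a) = 0 + frag_cmul 2 (?u q)"
        unfolding q boundary_real_chain by (simp add: real_chain_cmul)
    qed
    then obtain y w s where yws: "singular_chain (Suc p) X y" "singular_chain p (subtopology X {b}) w"
      "real_chain p ?a = chain_boundary (Suc p) y + w + frag_cmul 2 s" by blast
    have a: "\<tau> \<in> K \<and> card \<tau> = Suc p" if "?a \<tau> \<noteq> 0" for \<tau>
      using chnD[OF cK'] that[unfolded lift_chain_nonzero] unfolding Suc .
    have "bd V (\<lambda>\<tau>. of_int (?a \<tau>)) {} = 0" unfolding of_int_lift_chain by (rule z) simp
    from global_bridge[OF yws(1,2) b yws(3) a this]
    obtain Y where "chn K (Suc (Suc p)) Y" "\<forall>\<rho>. bd V Y \<rho> = of_int (?a \<rho>)" by blast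
    moreover from this(1) have "chn ?s (Suc k) Y" unfolding Suc by (rule chn_mono) auto
    ultimately show ?thesis unfolding of_int_lift_chain by blast
  qed
qed

lemma relcycle_local:
  assumes \<alpha>: "\<alpha> \<in> K" and p: "p > 0"
    and a: "\<And>\<rho>. \<rho> \<in> K \<Longrightarrow> card \<rho> = p \<Longrightarrow> \<alpha> \<subseteq> \<rho> \<Longrightarrow> int_bd a \<rho> = 0"
  shows "singular_relcycle p X (geometric_realization K - {barycenter \<alpha>}) (real_chain p a)"
proof -
  obtain q where q: "p = Suc q" using p by (cases p) auto
  have "singular_chain q (subtopology X (geometric_realization K - {barycenter \<alpha>})) (real_chain q (int_bd a))"
  proof (rule singular_chain_real_chain)
    fix \<tau> assume "\<tau> \<in> K" "card \<tau> = Suc q" "int_bd a \<tau> \<noteq> 0"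
    then have "\<not> \<alpha> \<subseteq> \<tau>" using a[of \<tau>] q by blast
    then show "cell \<tau> \<subseteq> geometric_realization K - {barycenter \<alpha>}"
      using cell_avoids_barycenter[OF \<alpha> \<open>\<tau> \<in> K\<close>] by blast
  qed
  then show ?thesis
    unfolding singular_relcycle q boundary_real_chain
    using singular_chain_real_chain_UNIV[of "Suc q" a] by simp
qed

text \<open>Without larger faces above \<alpha> the filling from \<open>local_bridge\<close> is
  zero. Both the dimension bound and the ridge bound rest on this.\<close>

lemma no_local_bound:
  assumes \<alpha>: "\<alpha> \<in> K" and a: "\<And>\<tau>. a \<tau> \<noteq> 0 \<Longrightarrow> \<tau> \<in> K \<and> card \<tau> = Suc p"
    and no: "\<And>\<tau>. \<tau> \<in> K \<Longrightarrow> \<alpha> \<subseteq> \<tau> \<Longrightarrow> card \<tau> \<noteq> Suc (Suc p)"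
    and rb: "singular_relboundary p X (geometric_realization K - {barycenter \<alpha>}) (real_chain p a - frag_cmul 2 s)"
    and \<rho>: "\<rho> \<in> K" "\<alpha> \<subseteq> \<rho>"
  shows "(of_int (a \<rho>) :: bit) = 0"
proof -
  obtain y w where yw: "singular_chain (Suc p) X y"
    "singular_chain p (subtopology X (geometric_realization K - {barycenter \<alpha>})) w"
    "chain_boundary (Suc p) y + w = real_chain p a - frag_cmul 2 s"
    using rb unfolding singular_relboundary by (elim exE conjE) (rule that)
  have eq: "real_chain p a = chain_boundary (Suc p) y + w + frag_cmul 2 s"
    using yw(3) by (simp add: algebra_simps)
  obtain Y where Y: "chn (star (insert {} K) \<alpha>) (Suc (Suc p)) Y"
    "\<forall>\<rho>\<in>star (insert {} K) \<alpha>. bd V Y \<rho> = of_int (a \<rho>)"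
    using local_bridge[OF \<alpha> yw(1,2) eq a] by blast
  have "Y \<sigma> = 0" for \<sigma>
  proof (rule ccontr)
    assume "Y \<sigma> \<noteq> 0"
    from chnD[OF Y(1) this] have "\<sigma> \<in> insert {} K" "\<alpha> \<subseteq> \<sigma>" "card \<sigma> = Suc (Suc p)" by simp_all
    then show False using no[of \<sigma>] by auto
  qed
  then have "bd V Y \<rho> = 0" by (simp add: bd_def)
  then show ?thesis using Y(2) \<rho> by simp
qed

text \<open>A maximal face with too many vertices is a relative cycle at its own barycenter. Local
  homology vanishes in its degree, but no larger face can bound it.\<close>

lemma card_face_le:
  assumes "\<sigma> \<in> K" shows "card \<sigma> \<le> Suc n"
proof (rule ccontr)
  assume big: "\<not> card \<sigma> \<le> Suc n"
  obtain \<tau> where \<tau>: "\<tau> \<in> K" "\<sigma> \<subseteq> \<tau>" and mx: "\<forall>\<phi>\<in>K. \<tau> \<subseteq> \<phi> \<longrightarrow> \<tau> = \<phi>"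
    using finite_has_maximal2[OF finite_K assms] by blast
  have fin: "finite \<tau>" using faceD[OF \<tau>(1)] by simp
  have "card \<sigma> \<le> card \<tau>" using \<tau>(2) fin by (rule card_mono[rotated])
  then obtain p where p: "card \<tau> = Suc p" "p > n" using big by (cases "card \<tau>") auto
  let ?a = "\<lambda>\<phi>. if \<phi> = \<tau> then 1 else 0 :: int"
  have rc: "singular_relcycle p X (geometric_realization K - {barycenter \<tau>}) (real_chain p ?a)"
    by (rule relcycle_local[OF \<tau>(1)]) (use p mx in \<open>auto simp: not_less\<close>)
  have tr: "trivial_group (relative_homology_group (int p) X (geometric_realization K - {barycenter \<tau>}))"
    using local_trivial[OF barycenter_in_X[OF \<tau>(1)]] p by simp
  have "singular_relboundary p X (geometric_realization K - {barycenter \<tau>}) (real_chain p ?a - frag_cmul 2 0)"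
    using relboundary_of_trivial[OF tr rc] by simp
  from no_local_bound[OF \<tau>(1) _ _ this \<tau>(1)] p mx \<tau>(1)
  have "(of_int (?a \<tau>) :: bit) = 0" by (metis Suc_inject n_not_Suc_n subset_refl)
  then show False by simp
qed

text \<open>Three cofacets of \<rho> give relative cycles for the pairs xy and xz, with difference
  zy. By \<open>one_of_three_even\<close> one of them is even up to a boundary, yet each has a
  coefficient 1 or -1, against \<open>no_local_bound\<close>.\<close>

lemma ridge_face_le:
  assumes \<rho>: "\<rho> \<in> K" "card \<rho> = n"
  shows "card {v\<in>V - \<rho>. insert v \<rho> \<in> K} \<le> 2"
proof (rule ccontr)
  let ?W = "{v\<in>V - \<rho>. insert v \<rho> \<in> K}"
  assume "\<not> card ?W \<le> 2"
  then obtain T where T: "T \<subseteq> ?W" "card T = 3" using obtain_subset_with_card_n[of 3 ?W] by auto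
  then obtain x y z where xyz: "T = {x, y, z}" "x \<noteq> y" "x \<noteq> z" "y \<noteq> z" by (auto simp: card_3_iff)
  have W: "x \<in> ?W" "y \<in> ?W" "z \<in> ?W" using T(1) xyz(1) by auto
  have n: "n > 0" using faceD[OF \<rho>(1)] \<rho>(2) by simp
  let ?A = "geometric_realization K - {barycenter \<rho>}"
  \<comment> \<open>These signs make two cofacets cancel over the integers in the boundary at
    \<rho>.\<close>
  let ?s = "\<lambda>v. (-1) ^ rk ix (insert v \<rho>) v :: int"
  let ?a = "\<lambda>u v \<tau>. (if \<tau> = insert u \<rho> then ?s u else 0) - (if \<tau> = insert v \<rho> then ?s v else 0)"
  have fr: "finite \<rho>" using faceD[OF \<rho>(1)] by simp
  have inj: "insert u \<rho> = insert v \<rho> \<longleftrightarrow> u = v" if "u \<notin> \<rho>" "v \<notin> \<rho>" for u v using that by auto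
  have one: "(\<Sum>w\<in>V - \<rho>. if insert w \<rho> \<in> K then ?s w * (if insert w \<rho> = insert u \<rho> then ?s u else 0) else 0) = 1"
    if u: "u \<in> ?W" for u
  proof -
    have "(\<Sum>w\<in>V - \<rho>. if insert w \<rho> \<in> K then ?s w * (if insert w \<rho> = insert u \<rho> then ?s u else 0) else 0)
      = (\<Sum>w\<in>V - \<rho>. if w = u then 1 else 0)"
    proof (rule sum.cong[OF refl])
      fix w assume w: "w \<in> V - \<rho>"
      show "(if insert w \<rho> \<in> K then ?s w * (if insert w \<rho> = insert u \<rho> then ?s u else 0) else 0) = (if w = u then 1 else 0)"
        using inj[of w u] w u by (cases "w = u") (auto simp flip: power_mult_distrib)
    qed
    also have "\<dots> = 1" using u finite_Diff[OF fin_V] by (simp only: sum.delta) simp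
    finally show ?thesis .
  qed
  have a_supp: "\<tau> \<in> K \<and> card \<tau> = Suc n" if "?a u v \<tau> \<noteq> 0" "u \<in> ?W" "v \<in> ?W" for u v \<tau>
  proof -
    have Wc: "insert w \<rho> \<in> K \<and> card (insert w \<rho>) = Suc n" if "w \<in> ?W" for w
      using that fr \<rho>(2) by simp
    have "\<tau> = insert u \<rho> \<or> \<tau> = insert v \<rho>" using \<open>?a u v \<tau> \<noteq> 0\<close> by (rule contrapos_np) simp
    then show ?thesis using Wc[OF \<open>u \<in> ?W\<close>] Wc[OF \<open>v \<in> ?W\<close>] by metis
  qed
  have rel: "singular_relcycle n X ?A (real_chain n (?a u v))" if "u \<in> ?W" "v \<in> ?W" for u v
  proof (rule relcycle_local[OF \<rho>(1) n])
    fix \<sigma> assume \<sigma>: "\<sigma> \<in> K" "card \<sigma> = n" "\<rho> \<subseteq> \<sigma>"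
    then have eq: "\<sigma> = \<rho>" using card_subset_eq[of \<sigma> \<rho>] faceD[OF \<sigma>(1)] \<rho>(2) by simp
    have "int_bd (?a u v) \<rho> =
      (\<Sum>w\<in>V - \<rho>. if insert w \<rho> \<in> K then ?s w * (if insert w \<rho> = insert u \<rho> then ?s u else 0) else 0) -
      (\<Sum>w\<in>V - \<rho>. if insert w \<rho> \<in> K then ?s w * (if insert w \<rho> = insert v \<rho> then ?s v else 0) else 0)"
      unfolding int_bd_def sum_subtractf[symmetric]
      by (intro sum.cong[OF refl]) (simp add: right_diff_distrib)
    then show "int_bd (?a u v) \<sigma> = 0" unfolding eq using one[OF that(1)] one[OF that(2)] by simp
  qed
  have diff: "real_chain n (?a x y) - real_chain n (?a x z) = real_chain n (?a z y)"
    unfolding real_chain_diff[symmetric] by (rule real_chain_cong) simp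
  have contra: False if uv: "u \<in> ?W" "v \<in> ?W" "u \<noteq> v" "singular_relboundary n X ?A (real_chain n (?a u v) - (s + s))" for u v s
  proof -
    have "s + s = frag_cmul 2 s" using frag_cmul_distrib[of 1 1 s] by simp
    then have rb: "singular_relboundary n X ?A (real_chain n (?a u v) - frag_cmul 2 s)" using uv(4) by simp
    have no: "card \<tau> \<noteq> Suc (Suc n)" if "\<tau> \<in> K" for \<tau> using card_face_le[OF that] by simp
    have "(of_int (?a u v (insert u \<rho>)) :: bit) = 0"
      by (rule no_local_bound[OF \<rho>(1) _ _ rb]) (use a_supp uv no in auto)
    moreover have "?a u v (insert u \<rho>) = ?s u" using uv inj[of u v] by simp
    ultimately show False using of_int_bit_neg1[of "rk ix (insert u \<rho>) u"] by (simp only:) simp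
  qed
  obtain c s where cs: "c \<in> {real_chain n (?a x y), real_chain n (?a x z), real_chain n (?a x y) - real_chain n (?a x z)}"
    "singular_relcycle n X ?A s" "singular_relboundary n X ?A (c - (s + s))"
    by (rule one_of_three_even[OF local_cyclic[OF barycenter_in_X[OF \<rho>(1)]] rel[OF W(1,2)] rel[OF W(1,3)]])
  consider "c = real_chain n (?a x y)" | "c = real_chain n (?a x z)" | "c = real_chain n (?a z y)"
    using cs(1) unfolding diff by blast
  then show False
  proof cases
    case 1
    then show ?thesis using contra[OF W(1,2) xyz(2)] cs(3) by blast
  next
    case 2
    then show ?thesis using contra[OF W(1,3) xyz(3)] cs(3) by blast
  next
    case 3
    then show ?thesis using contra[OF W(3,2) xyz(4)[symmetric]] cs(3) by blast
  qed
qed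

text \<open>For \<open>n = 0\<close> the ridge is the empty face, which has no barycenter, so the
  vertex count has to be supplied from outside.\<close>

lemma pseudo_acyclic:
  assumes "n = 0 \<Longrightarrow> card V \<le> 2"
  shows "pseudo_acyclic V (insert {} K) (Suc n)"
proof
  fix \<alpha> k assume "\<alpha> \<in> insert {} K" "k < Suc n"
  then show "acyc V (star (insert {} K) \<alpha>) k"
    using star_acyclic_face acyclic_global by auto
next
  fix \<sigma> assume "\<sigma> \<in> insert {} K"
  then show "card \<sigma> \<le> Suc n" using card_face_le by auto
next
  fix \<rho> assume \<rho>: "\<rho> \<in> insert {} K" "Suc (card \<rho>) = Suc n"
  show "card {v \<in> V - \<rho>. insert v \<rho> \<in> insert {} K} \<le> 2"
  proof (cases "\<rho> = {}")
    case True
    then have "card V \<le> 2" using \<rho> assms by simp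
    moreover have "card {v \<in> V - \<rho>. insert v \<rho> \<in> insert {} K} \<le> card V"
      using fin_V by (intro card_mono) auto
    ultimately show ?thesis by linarith
  next
    case False
    then have "card {v\<in>V - \<rho>. insert v \<rho> \<in> K} \<le> 2" using ridge_face_le \<rho> by simp
    then show ?thesis by simp
  qed
qed

end

text \<open>This tells spheres from balls: local homology bounds the number of cofacets only from
  above. The count 0 is excluded by \<open>pure\<close>.\<close>

lemma (in realized_manifold) ridge_not_one:
  assumes X: "X homeomorphic_space nsphere n" and \<rho>: "\<rho> \<in> K" "card \<rho> = n"
  shows "card {v\<in>V - \<rho>. insert v \<rho> \<in> K} \<noteq> 1"
proof
  assume "card {v\<in>V - \<rho>. insert v \<rho> \<in> K} = 1"
  then obtain u where W: "{v\<in>V - \<rho>. insert v \<rho> \<in> K} = {u}" by (auto simp: card_1_singleton_iff)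
  then have u: "u \<in> V" "u \<notin> \<rho>" "insert u \<rho> \<in> K" by auto
  have f: "finite \<rho>" "\<rho> \<noteq> {}" "\<rho> \<subseteq> V" using faceD[OF \<rho>(1)] by auto
  let ?T = "top_of_set {0..1::real}" and ?G = "geometric_realization K"
  \<comment> \<open>Were \<open>insert u \<rho>\<close> the only facet at \<open>\<rho>\<close>, the identity could be pushed off the barycenter of \<open>\<rho>\<close>
    in the direction \<open>c\<close>.\<close>
  define c where "c v = (if v = u then real (card \<rho>) / 2 else if v \<in> \<rho> then - 1 / 2 else 0)" for v
  \<comment> \<open>The minimum over \<rho> is positive only if the carrier contains \<rho>, and
    then the carrier lies in \<open>insert u \<rho>\<close>; elsewhere nothing moves. The weights of
    \<open>c\<close> sum to 0 and preserve the total, and \<open>- 1 / 2\<close> keeps the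
    coordinates in \<rho> nonnegative.\<close>
  define F where "F r v = snd r v + fst r * Min (snd r ` \<rho>) * c v" for r :: "real \<times> ('a \<Rightarrow> real)" and v
  have m0: "0 \<le> Min (x ` \<rho>)" if "x \<in> ?G" for x
    using realizationD(1)[OF that] f by (simp add: Min_ge_iff)
  have FX: "F (t, x) \<in> ?G" if t: "0 \<le> t" "t \<le> 1" and x: "x \<in> ?G" for t x
  proof (cases "Min (x ` \<rho>) = 0")
    case True
    then have "F (t, x) = x" by (auto simp: F_def)
    then show ?thesis using x by simp
  next
    case False
    then have mp: "0 < Min (x ` \<rho>)" using m0[OF x] by simp
    have "0 < x v" if "v \<in> \<rho>" for v using mp f that by (meson Min_le finite_imageI imageI less_le_trans)
    then have sub: "\<rho> \<subseteq> {v. x v > 0}" by auto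
    note sK = realizationD(4)[OF x]
    have "{v. x v > 0} \<subseteq> insert u \<rho>"
    proof
      fix v assume v: "v \<in> {v. x v > 0}"
      show "v \<in> insert u \<rho>"
      proof (cases "v \<in> \<rho>")
        case False
        have "insert v \<rho> \<in> K" using sub v by (intro subface[OF sK]) auto
        moreover have "v \<in> V" using sK v by blast
        ultimately have "v \<in> {v\<in>V - \<rho>. insert v \<rho> \<in> K}" using False by blast
        then show ?thesis unfolding W by simp
      qed simp
    qed
    then have out: "x v = 0" if "v \<notin> insert u \<rho>" for v
      using that realizationD(1)[OF x, of v] by (auto simp: order.order_iff_strict)
    have sx: "sum x (insert u \<rho>) = 1"
    proof -
      have "sum x V = sum x (insert u \<rho>)"
        by (rule sum.mono_neutral_right[OF fin_V]) (use out u f in auto)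
      then show ?thesis using realizationD(3)[OF x] by simp
    qed
    have "F (t, x) \<in> cell (insert u \<rho>)"
      unfolding cell_def
    proof (intro CollectI conjI allI impI)
      fix v
      have xm: "Min (x ` \<rho>) \<le> x v" if "v \<in> \<rho>" using f that by simp
      have "t * Min (x ` \<rho>) \<le> 1 * Min (x ` \<rho>)" using t mp by (intro mult_right_mono) auto
      then have "t * Min (x ` \<rho>) \<le> x v * 2" if "v \<in> \<rho>" using xm[OF that] mp by linarith
      then show "0 \<le> F (t, x) v"
        using xm u(2) t mp realizationD(1)[OF x, of v] by (auto simp: F_def c_def)
      show "F (t, x) v = 0" if "v \<notin> insert u \<rho>"
        using that out by (simp add: F_def c_def)
    next
      have "sum c \<rho> = (\<Sum>v\<in>\<rho>. - 1 / 2)" using u(2) by (intro sum.cong) (auto simp: c_def)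
      then have "sum c (insert u \<rho>) = 0" using f(1) u(2) by (simp add: c_def)
      then show "sum (F (t, x)) (insert u \<rho>) = 1"
        using sx by (simp add: F_def sum.distrib flip: sum_distrib_left)
    qed
    then show ?thesis using cell_sub[OF u(3)] by blast
  qed
  \<comment> \<open>Coordinate \<open>u\<close> of the barycenter is 0, which forces a zero push;
    then \<open>x\<close> is the barycenter itself, whose minimum over \<rho> is positive.\<close>
  have miss: "F (1, x) \<noteq> barycenter \<rho>" if x: "x \<in> ?G" for x
  proof
    assume eq: "F (1, x) = barycenter \<rho>"
    have "x u + Min (x ` \<rho>) * (real (card \<rho>) / 2) = 0"
      using fun_cong[OF eq, of u] u(2) by (simp add: F_def c_def barycenter_def)
    moreover have "0 \<le> x u" "0 \<le> Min (x ` \<rho>) * (real (card \<rho>) / 2)"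
      using realizationD(1)[OF x] m0[OF x] by auto
    ultimately have "Min (x ` \<rho>) * (real (card \<rho>) / 2) = 0" by linarith
    then have m: "Min (x ` \<rho>) = 0" using f by simp
    then have "x = barycenter \<rho>" using eq by (simp add: F_def fun_eq_iff)
    moreover have "Min (x ` \<rho>) \<in> x ` \<rho>" using f by (intro Min_in) auto
    ultimately obtain v where "v \<in> \<rho>" "barycenter \<rho> v = 0" using m by auto
    then show False using f by (simp add: barycenter_def)
  qed
  have cs: "continuous_map (prod_topology ?T X) euclideanreal (\<lambda>r. snd r v)" for v
    using continuous_map_compose[OF continuous_map_snd continuous_map_coord] by (simp add: o_def)
  have cfst: "continuous_map (prod_topology ?T X) euclideanreal fst"
    by (rule continuous_map_into_fulltopology[OF continuous_map_fst])
  have "continuous_map X euclideanreal (\<lambda>x. Min (x ` \<rho>))"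
    by (rule continuous_map_Min[OF f(1,2) continuous_map_coord])
  then have cm: "continuous_map (prod_topology ?T X) euclideanreal (\<lambda>r. Min (snd r ` \<rho>))"
    using continuous_map_compose[OF continuous_map_snd] by (fastforce simp: o_def)
  have "continuous_map (prod_topology ?T X) (powertop_real UNIV) F"
    unfolding continuous_map_componentwise_UNIV F_def
    by (intro allI continuous_map_add continuous_map_real_mult cs cfst cm continuous_map_canonical_const)
  moreover have "F \<in> topspace (prod_topology ?T X) \<rightarrow> ?G"
  proof
    fix r assume "r \<in> topspace (prod_topology ?T X)"
    then show "F r \<in> ?G" using FX[of "fst r" "snd r"] by auto
  qed
  ultimately have cF: "continuous_map (prod_topology ?T X) X F"
    unfolding realization_top_def continuous_map_in_subtopology by simp
  have F0: "F (0, x) = x" for x by (rule ext) (simp add: F_def)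
  have "homotopic_with (\<lambda>x. True) X X id (\<lambda>x. F (1, x))"
    by (subst homotopic_with, simp, intro exI[of _ F] conjI ballI allI) (use cF F0 in simp_all)
  from homotopic_id_surjective[OF X this]
  have "barycenter \<rho> \<in> (\<lambda>x. F (1, x)) ` ?G" using barycenter_in_X[OF \<rho>(1)] by simp
  then obtain x where "x \<in> ?G" "barycenter \<rho> = F (1, x)" by (rule imageE)
  then show False using miss[of x] by simp
qed

section \<open>From triangulations to the combinatorial notions\<close>

lemma ex_realized:
  assumes "simplicial_complex K"
  obtains ix where "realized K ix"
proof -
  have fin: "finite (\<Union>K)" using assms by (auto simp: simplicial_complex_def)
  obtain ix :: "'a \<Rightarrow> nat" where ix: "inj_on ix (\<Union>K)"
    using finite_imp_inj_to_nat_seg[OF fin] by blast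
  have "realized K ix"
  proof
    show "finite (\<Union>K)" by (rule fin)
    show "inj_on ix (\<Union>K)" by (rule ix)
    show "simplicial_complex K" by (rule assms)
    show "\<tau> \<in> insert {} K" if "\<sigma> \<in> insert {} K" "\<tau> \<subseteq> \<sigma>" for \<sigma> \<tau>
      using that assms unfolding simplicial_complex_def by auto
  qed auto
  then show thesis by (rule that)
qed

lemma topspace_nsphere_0: "card (topspace (nsphere 0)) = 2"
proof -
  let ?p = "\<lambda>s (i::nat). if i = 0 then s else (0::real)"
  have "topspace (nsphere 0) = {?p 1, ?p (-1)}"
  proof (intro equalityI subsetI)
    fix x assume "x \<in> topspace (nsphere 0)"
    then have x: "(x 0)\<^sup>2 = 1" "\<forall>i>0. x i = 0" by (auto simp: nsphere)
    then have "x 0 = 1 \<or> x 0 = - 1" by (simp add: power2_eq_1_iff)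
    then show "x \<in> {?p 1, ?p (-1)}" using x(2) by (auto simp: fun_eq_iff)
  next
    fix x assume "x \<in> {?p 1, ?p (-1)}"
    then show "x \<in> topspace (nsphere 0)" by (auto simp: nsphere)
  qed
  moreover have "?p 1 \<noteq> ?p (-1)" by (auto simp: fun_eq_iff)
  ultimately show ?thesis by simp
qed

lemma (in realized_manifold) card_vertices_0:
  assumes X: "X homeomorphic_space nsphere n" and n: "n = 0"
  shows "card V = 2"
proof -
  obtain h where h: "homeomorphic_map X (nsphere n) h" using X by (auto simp: homeomorphic_space)
  then have "bij_betw h (geometric_realization K) (topspace (nsphere n))"
    by (auto simp: homeomorphic_eq_everything_map bij_betw_def)
  then have c: "card (geometric_realization K) = 2"
    using topspace_nsphere_0 n bij_betw_same_card by fastforce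
  let ?e = "\<lambda>v::'a. barycenter {v}"
  have "geometric_realization K = ?e ` V"
  proof (intro equalityI subsetI)
    fix x assume x: "x \<in> geometric_realization K"
    note s = realizationD(4,5)[OF x]
    have "card {v. x v > 0} = 1"
      using card_face_le[OF s(1)] faceD[OF s(1)] n by (simp only: One_nat_def) linarith
    then obtain v where v: "{v. x v > 0} = {v}" by (auto simp: card_1_singleton_iff)
    have "x = ?e v"
    proof
      fix w show "x w = ?e v w"
        using s(2) unfolding v by (auto simp: cell_def barycenter_def)
    qed
    moreover have "v \<in> V" using s(1) unfolding v by blast
    ultimately show "x \<in> ?e ` V" by blast
  next
    fix x assume "x \<in> ?e ` V"
    then obtain v \<sigma> where v: "x = ?e v" "\<sigma> \<in> K" "v \<in> \<sigma>" by blast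
    then have "{v} \<in> K" using subface[OF v(2), of "{v}"] by simp
    then show "x \<in> geometric_realization K" using barycenter_in_X v(1) by blast
  qed
  moreover have "inj_on ?e V"
  proof (rule inj_onI)
    fix v w assume "?e v = ?e w"
    then have "?e v v = ?e w v" by simp
    then show "v = w" by (auto simp: barycenter_def split: if_splits)
  qed
  ultimately show ?thesis using c card_image by metis
qed

theorem triangulated_sphere_homology_sphere:
  assumes "triangulated_sphere n K"
  shows "homology_sphere (\<Union>K) (insert {} K) (Suc n)"
proof -
  have K: "simplicial_complex K" and hom: "realization_top K homeomorphic_space nsphere n"
    using assms by (auto simp: triangulated_sphere_def)
  obtain ix where "realized K ix" using ex_realized[OF K] .
  then interpret realized K ix .
  have ne: "geometric_realization K \<noteq> {}"
  proof -
    obtain h k where "homeomorphic_maps (nsphere n) X h k"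
      using hom homeomorphic_space_sym homeomorphic_space_def by metis
    then have "h (\<lambda>n. if n = 0 then 1 else 0) \<in> topspace X"
      using in_topspace_nsphere[of n] by (auto simp: homeomorphic_maps_def continuous_map_def)
    then show ?thesis by auto
  qed
  interpret realized_manifold K ix n
  proof
    fix b p assume b: "b \<in> geometric_realization K"
    then have bX: "b \<in> topspace X" by simp
    show "trivial_group (relative_homology_group (int p) X (geometric_realization K - {b}))" if "p \<noteq> n"
      using homology_sphere_point(1)[OF hom bX, of "int p"] that by simp
    show "trivial_group (relative_homology_group (int p) X {b})" if "p < n"
      using homology_sphere_point(3)[OF hom bX, of "int p"] that by simp
    show "cyclic_or_trivial n X (geometric_realization K - {b})"
      using homology_sphere_point(2)[OF hom bX] by simp
  qed (rule ne)
  interpret P: pseudo_acyclic V "insert {} K" "Suc n"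
    by (rule pseudo_acyclic) (use card_vertices_0[OF hom] in simp)
  show ?thesis
  proof
    fix \<rho> assume \<rho>: "\<rho> \<in> insert {} K" "Suc (card \<rho>) = Suc n"
    have eq: "{v \<in> V - \<rho>. insert v \<rho> \<in> insert {} K} = {v \<in> V - \<rho>. insert v \<rho> \<in> K}" by auto
    show "card {v \<in> V - \<rho>. insert v \<rho> \<in> insert {} K} = 2"
    proof (cases "\<rho> = {}")
      case True
      have "{v} \<in> K" if vV: "v \<in> V" for v
      proof -
        obtain \<sigma> where "\<sigma> \<in> K" "v \<in> \<sigma>" using vV by blast
        then show ?thesis using subface[of \<sigma> "{v}"] by simp
      qed
      then have "{v \<in> V - \<rho>. insert v \<rho> \<in> insert {} K} = V" using True by blast
      then show ?thesis using card_vertices_0[OF hom] \<rho>(2) True by simp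
    next
      case False
      then have \<rho>K: "\<rho> \<in> K" using \<rho>(1) by simp
      obtain \<tau> where \<tau>: "\<tau> \<in> insert {} K" "\<rho> \<subseteq> \<tau>" "card \<tau> = Suc n" using \<rho>(1) by (rule P.pure)
      have "\<rho> \<noteq> \<tau>" using \<tau>(3) \<rho>(2) by auto
      then obtain v where v: "v \<in> \<tau>" "v \<notin> \<rho>" using \<tau>(2) by blast
      have "insert v \<rho> \<in> K" using v \<tau> subface[of \<tau> "insert v \<rho>"] by blast
      moreover from this have "v \<in> V" by blast
      ultimately have "v \<in> {v \<in> V - \<rho>. insert v \<rho> \<in> K}" using v by blast
      moreover have "finite {v \<in> V - \<rho>. insert v \<rho> \<in> K}"
        by (rule finite_subset[OF _ fin_V]) blast
      ultimately have "card {v \<in> V - \<rho>. insert v \<rho> \<in> K} > 0" by (metis card_gt_0_iff empty_iff)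
      moreover have "card {v \<in> V - \<rho>. insert v \<rho> \<in> K} \<noteq> 1"
        using ridge_not_one[OF hom \<rho>K] \<rho>(2) by simp
      moreover have "card {v \<in> V - \<rho>. insert v \<rho> \<in> K} \<le> 2" using ridge_face_le[OF \<rho>K] \<rho>(2) by simp
      ultimately show ?thesis unfolding eq by linarith
    qed
  qed
qed

theorem triangulated_ball_pseudo_acyclic:
  assumes "triangulated_ball n K" "n > 0"
  shows "pseudo_acyclic (\<Union>K) (insert {} K) (Suc n)"
proof -
  have K: "simplicial_complex K" and hom: "realization_top K homeomorphic_space nball n"
    using assms by (auto simp: triangulated_ball_def)
  obtain ix where "realized K ix" using ex_realized[OF K] .
  then interpret realized K ix .
  have ne: "geometric_realization K \<noteq> {}"
  proof -
    obtain h k where hk: "homeomorphic_maps (nball n) X h k"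
      using hom homeomorphic_space_sym homeomorphic_space_def by metis
    have "(\<lambda>i. 0) \<in> topspace (nball n)" by (simp add: nball_eq)
    then have "h (\<lambda>i. 0) \<in> topspace X" using hk by (auto simp: homeomorphic_maps_def continuous_map_def)
    then show ?thesis by auto
  qed
  interpret realized_manifold K ix n
  proof
    fix b p assume b: "b \<in> geometric_realization K"
    then have bX: "b \<in> topspace X" by simp
    show "trivial_group (relative_homology_group (int p) X (geometric_realization K - {b}))" if "p \<noteq> n"
      using homology_ball_point(1)[OF hom assms(2) bX, of "int p"] that by simp
    show "trivial_group (relative_homology_group (int p) X {b})" if "p < n"
      using homology_ball_point(3)[OF hom assms(2) bX, of "int p"] .
    show "cyclic_or_trivial n X (geometric_realization K - {b})"
      using homology_ball_point(2)[OF hom assms(2) bX] by simp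
  qed (rule ne)
  show ?thesis by (rule pseudo_acyclic) (use assms(2) in simp)
qed

section \<open>Relabelling vertices\<close>

lemma simplicial_complex_image:
  assumes "simplicial_complex K"
  shows "simplicial_complex ((`) f ` K)"
proof -
  have fin: "finite K" and ne: "\<And>\<sigma>. \<sigma> \<in> K \<Longrightarrow> finite \<sigma> \<and> \<sigma> \<noteq> {}"
    and down: "\<And>\<sigma> \<tau>. \<sigma> \<in> K \<Longrightarrow> \<tau> \<subseteq> \<sigma> \<Longrightarrow> \<tau> \<noteq> {} \<Longrightarrow> \<tau> \<in> K"
    using assms unfolding simplicial_complex_def by blast+
  have "\<tau> \<in> (`) f ` K" if "\<sigma> \<in> K" "\<tau> \<subseteq> f ` \<sigma>" "\<tau> \<noteq> {}" for \<sigma> \<tau>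
  proof -
    obtain \<rho> where \<rho>: "\<rho> \<subseteq> \<sigma>" "\<tau> = f ` \<rho>" using \<open>\<tau> \<subseteq> f ` \<sigma>\<close> by (auto simp: subset_image_iff)
    then have "\<rho> \<in> K" using down[OF \<open>\<sigma> \<in> K\<close>] \<open>\<tau> \<noteq> {}\<close> by simp
    then show ?thesis using \<rho>(2) by simp
  qed
  then show ?thesis using fin ne unfolding simplicial_complex_def by auto
qed

text \<open>Barycentric coordinates are transported along \<open>f\<close>. It serves to copy
  \<open>S\<close>, \<open>L\<close> and \<open>B\<close> into the sum type of the glued
  complex.\<close>

lemma realization_image_homeomorphic:
  assumes inj: "inj_on f (\<Union>K)"
  shows "realization_top ((`) f ` K) homeomorphic_space realization_top K"
proof -
  let ?V = "\<Union>K" and ?K = "(`) f ` K"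
  let ?F = "\<lambda>x w. if w \<in> f ` ?V then x (inv_into ?V f w) else (0::real)"
  let ?G = "\<lambda>y v. if v \<in> ?V then y (f v) else (0::real)"
  have inv: "inv_into ?V f (f v) = v" if "v \<in> ?V" for v using inj that by (rule inv_into_f_f)
  have coord: "continuous_map (realization_top J) euclideanreal (\<lambda>x. x u)" for J :: "'c set set" and u
    unfolding realization_top_def
    by (rule continuous_map_from_subtopology[OF continuous_map_product_projection]) simp
  have FK: "?F x \<in> cell (f ` \<sigma>)" if "\<sigma> \<in> K" "x \<in> cell \<sigma>" for x \<sigma>
  proof -
    have sub: "\<sigma> \<subseteq> ?V" using that by blast
    have "sum (?F x) (f ` \<sigma>) = (\<Sum>v\<in>\<sigma>. ?F x (f v))"
      using sum.reindex[OF inj_on_subset[OF inj sub], of "?F x"] by simp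
    also have "\<dots> = sum x \<sigma>"
    proof (rule sum.cong[OF refl])
      fix v assume "v \<in> \<sigma>"
      then have v: "v \<in> ?V" using sub by (rule subsetD[rotated])
      show "?F x (f v) = x v" unfolding if_P[OF imageI[OF v]] inv[OF v] ..
    qed
    finally have "sum (?F x) (f ` \<sigma>) = 1" using that(2) by (simp add: cell_def)
    moreover have "?F x w = 0" if "w \<notin> f ` \<sigma>" for w
    proof (cases "w \<in> f ` ?V")
      case True
      then obtain v where v: "v \<in> ?V" "w = f v" by blast
      then have "v \<notin> \<sigma>" using that by blast
      then have "x v = 0" using \<open>x \<in> cell \<sigma>\<close> by (simp add: cell_def)
      then show ?thesis unfolding v(2) if_P[OF imageI[OF v(1)]] inv[OF v(1)] by simp
    next
      case False
      then show ?thesis by (rule if_not_P)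
    qed
    moreover have "0 \<le> ?F x w" for w using that(2) by (simp add: cell_def)
    ultimately show ?thesis unfolding cell_def by blast
  qed
  have GK: "?G y \<in> cell \<sigma>" if "\<sigma> \<in> K" "y \<in> cell (f ` \<sigma>)" for y \<sigma>
  proof -
    have sub: "\<sigma> \<subseteq> ?V" using that by blast
    have "sum (?G y) \<sigma> = (\<Sum>v\<in>\<sigma>. y (f v))"
    proof (rule sum.cong[OF refl])
      fix v assume "v \<in> \<sigma>"
      then have v: "v \<in> ?V" using sub by (rule subsetD[rotated])
      show "?G y v = y (f v)" by (rule if_P[OF v])
    qed
    also have "\<dots> = sum y (f ` \<sigma>)"
      using sum.reindex[OF inj_on_subset[OF inj sub], of y] by simp
    finally have "sum (?G y) \<sigma> = 1" using that(2) by (simp add: cell_def)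
    moreover have "?G y v = 0" if "v \<notin> \<sigma>" for v
    proof (cases "v \<in> ?V")
      case True
      then have "f v \<notin> f ` \<sigma>" using that inj_on_image_mem_iff[OF inj _ sub] by blast
      then show ?thesis unfolding if_P[OF True] using \<open>y \<in> cell (f ` \<sigma>)\<close> by (simp add: cell_def)
    next
      case False
      then show ?thesis by (rule if_not_P)
    qed
    moreover have "0 \<le> ?G y v" for v using that(2) by (simp add: cell_def)
    ultimately show ?thesis unfolding cell_def by blast
  qed
  have "continuous_map (realization_top K) (powertop_real UNIV) ?F"
    unfolding continuous_map_componentwise_UNIV
  proof
    fix w show "continuous_map (realization_top K) euclideanreal (\<lambda>x. ?F x w)"
      by (cases "w \<in> f ` ?V") (simp_all only: if_True if_False coord continuous_map_canonical_const)
  qed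
  moreover have "?F \<in> topspace (realization_top K) \<rightarrow> geometric_realization ?K"
  proof
    fix x assume "x \<in> topspace (realization_top K)"
    then obtain \<sigma> where "\<sigma> \<in> K" "x \<in> cell \<sigma>"
      by (auto simp: realization_top_def geometric_realization_cells)
    then have "?F x \<in> cell (f ` \<sigma>)" "f ` \<sigma> \<in> ?K" using FK by auto
    then show "?F x \<in> geometric_realization ?K" unfolding geometric_realization_cells by blast
  qed
  ultimately have cF: "continuous_map (realization_top K) (realization_top ?K) ?F"
    unfolding realization_top_def[of ?K] continuous_map_in_subtopology by blast
  have "continuous_map (realization_top ?K) (powertop_real UNIV) ?G"
    unfolding continuous_map_componentwise_UNIV
  proof
    fix v show "continuous_map (realization_top ?K) euclideanreal (\<lambda>y. ?G y v)"
      by (cases "v \<in> ?V") (simp_all only: if_True if_False coord continuous_map_canonical_const)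
  qed
  moreover have "?G \<in> topspace (realization_top ?K) \<rightarrow> geometric_realization K"
  proof
    fix y assume "y \<in> topspace (realization_top ?K)"
    then obtain \<sigma> where "\<sigma> \<in> K" "y \<in> cell (f ` \<sigma>)"
      by (auto simp: realization_top_def geometric_realization_cells)
    then have "?G y \<in> cell \<sigma>" "\<sigma> \<in> K" using GK by auto
    then show "?G y \<in> geometric_realization K" unfolding geometric_realization_cells by blast
  qed
  ultimately have cG: "continuous_map (realization_top ?K) (realization_top K) ?G"
    unfolding realization_top_def[of K] continuous_map_in_subtopology by blast
  have GF: "?G (?F x) = x" if "x \<in> topspace (realization_top K)" for x
  proof
    fix v
    obtain \<sigma> where \<sigma>: "\<sigma> \<in> K" "x \<in> cell \<sigma>"
      using \<open>x \<in> topspace (realization_top K)\<close> by (auto simp: realization_top_def geometric_realization_cells)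
    show "?G (?F x) v = x v"
    proof (cases "v \<in> ?V")
      case True
      show ?thesis unfolding if_P[OF True] if_P[OF imageI[OF True]] inv[OF True] ..
    next
      case False
      then have "v \<notin> \<sigma>" using \<sigma>(1) by blast
      then show ?thesis unfolding if_not_P[OF False] using \<sigma>(2) by (simp add: cell_def)
    qed
  qed
  have FG: "?F (?G y) = y" if "y \<in> topspace (realization_top ?K)" for y
  proof
    fix w
    obtain \<sigma> where \<sigma>: "\<sigma> \<in> K" "y \<in> cell (f ` \<sigma>)"
      using \<open>y \<in> topspace (realization_top ?K)\<close> by (auto simp: realization_top_def geometric_realization_cells)
    show "?F (?G y) w = y w"
    proof (cases "w \<in> f ` ?V")
      case True
      then obtain v where v: "v \<in> ?V" "w = f v" by blast
      show ?thesis unfolding v(2) if_P[OF imageI[OF v(1)]] inv[OF v(1)] if_P[OF v(1)] ..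
    next
      case False
      then have "w \<notin> f ` \<sigma>" using \<sigma>(1) by blast
      then show ?thesis unfolding if_not_P[OF False] using \<sigma>(2) by (simp add: cell_def)
    qed
  qed
  have "homeomorphic_maps (realization_top ?K) (realization_top K) ?G ?F"
    unfolding homeomorphic_maps_def using cF cG GF FG by blast
  then show ?thesis by (rule homeomorphic_maps_imp_homeomorphic_space)
qed

lemma triangulated_sphere_image:
  assumes "triangulated_sphere n K" "inj_on f (\<Union>K)"
  shows "triangulated_sphere n ((`) f ` K)"
  using assms simplicial_complex_image realization_image_homeomorphic[OF assms(2)]
  unfolding triangulated_sphere_def by (blast intro: homeomorphic_space_trans)

lemma triangulated_ball_image:
  assumes "triangulated_ball n K" "inj_on f (\<Union>K)"
  shows "triangulated_ball n ((`) f ` K)"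
  using assms simplicial_complex_image realization_image_homeomorphic[OF assms(2)]
  unfolding triangulated_ball_def by (blast intro: homeomorphic_space_trans)

section \<open>Enlarging the vertex set\<close>

context pseudo_acyclic begin

text \<open>Members of \<open>K\<close> use only vertices of \<open>V\<close>, so additional
  vertices contribute 0. The gluing argument needs one vertex set for all complexes.\<close>

lemma bd_extend:
  assumes "V \<subseteq> V'" "finite V'" "chn A k c" "A \<subseteq> K"
  shows "bd V' c \<rho> = bd V c \<rho>"
  unfolding bd_def
proof (rule sum.mono_neutral_right)
  show "\<forall>v\<in>V' - \<rho> - (V - \<rho>). c (insert v \<rho>) = 0"
  proof (rule ballI, rule ccontr)
    fix v assume v: "v \<in> V' - \<rho> - (V - \<rho>)" and "c (insert v \<rho>) \<noteq> 0"
    then have "insert v \<rho> \<in> K" using chnD[OF assms(3)] assms(4) by blast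
    then show False using v K_sub by blast
  qed
qed (use assms in auto)

lemma acyc_extend:
  assumes V: "V \<subseteq> V'" "finite V'" and A: "A \<subseteq> K" and ac: "acyc V A k"
  shows "acyc V' A k"
proof (rule acycI)
  fix c assume c: "chn A k c" and z: "\<And>\<rho>. \<rho> \<in> A \<Longrightarrow> bd V' c \<rho> = 0"
  have "bd V c \<rho> = 0" if "\<rho> \<in> A" for \<rho> using z[OF that] bd_extend[OF V c A] by simp
  from acycD[OF ac c this] obtain y where y: "chn A (Suc k) y" "\<forall>\<rho>\<in>A. bd V y \<rho> = c \<rho>" by blast
  then show "\<exists>y. chn A (Suc k) y \<and> (\<forall>\<rho>\<in>A. bd V' y \<rho> = c \<rho>)"
    using bd_extend[OF V y(1) A] by (intro exI[of _ y]) simp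
qed

lemma pseudo_acyclic_extend:
  assumes V: "V \<subseteq> V'" "finite V'"
  shows "pseudo_acyclic V' K m"
    and "\<And>\<rho>. {v\<in>V' - \<rho>. insert v \<rho> \<in> K} = {v\<in>V - \<rho>. insert v \<rho> \<in> K}"
proof -
  show eq: "{v\<in>V' - \<rho>. insert v \<rho> \<in> K} = {v\<in>V - \<rho>. insert v \<rho> \<in> K}" for \<rho>
    using V K_sub by blast
  show "pseudo_acyclic V' K m"
  proof
    show "finite V'" by (rule V(2))
    show "K \<subseteq> Pow V'" using K_sub V(1) by blast
    show "{} \<in> K" by (rule empty_in)
    show "\<tau> \<in> K" if "\<sigma> \<in> K" "\<tau> \<subseteq> \<sigma>" for \<sigma> \<tau> using that by (rule down)
    show "card \<sigma> \<le> m" if "\<sigma> \<in> K" for \<sigma> using that by (rule card_le)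
    show "acyc V' (star K \<alpha>) k" if "\<alpha> \<in> K" "k < m" for \<alpha> k
      by (rule acyc_extend[OF V _ star_acyc[OF that]]) auto
    show "card {v \<in> V' - \<rho>. insert v \<rho> \<in> K} \<le> 2" if "\<rho> \<in> K" "Suc (card \<rho>) = m" for \<rho>
      unfolding eq using that by (rule ridge_le)
  qed
qed

text \<open>Translates between completing vertices, as counted by \<open>ridge_le\<close>, and
  cofaces, as counted in \<open>ball_boundary\<close>.\<close>

lemma card_cofaces:
  assumes "\<rho> \<in> K"
  shows "card {v\<in>V - \<rho>. insert v \<rho> \<in> K} = card {\<sigma>\<in>K. card \<sigma> = Suc (card \<rho>) \<and> \<rho> \<subseteq> \<sigma>}"
proof (rule bij_betw_same_card[of "\<lambda>v. insert v \<rho>"], unfold bij_betw_def, intro conjI)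
  have f: "finite \<rho>" using fin_face[OF assms] .
  show "inj_on (\<lambda>v. insert v \<rho>) {v \<in> V - \<rho>. insert v \<rho> \<in> K}" by (auto simp: inj_on_def)
  show "(\<lambda>v. insert v \<rho>) ` {v \<in> V - \<rho>. insert v \<rho> \<in> K} = {\<sigma> \<in> K. card \<sigma> = Suc (card \<rho>) \<and> \<rho> \<subseteq> \<sigma>}"
  proof (intro equalityI subsetI)
    fix \<sigma> assume \<sigma>: "\<sigma> \<in> {\<sigma> \<in> K. card \<sigma> = Suc (card \<rho>) \<and> \<rho> \<subseteq> \<sigma>}"
    then have "card (\<sigma> - \<rho>) = 1" using f by (simp add: card_Diff_subset)
    then obtain v where v: "\<sigma> - \<rho> = {v}" by (auto simp: card_1_singleton_iff)
    then have "\<sigma> = insert v \<rho>" "v \<notin> \<rho>" using \<sigma> by auto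
    then show "\<sigma> \<in> (\<lambda>v. insert v \<rho>) ` {v \<in> V - \<rho>. insert v \<rho> \<in> K}" using \<sigma> K_sub by auto
  next
    fix \<sigma> assume "\<sigma> \<in> (\<lambda>v. insert v \<rho>) ` {v \<in> V - \<rho>. insert v \<rho> \<in> K}"
    then show "\<sigma> \<in> {\<sigma> \<in> K. card \<sigma> = Suc (card \<rho>) \<and> \<rho> \<subseteq> \<sigma>}" using f by auto
  qed
qed

end

lemma (in homology_sphere) homology_sphere_extend:
  assumes V: "V \<subseteq> V'" "finite V'"
  shows "homology_sphere V' K m"
proof -
  interpret P: pseudo_acyclic V' K m by (rule pseudo_acyclic_extend(1)[OF V])
  show ?thesis
  proof
    fix \<rho> assume "\<rho> \<in> K" "Suc (card \<rho>) = m"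
    then show "card {v \<in> V' - \<rho>. insert v \<rho> \<in> K} = 2"
      unfolding pseudo_acyclic_extend(2)[OF V] by (rule ridge)
  qed
qed

section \<open>The theorem\<close>

text \<open>The boundary of a 0-ball is empty, so a vertex of \<open>B\<close> joins the two
  vertices of \<open>S\<close>, and a 0-sphere has no third vertex.\<close>

lemma no_glued_0_skeleton:
  assumes S: "triangulated_sphere 0 S" and B: "triangulated_ball 0 B" and T: "triangulated_sphere 0 T"
  shows "skeleton 0 T \<noteq> glued_complex 0 S B (ball_boundary 0 B) g"
proof
  assume eq: "skeleton 0 T = glued_complex 0 S B (ball_boundary 0 B) g"
  interpret S: homology_sphere "\<Union>S" "insert {} S" "Suc 0" by (rule triangulated_sphere_homology_sphere[OF S])
  interpret T: homology_sphere "\<Union>T" "insert {} T" "Suc 0" by (rule triangulated_sphere_homology_sphere[OF T])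
  have sB: "simplicial_complex B" and hB: "realization_top B homeomorphic_space nball 0"
    using B by (auto simp: triangulated_ball_def)
  have bd0: "ball_boundary 0 B = {}"
  proof -
    have "card \<rho> \<noteq> 0" if "\<rho> \<in> B" for \<rho> using sB that by (auto simp: simplicial_complex_def)
    then show ?thesis by (auto simp: ball_boundary_def)
  qed
  have "B \<noteq> {}"
  proof
    assume "B = {}"
    obtain h k where hk: "homeomorphic_maps (nball 0) (realization_top B) h k"
      using hB homeomorphic_space_sym homeomorphic_space_def by metis
    have "(\<lambda>i. 0) \<in> topspace (nball 0)" by (simp add: nball_eq)
    then have "h (\<lambda>i. 0) \<in> topspace (realization_top B)" using hk by (auto simp: homeomorphic_maps_def continuous_map_def)
    then show False using \<open>B = {}\<close> by (simp add: realization_top_def geometric_realization_def)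
  qed
  then obtain \<beta> where \<beta>: "\<beta> \<in> B" by blast
  have downB: "\<forall>\<sigma>\<in>B. \<forall>\<tau>. \<tau> \<subseteq> \<sigma> \<and> \<tau> \<noteq> {} \<longrightarrow> \<tau> \<in> B" and "\<forall>\<sigma>\<in>B. \<sigma> \<noteq> {}"
    using sB unfolding simplicial_complex_def by blast+
  then have "\<beta> \<noteq> {}" using \<beta> by simp
  then obtain b where b: "b \<in> \<beta>" by blast
  have "{b} \<in> B" using downB[rule_format, OF \<beta>, of "{b}"] b by simp
  have inT: "glued_complex 0 S B (ball_boundary 0 B) g \<subseteq> T"
    unfolding eq[symmetric] skeleton_def by blast
  have "glue_vertex (ball_boundary 0 B) g ` {b} \<in> glued_complex 0 S B (ball_boundary 0 B) g"
    using \<open>{b} \<in> B\<close> unfolding glued_complex_def by blast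
  then have "glue_vertex (ball_boundary 0 B) g ` {b} \<in> T" by (rule subsetD[OF inT])
  then have bT: "{Inr b} \<in> T" by (simp add: glue_vertex_def bd0 vertices_def)
  have "card {v \<in> \<Union>S - {}. insert v {} \<in> insert {} S} = 2" by (rule S.ridge) simp_all
  then obtain x y where xy: "{v \<in> \<Union>S - {}. insert v {} \<in> insert {} S} = {x, y}" "x \<noteq> y" by (auto simp: card_2_iff)
  then have "{x} \<in> S" "{y} \<in> S" by auto
  then have "Inl ` {x} \<in> glued_complex 0 S B (ball_boundary 0 B) g" "Inl ` {y} \<in> glued_complex 0 S B (ball_boundary 0 B) g"
    unfolding glued_complex_def by (auto simp: skeleton_def)
  then have "Inl ` {x} \<in> T" "Inl ` {y} \<in> T" by (blast intro: subsetD[OF inT])+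
  then have xyT: "{Inl x} \<in> T" "{Inl y} \<in> T" by simp_all
  have sub: "{Inl x, Inl y, Inr b} \<subseteq> {v \<in> \<Union>T - {}. insert v {} \<in> insert {} T}" using bT xyT by blast
  have c: "card {v \<in> \<Union>T - {}. insert v {} \<in> insert {} T} = 2" by (rule T.ridge) simp_all
  have fin: "finite {v \<in> \<Union>T - {}. insert v {} \<in> insert {} T}" by (rule finite_subset[OF _ T.fin_V]) blast
  have "card {Inl x, Inl y, Inr b} \<le> 2" using card_mono[OF fin sub] unfolding c .
  then show False using xy(2) by simp
qed

text \<open>\<open>S\<close> and \<open>L\<close> are copied by \<open>Inl\<close> and
  \<open>B\<close> by \<open>glue_vertex\<close>, which is injective because \<open>g\<close> is
  injective on boundary vertices. The copies are then shown to satisfy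
  \<open>glued_skeleton\<close>.\<close>

lemma glued_skeleton_sphere:
  fixes S L :: "'a set set" and B :: "'b set set" and T :: "('a + 'b) set set"
  assumes d: "d > 0"
    and S: "triangulated_sphere (2 * d) S" and L_induced: "induced_subcomplex L S"
    and L: "triangulated_sphere (d - 1) L" and B: "triangulated_ball d B"
    and g: "simplicial_isomorphism g (ball_boundary d B) L"
    and T: "triangulated_sphere (2 * d) T"
    and sk: "skeleton d T = glued_complex d S B (ball_boundary d B) g"
  shows False
proof -
  let ?dB = "ball_boundary d B"
  let ?h = "glue_vertex ?dB g"
  let ?S = "(`) (Inl :: 'a \<Rightarrow> 'a + 'b) ` S" and ?L = "(`) (Inl :: 'a \<Rightarrow> 'a + 'b) ` L" and ?B = "(`) ?h ` B"
  define V where "V = \<Union>?S \<union> \<Union>?L \<union> \<Union>?B \<union> \<Union>T"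
  have sB: "simplicial_complex B" using B by (simp add: triangulated_ball_def)
  obtain W where W: "L = {\<sigma>\<in>S. \<sigma> \<subseteq> W}" using L_induced by (auto simp: induced_subcomplex_def)
  have g_bij: "bij_betw g (\<Union>?dB) (\<Union>L)" and g_iff: "\<And>\<sigma>. \<sigma> \<subseteq> \<Union>?dB \<Longrightarrow> \<sigma> \<in> ?dB \<longleftrightarrow> g ` \<sigma> \<in> L"
    using g by (auto simp: simplicial_isomorphism_def vertices_def)
  have h_in: "?h v = Inl (g v)" if "v \<in> \<Union>?dB" for v using that by (simp add: glue_vertex_def vertices_def)
  have h_out: "?h v = Inr v" if "v \<notin> \<Union>?dB" for v using that by (simp add: glue_vertex_def vertices_def)
  have h_Inl: "v \<in> \<Union>?dB \<and> x = g v" if "?h v = Inl x" for v x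
    using that h_in[of v] h_out[of v] by (cases "v \<in> \<Union>?dB") auto
  have h_inj: "inj ?h"
  proof (rule injI)
    fix v w assume eq: "?h v = ?h w"
    show "v = w"
    proof (cases "v \<in> \<Union>?dB")
      case True
      then have "?h w = Inl (g v)" using eq h_in by simp
      then have w: "w \<in> \<Union>?dB" "g v = g w" using h_Inl by auto
      show ?thesis using bij_betw_imp_inj_on[OF g_bij] True w by (auto dest: inj_onD)
    next
      case False
      then have "?h w = Inr v" using eq h_out by simp
      then show ?thesis using h_in[of w] h_out[of w] by (cases "w \<in> \<Union>?dB") auto
    qed
  qed
  have dB_B: "\<tau> \<in> B" if "\<tau> \<in> ?dB" for \<tau>
    using that sB unfolding ball_boundary_def simplicial_complex_def by blast
  have lift: "\<exists>\<tau>\<in>?dB. Inl ` l = ?h ` \<tau>" if "l \<in> L" for l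
  proof -
    have "l \<subseteq> g ` \<Union>?dB" using that g_bij by (auto simp: bij_betw_def)
    then obtain \<tau> where \<tau>: "\<tau> \<subseteq> \<Union>?dB" "l = g ` \<tau>" by (auto simp: subset_image_iff)
    have "?h ` \<tau> = Inl ` g ` \<tau>"
      unfolding image_image using \<tau>(1) h_in by (intro image_cong) auto
    moreover have "\<tau> \<in> ?dB" using g_iff[OF \<tau>(1)] \<tau>(2) that by simp
    ultimately show ?thesis using \<tau>(2) by (intro bexI[of _ \<tau>]) simp_all
  qed
  interpret S': homology_sphere "\<Union>?S" "insert {} ?S" "Suc (2 * d)"
    by (intro triangulated_sphere_homology_sphere triangulated_sphere_image S) simp
  interpret T': homology_sphere "\<Union>T" "insert {} T" "Suc (2 * d)"
    by (rule triangulated_sphere_homology_sphere[OF T])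
  have "homology_sphere (\<Union>?L) (insert {} ?L) (Suc (d - 1))"
    by (intro triangulated_sphere_homology_sphere triangulated_sphere_image L) simp
  then interpret L': homology_sphere "\<Union>?L" "insert {} ?L" d using d by simp
  interpret B': pseudo_acyclic "\<Union>?B" "insert {} ?B" "Suc d"
    by (intro triangulated_ball_pseudo_acyclic triangulated_ball_image B d inj_on_subset[OF h_inj]) simp
  have finV: "finite V" unfolding V_def
    using S'.fin_V L'.fin_V B'.fin_V T'.fin_V by (intro finite_UnI)
  interpret S: homology_sphere V "insert {} ?S" "Suc (2 * d)"
    by (rule S'.homology_sphere_extend[OF _ finV]) (auto simp: V_def)
  interpret T: homology_sphere V "insert {} T" "Suc (2 * d)"
    by (rule T'.homology_sphere_extend[OF _ finV]) (auto simp: V_def)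
  interpret L: homology_sphere V "insert {} ?L" d
    by (rule L'.homology_sphere_extend[OF _ finV]) (auto simp: V_def)
  interpret B: pseudo_acyclic V "insert {} ?B" "Suc d"
    by (rule B'.pseudo_acyclic_extend(1)[OF _ finV]) (auto simp: V_def)
  have inL: "l \<in> L" if "l \<in> S" "l \<subseteq> \<Union>L" for l
    using that W by blast
  \<comment> \<open>A face of \<open>L\<close> is the image of a boundary face, which lies in a
    ridge of \<open>B\<close> with one coface; \<open>B.star_acyc_free\<close> applies to all its
    subsets, the empty one included.\<close>
  have free: "acyc V (star (insert {} ?B) \<alpha>) k" if lL: "l \<in> L" and \<alpha>: "\<alpha> \<subseteq> Inl ` l" for l \<alpha> k
  proof -
    obtain \<tau> where \<tau>: "\<tau> \<in> ?dB" "Inl ` l = ?h ` \<tau>" using lift[OF lL] by blast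
    then obtain \<rho> where \<rho>: "\<rho> \<in> B" "card \<rho> = d" "\<tau> \<subseteq> \<rho>" "card {\<sigma>\<in>B. card \<sigma> = d + 1 \<and> \<rho> \<subseteq> \<sigma>} = 1"
      unfolding ball_boundary_def by blast
    have ch: "card (?h ` \<sigma>) = card \<sigma>" for \<sigma> by (rule card_image[OF inj_on_subset[OF h_inj]]) simp
    have \<rho>': "?h ` \<rho> \<in> insert {} ?B" using \<rho>(1) by blast
    have "{\<sigma> \<in> insert {} ?B. card \<sigma> = Suc (card (?h ` \<rho>)) \<and> ?h ` \<rho> \<subseteq> \<sigma>} =
      (`) ?h ` {\<sigma>\<in>B. card \<sigma> = d + 1 \<and> \<rho> \<subseteq> \<sigma>}" (is "?X = ?Y")
    proof (intro equalityI subsetI)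
      fix x assume x: "x \<in> ?X"
      then have "x \<noteq> {}" by auto
      with x obtain \<sigma> where \<sigma>: "\<sigma> \<in> B" "x = ?h ` \<sigma>" by auto
      then have "card \<sigma> = d + 1" "\<rho> \<subseteq> \<sigma>" using x \<rho>(2) ch inj_image_subset_iff[OF h_inj] by auto
      then show "x \<in> ?Y" using \<sigma> by blast
    next
      fix x assume "x \<in> ?Y"
      then obtain \<sigma> where "\<sigma> \<in> B" "card \<sigma> = d + 1" "\<rho> \<subseteq> \<sigma>" "x = ?h ` \<sigma>" by blast
      then show "x \<in> ?X" using ch \<rho>(2) by auto
    qed
    moreover have "card ?Y = card {\<sigma>\<in>B. card \<sigma> = d + 1 \<and> \<rho> \<subseteq> \<sigma>}"
      by (rule card_image) (use h_inj in \<open>auto simp: inj_on_def inj_image_eq_iff\<close>)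
    ultimately have "card {v\<in>V - ?h ` \<rho>. insert v (?h ` \<rho>) \<in> insert {} ?B} = 1"
      using B.card_cofaces[OF \<rho>'] \<rho>(4) by simp
    moreover have "\<alpha> \<subseteq> ?h ` \<rho>" using \<alpha> image_mono[OF \<rho>(3)] unfolding \<tau>(2) by (rule order_trans)
    moreover have "Suc (card (?h ` \<rho>)) = Suc d" using ch \<rho>(2) by simp
    ultimately show ?thesis by (intro B.star_acyc_free[OF _ \<rho>'])
  qed
  interpret glued_skeleton V d "insert {} ?S" "insert {} T" "insert {} ?L" "insert {} ?B" "\<Union>(insert {} ?L)"
  proof (rule glued_skeleton.intro[OF S.homology_sphere_axioms T.homology_sphere_axioms
        L.homology_sphere_axioms B.pseudo_acyclic_axioms], rule glued_skeleton_axioms.intro)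
    show "0 < d" by (rule d)
    show "insert {} ?L = {\<sigma> \<in> insert {} ?S. \<sigma> \<subseteq> \<Union>(insert {} ?L)}"
    proof (intro equalityI subsetI)
      fix \<sigma> assume "\<sigma> \<in> insert {} ?L"
      then show "\<sigma> \<in> {\<sigma> \<in> insert {} ?S. \<sigma> \<subseteq> \<Union>(insert {} ?L)}" using W by auto
    next
      fix \<sigma> assume \<sigma>: "\<sigma> \<in> {\<sigma> \<in> insert {} ?S. \<sigma> \<subseteq> \<Union>(insert {} ?L)}"
      show "\<sigma> \<in> insert {} ?L"
      proof (cases "\<sigma> = {}")
        case False
        then obtain l where l: "l \<in> S" "\<sigma> = Inl ` l" using \<sigma> by blast
        have "l \<subseteq> \<Union>L" using \<sigma> l(2) by auto
        then show ?thesis using inL l by blast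
      qed simp
    qed
    show "insert {} ?L \<subseteq> insert {} ?B"
    proof
      fix \<sigma> assume "\<sigma> \<in> insert {} ?L"
      then show "\<sigma> \<in> insert {} ?B" using lift dB_B by fastforce
    qed
    show "\<Union>(insert {} ?L) = \<Union>(insert {} ?L)" ..
    show "acyc V (star (insert {} ?B) \<alpha>) k" if aL: "\<alpha> \<in> insert {} ?L" for \<alpha> k
    proof (cases "\<alpha> = {}")
      case False
      then obtain l where "l \<in> L" "\<alpha> = Inl ` l" using aL by blast
      then show ?thesis by (intro free[of l]) simp_all
    next
      \<comment> \<open>The empty face lies below every face of \<open>L\<close>; purity and
        \<open>d > 0\<close> show that there is one.\<close>
      case True
      obtain \<phi> where "\<phi> \<in> insert {} ?L" "card \<phi> = d" using L.empty_in by (rule L.pure)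
      then obtain l where "l \<in> L" using d by auto
      then show ?thesis using True by (intro free[of l]) simp_all
    qed
    show "\<sigma> \<in> insert {} ?L" if SB: "\<sigma> \<in> insert {} ?S" "\<sigma> \<in> insert {} ?B" for \<sigma>
    proof (cases "\<sigma> = {}")
      case False
      then obtain s b where sb: "s \<in> S" "\<sigma> = Inl ` s" "b \<in> B" "\<sigma> = ?h ` b" using SB by blast
      have "s \<subseteq> \<Union>L"
      proof
        fix x assume "x \<in> s"
        then have "Inl x \<in> ?h ` b" using sb by auto
        then obtain v where "v \<in> b" "?h v = Inl x" by (metis imageE)
        then have "v \<in> \<Union>?dB" "x = g v" using h_Inl by auto
        then show "x \<in> \<Union>L" using bij_betwE[OF g_bij] by blast
      qed
      then show ?thesis using inL sb by blast
    qed simp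
    show "\<Union>(insert {} ?S) \<inter> \<Union>(insert {} ?B) \<subseteq> \<Union>(insert {} ?L)"
    proof
      fix z assume "z \<in> \<Union>(insert {} ?S) \<inter> \<Union>(insert {} ?B)"
      then obtain x v where "z = Inl x" "z = ?h v" by blast
      then have "v \<in> \<Union>?dB" "x = g v" using h_Inl[of v x] by auto
      then have "x \<in> \<Union>L" using bij_betwE[OF g_bij] by blast
      then show "z \<in> \<Union>(insert {} ?L)" using \<open>z = Inl x\<close> by auto
    qed
    show "\<tau> \<in> insert {} T \<longleftrightarrow> \<tau> \<in> insert {} ?S \<or> \<tau> \<in> insert {} ?B" if c: "card \<tau> \<le> Suc d" for \<tau>
    proof
      assume "\<tau> \<in> insert {} T"
      then have "\<tau> = {} \<or> \<tau> \<in> glued_complex d S B ?dB g"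
        using c unfolding sk[symmetric] skeleton_def by auto
      then show "\<tau> \<in> insert {} ?S \<or> \<tau> \<in> insert {} ?B" unfolding glued_complex_def skeleton_def by auto
    next
      assume "\<tau> \<in> insert {} ?S \<or> \<tau> \<in> insert {} ?B"
      then consider "\<tau> = {}" | s where "s \<in> S" "\<tau> = Inl ` s" | b where "b \<in> B" "\<tau> = ?h ` b" by (elim disjE insertE imageE) auto
      then show "\<tau> \<in> insert {} T"
      proof cases
        case 2
        then have "card s \<le> d + 1" using c by (simp add: card_image)
        then have "\<tau> \<in> glued_complex d S B ?dB g" using 2 unfolding glued_complex_def skeleton_def by auto
        then show ?thesis unfolding sk[symmetric] skeleton_def by blast
      next
        case 3
        then have "\<tau> \<in> glued_complex d S B ?dB g" unfolding glued_complex_def by auto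
        then show ?thesis unfolding sk[symmetric] skeleton_def by blast
      qed simp
    qed
  qed
  show False by (rule contradiction)
qed

theorem theorem4:
  fixes d :: nat
    and S L :: "'a set set"
    and B :: "'b set set"
    and g :: "'b \<Rightarrow> 'a"
  assumes S_sphere: "triangulated_sphere (2 * d) S"
    and L_induced: "induced_subcomplex L S"
    and L_sphere: "if d = 0 then L = {}
                   else realization_top L homeomorphic_space nsphere (d - 1)"
    and B_ball: "triangulated_ball d B"
    and g_iso: "simplicial_isomorphism g (ball_boundary d B) L"
  shows "\<not> (\<exists>T :: ('a + 'b) set set. triangulated_sphere (2 * d) T \<and>
             skeleton d T = glued_complex d S B (ball_boundary d B) g)"
proof (cases "d = 0")
  case True
  then show ?thesis using no_glued_0_skeleton[of S B _ g] S_sphere B_ball by auto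
next
  case False
  have "simplicial_complex S" using S_sphere by (simp add: triangulated_sphere_def)
  then have sS: "finite S" "\<forall>\<sigma>\<in>S. finite \<sigma> \<and> \<sigma> \<noteq> {}" "\<forall>\<sigma>\<in>S. \<forall>\<tau>. \<tau> \<subseteq> \<sigma> \<and> \<tau> \<noteq> {} \<longrightarrow> \<tau> \<in> S"
    unfolding simplicial_complex_def by blast+
  obtain W where W: "L = {\<sigma>\<in>S. \<sigma> \<subseteq> W}" using L_induced by (auto simp: induced_subcomplex_def)
  have "simplicial_complex L"
    unfolding simplicial_complex_def
  proof (intro conjI ballI allI impI)
    show "finite L" using sS(1) W by simp
    show "finite \<sigma>" "\<sigma> \<noteq> {}" if "\<sigma> \<in> L" for \<sigma> using sS(2) that W by blast+
    show "\<tau> \<in> L" if "\<sigma> \<in> L" "\<tau> \<subseteq> \<sigma> \<and> \<tau> \<noteq> {}" for \<sigma> \<tau> using sS(3) that W by blast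
  qed
  then have "triangulated_sphere (d - 1) L" using L_sphere False by (simp add: triangulated_sphere_def)
  then show ?thesis using glued_skeleton_sphere[of d S L B g] False assms by blast
qed

end
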